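(* (Wire substitution law.) Let $\Delta$ be a type environment, $P$ a process, $a$ a name and $b$ a bound name of the same polarity and type as $a$, with companion $\breve b$ not free in $P$. Suppose both processes below are typable under $\Delta$. Then $$(\nu b)\big([\breve b \leftrightarrow a]\mid P\big)\;\cong_\Delta\; P\{a/b\}.$$ (For an O-name $a$ this reads $(\nu\,\breve b\leftrightarrow b)([\breve b\to a]\mid P)\cong_\Delta P\{a/b\}$; for an I-name $a$ it reads $(\nu\,b\leftrightarrow\breve b)([a\to\breve b]\mid P)\cong_\Delta P\{a/b\}$ with $\breve b$ fresh for $P$.)
   Context: The calculus AW$\pi$. Names form a countably infinite set. Besides a distinguished set of success names, every name is either an I-name (may only be used as subject of an input) or an O-name (may only be used as subject of an output). Values are $v ::= a \mid \star$. Processes: $P ::= 0 \mid P \mid Q \mid a(x).P \mid \overline{b}\langle v\rangle \mid (\nu\, a \leftrightarrow b : T)P \mid\ !a(x).P$. Input and restriction are binders. In $(\nu\, a\leftrightarrow b)P$ $a$ is an I-name and $b$ an O-name, called companions. For a bound name $c$, $\breve c$ denotes its companion, and $(\nu c)$ abbreviates $(\nu\, c\leftrightarrow \breve c)$ or $(\nu\, \breve c\leftrightarrow c)$ according to the polarity of $c$. $P\{a/b\}$ is capture-avoiding substitution. Success names are O-names carrying only $\star$, never restricted; a closed process has only success names free. Bound names are distinct from each other and from free names. Types: $T ::= o\,T \mid i\,T \mid \mathsf{unit}$; the dual of $o\,T$ is $i\,T$ and vice versa. A type environment is a finite set of bindings $a:T$; $I(\Gamma)$ is the set of names with input type in $\Gamma$;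 $\Gamma_1,\Gamma_2$ is defined only if they agree on shared names. Typing rules: $\Gamma\vdash 0$; if $\Gamma_1\vdash P_1$, $\Gamma_2\vdash P_2$, $I(\Gamma_1)\cap I(\Gamma_2)=\emptyset$ then $\Gamma_1,\Gamma_2\vdash P_1\mid P_2$; if $\Gamma,a:i\,T,b:o\,T\vdash P$ then $\Gamma\vdash(\nu\,a\leftrightarrow b:i\,T)P$; $\Gamma,a:o\,T,b:T\vdash \overline{a}\langle b\rangle$; if $\Gamma,a:i\,T,b:T\vdash P$ then $\Gamma,a:i\,T\vdash a(b).P$; if $\Gamma_o,b:T\vdash P$ with $\Gamma_o$ assigning only output types, then $\Gamma_o,a:i\,T,\Gamma'\vdash\ !a(b).P$. Reduction: structural congruence $\equiv$ is the least congruence with $|$ associative, commutative with unit $0$, $P\mid(\nu\,a\leftrightarrow b)Q\equiv(\nu\,a\leftrightarrow b)(P\mid Q)$ if $a,b\notin\mathrm{fn}(P)$, restrictions commute, $(\nu\,a\leftrightarrow b)0\equiv 0$. Reduction $\to$ is closed under $|$, restriction and $\equiv$, with $(\nu\,a\leftrightarrow b)(a(x).P\mid\overline{b}\langle v\rangle\mid Q)\to(\nu\,a\leftrightarrow b)(P\{v/x\}\mid Q)$ and $(\nu\,a\leftrightarrow b)(!a(x).P\mid\overline{b}\langle v\rangle\mid Q)\to(\nu\,a\leftrightarrow b)(!a(x).P\mid P\{v/x\}\mid Q)$; $\Rightarrow$ is its reflexive-transitive closure. $P\downarrow_\omega$ ($\omega$ a success name) if $P\equiv\overline{\omega}\langle\star\rangle\mid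 P'$; $P\Downarrow_\omega$ if $P\Rightarrow P''\downarrow_\omega$. Barbed bisimilarity $\approx$ is the largest symmetric relation on closed processes such that $P\approx Q$ and $P\downarrow_\omega$ imply $Q\Downarrow_\omega$, and $P\to P'$ implies $Q\Rightarrow Q'$ with $P'\approx Q'$. Barbed congruence: an extension of $\Delta$ is $\Delta,\Delta'$ with $\Delta'$ containing only O-names. A context $C$ is closing for $\Delta$ if $\Gamma\vdash C$ for some $\Gamma$ containing only success names, assuming the hole typable under an extension of $\Delta$. A connection set $\delta$ is a finite set of pairs $a\leftrightarrow b$; $C$ respects $\delta$ if every pair of $\delta$ is a restriction of $C$ whose scope contains the hole. For $\Delta\vdash P,Q$, $P\cong^\delta_\Delta Q$ iff $C[P]\approx C[Q]$ for every context $C$ closing for $\Delta$ and respecting $\delta$; $\cong_\Delta$ is $\cong^\emptyset_\Delta$. Wires: for an I-name $a$ and O-name $b$ of dual types, $[a\to b] := !a(x).\overline{b}\langle x\rangle$; $[p\leftrightarrow q]$ denotes $[p\to q]$ or $[q\to p]$, whichever has an I-name as source. *)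

theory Defs
  imports Main
begin

section \<open>Names, values, processes\<close>

text \<open>
  The polarity of a name is part of its syntax; success names are O-names of a special kind.
\<close>

datatype name = IName nat | OName nat | Success nat

fun is_I :: "name \<Rightarrow> bool" where
  "is_I (IName _) \<longleftrightarrow> True"
| "is_I _ \<longleftrightarrow> False"

abbreviation is_O :: "name \<Rightarrow> bool" where
  "is_O c \<equiv> \<not> is_I c"

fun is_success :: "name \<Rightarrow> bool" where
  "is_success (Success _) \<longleftrightarrow> True"
| "is_success _ \<longleftrightarrow> False"

fun with_index :: "name \<Rightarrow> nat \<Rightarrow> name" where
  "with_index (IName _) n = IName n"
| "with_index (OName _) n = OName n"
| "with_index (Success _) n = Success n"

definition same_sort :: "name \<Rightarrow> name \<Rightarrow> bool" where
  "same_sort c d \<longleftrightarrow> (\<exists>n. d = with_index c n)"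

datatype ty = TO ty | TI ty | Unit

datatype val = Nm name | Star

text \<open>
  Processes are raw terms. The convention that bound names are distinct from each other and from
  the free names is rendered by working up to alpha-conversion: it is part of structural
  congruence, substitution is capture-avoiding, and an inner binder shadows outer occurrences of
  the same name. The grammar's restrictions on the polarity of names are imposed by typing.

  In \<open>Res a b T P\<close>, i.e. \<open>(\<nu> a \<leftrightarrow> b : T) P\<close>, the I-name \<open>a\<close> comes first and \<open>T\<close> is its type.
\<close>

datatype proc =
    Zero
  | Par proc proc
  | In name name proc
  | Out name val
  | Res name name ty proc
  | Rep name name proc

fun names_val :: "val \<Rightarrow> name set" where
  "names_val (Nm c) = {c}"
| "names_val Star = {}"

fun fn :: "proc \<Rightarrow> name set" where
  "fn Zero = {}"
| "fn (Par P Q) = fn P \<union> fn Q"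
| "fn (In a x P) = {a} \<union> (fn P - {x})"
| "fn (Out a v) = {a} \<union> names_val v"
| "fn (Res a b T P) = fn P - {a, b}"
| "fn (Rep a x P) = {a} \<union> (fn P - {x})"

section \<open>Capture-avoiding substitution\<close>

text \<open>The first name of the same sort as \<open>c\<close> that is not in the (finite) set \<open>A\<close>.\<close>

definition fresh_name :: "name \<Rightarrow> name set \<Rightarrow> name" where
  "fresh_name c A = with_index c (LEAST n. with_index c n \<notin> A)"

definition names_image :: "(name \<Rightarrow> val) \<Rightarrow> name set \<Rightarrow> name set" where
  "names_image \<sigma> A = (\<Union>c\<in>A. names_val (\<sigma> c))"

fun subst_val :: "(name \<Rightarrow> val) \<Rightarrow> val \<Rightarrow> val" where
  "subst_val \<sigma> (Nm c) = \<sigma> c"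
| "subst_val \<sigma> Star = Star"

text \<open>
  \<open>\<star>\<close> cannot be a subject; the dummy second case is never met in typed processes.
\<close>

definition subst_subj :: "(name \<Rightarrow> val) \<Rightarrow> name \<Rightarrow> name" where
  "subst_subj \<sigma> c = (case \<sigma> c of Nm d \<Rightarrow> d | Star \<Rightarrow> c)"

text \<open>
  Simultaneous substitution in the style of Stoughton: every binder is renamed to the first name
  of its sort that is not free in the result, so nothing is captured, and the result
  depends only on the alpha-equivalence class of the argument.
\<close>

primrec psubst :: "(name \<Rightarrow> val) \<Rightarrow> proc \<Rightarrow> proc" where
  "psubst \<sigma> Zero = Zero"
| "psubst \<sigma> (Par P Q) = Par (psubst \<sigma> P) (psubst \<sigma> Q)"
| "psubst \<sigma> (In a x P) =
     (let x' = fresh_name x (names_image \<sigma> (fn P - {x}))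
      in In (subst_subj \<sigma> a) x' (psubst (\<sigma>(x := Nm x')) P))"
| "psubst \<sigma> (Out a v) = Out (subst_subj \<sigma> a) (subst_val \<sigma> v)"
| "psubst \<sigma> (Res a b T P) =
     (let A = names_image \<sigma> (fn P - {a, b});
          a' = fresh_name a A;
          b' = fresh_name b (insert a' A)
      in Res a' b' T (psubst (\<sigma>(a := Nm a', b := Nm b')) P))"
| "psubst \<sigma> (Rep a x P) =
     (let x' = fresh_name x (names_image \<sigma> (fn P - {x}))
      in Rep (subst_subj \<sigma> a) x' (psubst (\<sigma>(x := Nm x')) P))"

abbreviation subst :: "proc \<Rightarrow> val \<Rightarrow> name \<Rightarrow> proc"  ("_\<lbrace>_'/_\<rbrace>" [1000, 0, 0] 1000) where
  "P\<lbrace>v/x\<rbrace> \<equiv> psubst (Nm(x := v)) P"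

section \<open>Typing\<close>

type_synonym env = "name \<Rightarrow> ty option"

fun well_sorted :: "name \<Rightarrow> ty \<Rightarrow> bool" where
  "well_sorted (IName _) T \<longleftrightarrow> (\<exists>U. T = TI U) \<or> T = Unit"
| "well_sorted (OName _) T \<longleftrightarrow> (\<exists>U. T = TO U) \<or> T = Unit"
| "well_sorted (Success _) T \<longleftrightarrow> T = TO Unit"

definition type_env :: "env \<Rightarrow> bool" where
  "type_env \<Gamma> \<longleftrightarrow> finite (dom \<Gamma>) \<and> (\<forall>c T. \<Gamma> c = Some T \<longrightarrow> well_sorted c T)"

definition inputs :: "env \<Rightarrow> name set" where
  "inputs \<Gamma> = {c. \<exists>T. \<Gamma> c = Some (TI T)}"

text \<open>\<open>\<Gamma>\<^sub>1, \<Gamma>\<^sub>2\<close> is rendered as \<open>\<Gamma>\<^sub>1 ++ \<Gamma>\<^sub>2\<close> and is defined only under this condition.\<close>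

definition agree :: "env \<Rightarrow> env \<Rightarrow> bool" where
  "agree \<Gamma>\<^sub>1 \<Gamma>\<^sub>2 \<longleftrightarrow> (\<forall>c \<in> dom \<Gamma>\<^sub>1 \<inter> dom \<Gamma>\<^sub>2. \<Gamma>\<^sub>1 c = \<Gamma>\<^sub>2 c)"

fun has_type :: "env \<Rightarrow> val \<Rightarrow> ty \<Rightarrow> bool" where
  "has_type \<Gamma> (Nm c) T \<longleftrightarrow> \<Gamma> c = Some T"
| "has_type \<Gamma> Star T \<longleftrightarrow> T = Unit"

definition legal_res :: "name \<Rightarrow> name \<Rightarrow> ty \<Rightarrow> bool" where
  "legal_res a b T \<longleftrightarrow> is_I a \<and> is_O b \<and> \<not> is_success b \<and> (\<exists>U. T = TI U)"

definition output_env :: "env \<Rightarrow> bool" where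
  "output_env \<Gamma> \<longleftrightarrow> (\<forall>T \<in> ran \<Gamma>. \<exists>U. T = TO U)"

text \<open>
  Bound names override the environment (they may be assumed not to occur in it, by
  alpha-conversion). In \<open>T_Rep\<close>, \<open>\<Gamma>\<close> is \<open>\<Gamma>\<^sub>o, a : TI T, \<Gamma>'\<close> for an arbitrary \<open>\<Gamma>'\<close>.
\<close>

inductive typing :: "env \<Rightarrow> proc \<Rightarrow> bool"  (infix "\<turnstile>" 50) where
  T_Zero: "type_env \<Gamma> \<Longrightarrow> \<Gamma> \<turnstile> Zero"
| T_Par: "\<lbrakk>\<Gamma>\<^sub>1 \<turnstile> P; \<Gamma>\<^sub>2 \<turnstile> Q; agree \<Gamma>\<^sub>1 \<Gamma>\<^sub>2; inputs \<Gamma>\<^sub>1 \<inter> inputs \<Gamma>\<^sub>2 = {}\<rbrakk>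
    \<Longrightarrow> \<Gamma>\<^sub>1 ++ \<Gamma>\<^sub>2 \<turnstile> Par P Q"
| T_Res: "\<lbrakk>type_env \<Gamma>; legal_res a b (TI T); \<Gamma>(a \<mapsto> TI T, b \<mapsto> TO T) \<turnstile> P\<rbrakk>
    \<Longrightarrow> \<Gamma> \<turnstile> Res a b (TI T) P"
| T_Out: "\<lbrakk>type_env \<Gamma>; \<Gamma> a = Some (TO T); has_type \<Gamma> v T\<rbrakk> \<Longrightarrow> \<Gamma> \<turnstile> Out a v"
| T_In: "\<lbrakk>type_env \<Gamma>; \<Gamma> a = Some (TI T); \<not> is_success x; \<Gamma>(x \<mapsto> T) \<turnstile> P\<rbrakk>
    \<Longrightarrow> \<Gamma> \<turnstile> In a x P"
| T_Rep: "\<lbrakk>type_env \<Gamma>; \<Gamma> a = Some (TI T); \<not> is_success x;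
           \<Gamma>\<^sub>o \<subseteq>\<^sub>m \<Gamma>; output_env \<Gamma>\<^sub>o; \<Gamma>\<^sub>o(x \<mapsto> T) \<turnstile> P\<rbrakk>
    \<Longrightarrow> \<Gamma> \<turnstile> Rep a x P"

section \<open>Structural congruence and reduction\<close>

inductive scong :: "proc \<Rightarrow> proc \<Rightarrow> bool" where
  sc_refl: "scong P P"
| sc_sym: "scong P Q \<Longrightarrow> scong Q P"
| sc_trans: "\<lbrakk>scong P Q; scong Q R\<rbrakk> \<Longrightarrow> scong P R"
| sc_cong_Par: "\<lbrakk>scong P P'; scong Q Q'\<rbrakk> \<Longrightarrow> scong (Par P Q) (Par P' Q')"
| sc_cong_In: "scong P P' \<Longrightarrow> scong (In a x P) (In a x P')"
| sc_cong_Res: "scong P P' \<Longrightarrow> scong (Res a b T P) (Res a b T P')"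
| sc_cong_Rep: "scong P P' \<Longrightarrow> scong (Rep a x P) (Rep a x P')"
| sc_alpha_In: "\<lbrakk>same_sort x y; y \<notin> fn P - {x}\<rbrakk>
    \<Longrightarrow> scong (In a x P) (In a y (P\<lbrace>Nm y/x\<rbrace>))"
| sc_alpha_Rep: "\<lbrakk>same_sort x y; y \<notin> fn P - {x}\<rbrakk>
    \<Longrightarrow> scong (Rep a x P) (Rep a y (P\<lbrace>Nm y/x\<rbrace>))"
| sc_alpha_Res: "\<lbrakk>a \<noteq> b; a' \<noteq> b'; same_sort a a'; same_sort b b'; {a', b'} \<inter> (fn P - {a, b}) = {}\<rbrakk>
    \<Longrightarrow> scong (Res a b T P) (Res a' b' T (psubst (Nm(a := Nm a', b := Nm b')) P))"
| sc_Par_assoc: "scong (Par (Par P Q) R) (Par P (Par Q R))"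
| sc_Par_comm: "scong (Par P Q) (Par Q P)"
| sc_Par_Zero: "scong (Par P Zero) P"
| sc_extrude: "\<lbrakk>a \<notin> fn P; b \<notin> fn P\<rbrakk> \<Longrightarrow> scong (Par P (Res a b T Q)) (Res a b T (Par P Q))"
| sc_Res_comm: "{a, b} \<inter> {c, d} = {}
    \<Longrightarrow> scong (Res a b T (Res c d U P)) (Res c d U (Res a b T P))"
| sc_Res_Zero: "legal_res a b T \<Longrightarrow> scong (Res a b T Zero) Zero"

inductive red :: "proc \<Rightarrow> proc \<Rightarrow> bool"  (infix "\<longmapsto>" 50) where
  red_In: "Res a b T (Par (Par (In a x P) (Out b v)) Q) \<longmapsto> Res a b T (Par (P\<lbrace>v/x\<rbrace>) Q)"
| red_Rep: "Res a b T (Par (Par (Rep a x P) (Out b v)) Q)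
    \<longmapsto> Res a b T (Par (Par (Rep a x P) (P\<lbrace>v/x\<rbrace>)) Q)"
| red_Par: "P \<longmapsto> P' \<Longrightarrow> Par P Q \<longmapsto> Par P' Q"
| red_Res: "P \<longmapsto> P' \<Longrightarrow> Res a b T P \<longmapsto> Res a b T P'"
| red_scong: "\<lbrakk>scong P P'; P' \<longmapsto> Q'; scong Q' Q\<rbrakk> \<Longrightarrow> P \<longmapsto> Q"

abbreviation reds :: "proc \<Rightarrow> proc \<Rightarrow> bool"  (infix "\<longmapsto>*" 50) where
  "P \<longmapsto>* Q \<equiv> red\<^sup>*\<^sup>* P Q"

section \<open>Barbed bisimilarity and barbed congruence\<close>

definition closed_proc :: "proc \<Rightarrow> bool" where
  "closed_proc P \<longleftrightarrow> (\<forall>c \<in> fn P. is_success c)"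

definition barb :: "proc \<Rightarrow> name \<Rightarrow> bool" where
  "barb P \<omega> \<longleftrightarrow> is_success \<omega> \<and> (\<exists>P'. scong P (Par (Out \<omega> Star) P'))"

definition weak_barb :: "proc \<Rightarrow> name \<Rightarrow> bool" where
  "weak_barb P \<omega> \<longleftrightarrow> (\<exists>P'. P \<longmapsto>* P' \<and> barb P' \<omega>)"

definition barbed_bisimulation :: "(proc \<Rightarrow> proc \<Rightarrow> bool) \<Rightarrow> bool" where
  "barbed_bisimulation R \<longleftrightarrow>
     symp R \<and>
     (\<forall>P Q. R P Q \<longrightarrow>
        closed_proc P \<and> closed_proc Q \<and>
        (\<forall>\<omega>. barb P \<omega> \<longrightarrow> weak_barb Q \<omega>) \<and>
        (\<forall>P'. P \<longmapsto> P' \<longrightarrow> (\<exists>Q'. Q \<longmapsto>* Q' \<and> R P' Q')))"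

definition barbed_bisimilar :: "proc \<Rightarrow> proc \<Rightarrow> bool"  (infix "\<approx>" 50) where
  "P \<approx> Q \<longleftrightarrow> (\<exists>R. barbed_bisimulation R \<and> R P Q)"

datatype ctx =
    Hole
  | CParL ctx proc
  | CParR proc ctx
  | CIn name name ctx
  | CRes name name ty ctx
  | CRep name name ctx

text \<open>Filling the hole captures free names.\<close>

primrec fill :: "ctx \<Rightarrow> proc \<Rightarrow> proc"  ("_\<langle>_\<rangle>" [1000, 0] 1000) where
  "fill Hole R = R"
| "fill (CParL C Q) R = Par (fill C R) Q"
| "fill (CParR P C) R = Par P (fill C R)"
| "fill (CIn a x C) R = In a x (fill C R)"
| "fill (CRes a b T C) R = Res a b T (fill C R)"
| "fill (CRep a x C) R = Rep a x (fill C R)"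

definition extends_env :: "env \<Rightarrow> env \<Rightarrow> bool" where
  "extends_env \<Delta> \<Gamma> \<longleftrightarrow>
     type_env \<Gamma> \<and> (\<exists>\<Delta>'. agree \<Delta> \<Delta>' \<and> (\<forall>c \<in> dom \<Delta>'. is_O c) \<and> \<Gamma> = \<Delta> ++ \<Delta>')"

text \<open>\<open>ctx_typing \<Delta> \<Gamma> C\<close>: \<open>\<Gamma> \<turnstile> C\<close>, assuming that the hole is typable under an extension of \<open>\<Delta>\<close>.\<close>

inductive ctx_typing :: "env \<Rightarrow> env \<Rightarrow> ctx \<Rightarrow> bool" for \<Delta> :: env where
  C_Hole: "extends_env \<Delta> \<Gamma> \<Longrightarrow> ctx_typing \<Delta> \<Gamma> Hole"
| C_ParL: "\<lbrakk>ctx_typing \<Delta> \<Gamma>\<^sub>1 C; \<Gamma>\<^sub>2 \<turnstile> Q; agree \<Gamma>\<^sub>1 \<Gamma>\<^sub>2; inputs \<Gamma>\<^sub>1 \<inter> inputs \<Gamma>\<^sub>2 = {}\<rbrakk>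
    \<Longrightarrow> ctx_typing \<Delta> (\<Gamma>\<^sub>1 ++ \<Gamma>\<^sub>2) (CParL C Q)"
| C_ParR: "\<lbrakk>\<Gamma>\<^sub>1 \<turnstile> P; ctx_typing \<Delta> \<Gamma>\<^sub>2 C; agree \<Gamma>\<^sub>1 \<Gamma>\<^sub>2; inputs \<Gamma>\<^sub>1 \<inter> inputs \<Gamma>\<^sub>2 = {}\<rbrakk>
    \<Longrightarrow> ctx_typing \<Delta> (\<Gamma>\<^sub>1 ++ \<Gamma>\<^sub>2) (CParR P C)"
| C_Res: "\<lbrakk>type_env \<Gamma>; legal_res a b (TI T); ctx_typing \<Delta> (\<Gamma>(a \<mapsto> TI T, b \<mapsto> TO T)) C\<rbrakk>
    \<Longrightarrow> ctx_typing \<Delta> \<Gamma> (CRes a b (TI T) C)"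
| C_In: "\<lbrakk>type_env \<Gamma>; \<Gamma> a = Some (TI T); \<not> is_success x; ctx_typing \<Delta> (\<Gamma>(x \<mapsto> T)) C\<rbrakk>
    \<Longrightarrow> ctx_typing \<Delta> \<Gamma> (CIn a x C)"
| C_Rep: "\<lbrakk>type_env \<Gamma>; \<Gamma> a = Some (TI T); \<not> is_success x;
           \<Gamma>\<^sub>o \<subseteq>\<^sub>m \<Gamma>; output_env \<Gamma>\<^sub>o; ctx_typing \<Delta> (\<Gamma>\<^sub>o(x \<mapsto> T)) C\<rbrakk>
    \<Longrightarrow> ctx_typing \<Delta> \<Gamma> (CRep a x C)"

definition closing :: "env \<Rightarrow> ctx \<Rightarrow> bool" where
  "closing \<Delta> C \<longleftrightarrow> (\<exists>\<Gamma>. (\<forall>c \<in> dom \<Gamma>. is_success c) \<and> ctx_typing \<Delta> \<Gamma> C)"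

text \<open>Names bound at the hole, and the restrictions in force there (i.e. not shadowed).\<close>

primrec hole_binders :: "ctx \<Rightarrow> name set" where
  "hole_binders Hole = {}"
| "hole_binders (CParL C Q) = hole_binders C"
| "hole_binders (CParR P C) = hole_binders C"
| "hole_binders (CIn a x C) = insert x (hole_binders C)"
| "hole_binders (CRes a b T C) = {a, b} \<union> hole_binders C"
| "hole_binders (CRep a x C) = insert x (hole_binders C)"

primrec connections :: "ctx \<Rightarrow> (name \<times> name) set" where
  "connections Hole = {}"
| "connections (CParL C Q) = connections C"
| "connections (CParR P C) = connections C"
| "connections (CIn a x C) = connections C"
| "connections (CRes a b T C) =
     (if {a, b} \<inter> hole_binders C = {} then {(a, b)} else {}) \<union> connections C"
| "connections (CRep a x C) = connections C"

definition respects_conn :: "ctx \<Rightarrow> (name \<times> name) set \<Rightarrow> bool" where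
  "respects_conn C \<delta> \<longleftrightarrow> \<delta> \<subseteq> connections C"

definition barbed_congruent_conn :: "(name \<times> name) set \<Rightarrow> env \<Rightarrow> proc \<Rightarrow> proc \<Rightarrow> bool" where
  "barbed_congruent_conn \<delta> \<Delta> P Q \<longleftrightarrow>
     \<Delta> \<turnstile> P \<and> \<Delta> \<turnstile> Q \<and> (\<forall>C. closing \<Delta> C \<and> respects_conn C \<delta> \<longrightarrow> C\<langle>P\<rangle> \<approx> C\<langle>Q\<rangle>)"

abbreviation barbed_congruent :: "env \<Rightarrow> proc \<Rightarrow> proc \<Rightarrow> bool" where
  "barbed_congruent \<equiv> barbed_congruent_conn {}"

section \<open>Wires\<close>

definition companions :: "name \<Rightarrow> name \<Rightarrow> bool" where
  "companions c c' \<longleftrightarrow> is_I c \<noteq> is_I c' \<and> \<not> is_success c \<and> \<not> is_success c'"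

text \<open>The type of a name of the polarity of \<open>c\<close> that carries values of type \<open>U\<close>.\<close>

definition chan_ty :: "name \<Rightarrow> ty \<Rightarrow> ty" where
  "chan_ty c U = (if is_I c then TI U else TO U)"

text \<open>\<open>(\<nu> c) P\<close>, where \<open>c'\<close> is the companion of \<open>c\<close> and both carry values of type \<open>U\<close>.\<close>

definition nu :: "name \<Rightarrow> name \<Rightarrow> ty \<Rightarrow> proc \<Rightarrow> proc" where
  "nu c c' U P = (if is_I c then Res c c' (TI U) P else Res c' c (TI U) P)"

text \<open>
  The wires \<open>[a \<rightarrow> b]\<close> and \<open>[p \<leftrightarrow> q]\<close>. The type \<open>U\<close> of the values carried is an argument
  because it determines the polarity of the bound name; for \<open>Unit\<close> the polarity is immaterial.
\<close>

fun name_for :: "ty \<Rightarrow> name" where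
  "name_for (TI _) = IName 0"
| "name_for (TO _) = OName 0"
| "name_for Unit = OName 0"

definition wire :: "ty \<Rightarrow> name \<Rightarrow> name \<Rightarrow> proc" where
  "wire U a b = (let x = fresh_name (name_for U) {a, b} in Rep a x (Out b (Nm x)))"

definition link :: "ty \<Rightarrow> name \<Rightarrow> name \<Rightarrow> proc" where
  "link U p q = (if is_I p then wire U p q else wire U q p)"

end

theory Submission
  imports Defs "HOL-Library.Multiset"
begin

text \<open>
  Processes are executed by a machine whose states are multisets of prefixes over global channels.
  Structurally congruent processes unroll to the same states, and reductions are exactly
  the machine steps. On states both forms of the law become one: a wire \<open>[m \<rightarrow> k]\<close> may be
  removed if the channels \<open>m\<close> and \<open>k\<close> are identified. By linear typing the wire is the only
  receiver at \<open>m\<close>, so forwarding a message from \<open>m\<close> to \<open>k\<close> commits to nothing and is matched by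
  no step of the contracted state; conversely, a communication of the contracted state is matched by
  forwarding the message along wires to the channel of its receiver and communicating there.
  A context may copy its hole, so any number of wires is contracted at once.
\<close>

text \<open>Two kinds of bookkeeping shape the development. The first is freshness. States have no
  binders, so the channel numbers drawn for restrictions must stay apart from all numbers in use,
  and which numbers these are depends on the process chosen to represent a state. Unrollings and
  steps therefore carry a finite set to be avoided: a reduction yields a step avoiding any
  prescribed set, while a step is known to be a reduction once it avoids a suitable set. The second
  is linearity. Typing separates names, but nothing in it prevents two names from denoting the same
  end of a channel. Linearity is therefore kept on states, by typing each component under its
  valuation and by counting who holds the input end of each channel. Reductions of terms are
  followed only by the coarser typing \<open>wt\<close>, which is invariant under structural
  congruence in both directions.\<close>

lemma with_index_inj: "with_index c m = with_index c n \<Longrightarrow> m = n"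
  by (cases c) auto

lemma fresh_name_notin: "finite A \<Longrightarrow> fresh_name c A \<notin> A"
proof -
  assume "finite A"
  then have "\<not> range (with_index c) \<subseteq> A"
    by (metis finite_subset finite_imageD infinite_UNIV_nat injI with_index_inj)
  then have "\<exists>n. with_index c n \<notin> A" by auto
  then show ?thesis
    unfolding fresh_name_def by (rule LeastI_ex)
qed

lemma is_I_fresh_name [simp]: "is_I (fresh_name c A) = is_I c"
  by (cases c) (auto simp: fresh_name_def)

lemma is_success_fresh_name [simp]: "is_success (fresh_name c A) = is_success c"
  by (cases c) (auto simp: fresh_name_def)

lemma same_sort_fresh_name: "same_sort c (fresh_name c A)"
  unfolding same_sort_def fresh_name_def by blast

lemma same_sort_is_I: "same_sort c d \<Longrightarrow> is_I d = is_I c"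
  by (cases c) (auto simp: same_sort_def)

lemma same_sort_is_success: "same_sort c d \<Longrightarrow> is_success d = is_success c"
  by (cases c) (auto simp: same_sort_def)

lemma legal_res_cong:
  "is_I a' = is_I a \<Longrightarrow> is_I b' = is_I b \<Longrightarrow> is_success b' = is_success b \<Longrightarrow>
   legal_res a' b' T = legal_res a b T"
  by (simp add: legal_res_def)

lemma finite_names_val [simp]: "finite (names_val v)"
  by (cases v) auto

lemma finite_fn [simp]: "finite (fn P)"
  by (induction P) auto

lemma finite_names_image [simp]: "finite A \<Longrightarrow> finite (names_image \<sigma> A)"
  by (simp add: names_image_def)

lemma size_psubst: "size (psubst \<sigma> P) = size P"
  by (induction P arbitrary: \<sigma>) (auto simp: Let_def)

text \<open>A free name in subject position must not be replaced by \<open>Star\<close>: there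
  \<open>subst_subj\<close> falls back on a dummy, and \<open>psubst\<close> would no longer commute
  with typing or denotation. \<open>subjects\<close> serves to state the side condition under which
  it does.\<close>

primrec subjects :: "proc \<Rightarrow> name set" where
  "subjects Zero = {}"
| "subjects (Par P Q) = subjects P \<union> subjects Q"
| "subjects (In a x P) = {a} \<union> (subjects P - {x})"
| "subjects (Out a v) = {a}"
| "subjects (Res a b T P) = subjects P - {a, b}"
| "subjects (Rep a x P) = {a} \<union> (subjects P - {x})"

section \<open>Simple typing\<close>

text \<open>Without environment splitting, typing is syntax-directed and depends on the environment
  only through the free names. It supplies what the correspondence with the machine needs of types:
  companions are distinct, \<open>Star\<close> never reaches a subject, and a success name carries
  only \<open>Star\<close>.\<close>

primrec wt :: "env \<Rightarrow> proc \<Rightarrow> bool" where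
  "wt \<Gamma> Zero \<longleftrightarrow> True"
| "wt \<Gamma> (Par P Q) \<longleftrightarrow> wt \<Gamma> P \<and> wt \<Gamma> Q"
| "wt \<Gamma> (In a x P) \<longleftrightarrow> (\<exists>T. \<Gamma> a = Some (TI T) \<and> wt (\<Gamma>(x \<mapsto> T)) P)"
| "wt \<Gamma> (Out a v) \<longleftrightarrow> (\<exists>T. \<Gamma> a = Some (TO T) \<and> has_type \<Gamma> v T)"
| "wt \<Gamma> (Res a b T P) \<longleftrightarrow> legal_res a b T \<and> (\<exists>U. T = TI U \<and> wt (\<Gamma>(a \<mapsto> TI U, b \<mapsto> TO U)) P)"
| "wt \<Gamma> (Rep a x P) \<longleftrightarrow> (\<exists>T. \<Gamma> a = Some (TI T) \<and> wt (\<Gamma>(x \<mapsto> T)) P)"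

lemma has_type_cong: "(\<And>c. c \<in> names_val v \<Longrightarrow> \<Gamma> c = \<Gamma>' c) \<Longrightarrow> has_type \<Gamma> v T = has_type \<Gamma>' v T"
  by (cases v) auto

lemma wt_cong: "(\<And>c. c \<in> fn P \<Longrightarrow> \<Gamma> c = \<Gamma>' c) \<Longrightarrow> wt \<Gamma> P = wt \<Gamma>' P"
proof (induction P arbitrary: \<Gamma> \<Gamma>')
  case (Par P Q)
  then show ?case by (metis UnCI fn.simps(2) wt.simps(2))
next
  case (In a x P)
  have "wt (\<Gamma>(x \<mapsto> T)) P = wt (\<Gamma>'(x \<mapsto> T)) P" for T
    by (rule In.IH) (use In.prems in auto)
  then show ?case using In.prems by simp
next
  case (Out a v)
  then show ?case using has_type_cong[of v \<Gamma> \<Gamma>'] by auto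
next
  case (Res a b T P)
  have "wt (\<Gamma>(a \<mapsto> TI U, b \<mapsto> TO U)) P = wt (\<Gamma>'(a \<mapsto> TI U, b \<mapsto> TO U)) P" for U
    by (rule Res.IH) (use Res.prems in auto)
  then show ?case by simp
next
  case (Rep a x P)
  have "wt (\<Gamma>(x \<mapsto> T)) P = wt (\<Gamma>'(x \<mapsto> T)) P" for T
    by (rule Rep.IH) (use Rep.prems in auto)
  then show ?case using Rep.prems by simp
qed simp

lemma wt_fn_dom: "wt \<Gamma> P \<Longrightarrow> fn P \<subseteq> dom \<Gamma>"
proof (induction P arbitrary: \<Gamma>)
  case (Out a v)
  then show ?case by (cases v) auto
qed (fastforce split: if_splits)+

text \<open>Only a name of type \<open>Unit\<close> can receive \<open>Star\<close>, so no
  well-typed communication puts \<open>Star\<close> in subject position.\<close>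

lemma wt_subjects: "wt \<Gamma> P \<Longrightarrow> c \<in> subjects P \<Longrightarrow> \<Gamma> c \<noteq> Some Unit"
  by (induction P arbitrary: \<Gamma>) (fastforce split: if_splits)+

fun type_of :: "env \<Rightarrow> val \<Rightarrow> ty option" where
  "type_of \<Gamma> (Nm c) = \<Gamma> c"
| "type_of \<Gamma> Star = Some Unit"

lemma has_type_type_of: "has_type \<Gamma> v T \<longleftrightarrow> type_of \<Gamma> v = Some T"
  by (cases v) auto

lemma has_type_subst_val:
  "has_type \<Gamma> (subst_val \<sigma> v) T \<longleftrightarrow> has_type (\<lambda>c. type_of \<Gamma> (\<sigma> c)) v T"
  by (cases v) (auto simp: has_type_type_of)

lemma type_of_cong: "(\<And>c. c \<in> names_val v \<Longrightarrow> \<Gamma> c = \<Gamma>' c) \<Longrightarrow> type_of \<Gamma> v = type_of \<Gamma>' v"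
  by (cases v) auto

lemma wt_fresh_binder:
  assumes "x' \<notin> names_image \<sigma> (fn P - {x})"
  shows "wt (\<lambda>c. type_of (\<Gamma>(x' \<mapsto> T)) ((\<sigma>(x := Nm x')) c)) P \<longleftrightarrow> wt ((\<lambda>c. type_of \<Gamma> (\<sigma> c))(x \<mapsto> T)) P"
  by (rule wt_cong) (use assms in \<open>auto intro!: type_of_cong simp: names_image_def\<close>)

text \<open>Typing after a substitution is typing before it in the environment pulled back along
  \<open>\<sigma>\<close>. Being an equivalence, it covers alpha-conversion in both directions as
  well as communication.\<close>

lemma wt_psubst:
  "(\<And>c. c \<in> subjects P \<Longrightarrow> \<sigma> c \<noteq> Star) \<Longrightarrow>
   wt \<Gamma> (psubst \<sigma> P) \<longleftrightarrow> wt (\<lambda>c. type_of \<Gamma> (\<sigma> c)) P"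
proof (induction P arbitrary: \<Gamma> \<sigma>)
  case (In a x P)
  define x' where "x' = fresh_name x (names_image \<sigma> (fn P - {x}))"
  have x': "x' \<notin> names_image \<sigma> (fn P - {x})" unfolding x'_def by (rule fresh_name_notin) simp
  obtain d where d: "\<sigma> a = Nm d" using In.prems[of a] by (cases "\<sigma> a") auto
  have "wt (\<Gamma>(x' \<mapsto> T)) (psubst (\<sigma>(x := Nm x')) P) \<longleftrightarrow> wt ((\<lambda>c. type_of \<Gamma> (\<sigma> c))(x \<mapsto> T)) P" for T
    unfolding wt_fresh_binder[OF x', symmetric] by (rule In.IH) (use In.prems in auto)
  then show ?case by (simp add: x'_def[symmetric] subst_subj_def d)
next
  case (Rep a x P)
  define x' where "x' = fresh_name x (names_image \<sigma> (fn P - {x}))"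
  have x': "x' \<notin> names_image \<sigma> (fn P - {x})" unfolding x'_def by (rule fresh_name_notin) simp
  obtain d where d: "\<sigma> a = Nm d" using Rep.prems[of a] by (cases "\<sigma> a") auto
  have "wt (\<Gamma>(x' \<mapsto> T)) (psubst (\<sigma>(x := Nm x')) P) \<longleftrightarrow> wt ((\<lambda>c. type_of \<Gamma> (\<sigma> c))(x \<mapsto> T)) P" for T
    unfolding wt_fresh_binder[OF x', symmetric] by (rule Rep.IH) (use Rep.prems in auto)
  then show ?case by (simp add: x'_def[symmetric] subst_subj_def d)
next
  case (Out a v)
  obtain d where d: "\<sigma> a = Nm d" using Out.prems[of a] by (cases "\<sigma> a") auto
  show ?case by (simp add: subst_subj_def d has_type_subst_val)
next
  case (Res a b T P)
  define A where "A = names_image \<sigma> (fn P - {a, b})"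
  define a' where "a' = fresh_name a A"
  define b' where "b' = fresh_name b (insert a' A)"
  have fA: "finite A" by (simp add: A_def)
  have a': "a' \<notin> A" unfolding a'_def by (rule fresh_name_notin) (simp add: fA)
  have b': "b' \<notin> insert a' A" unfolding b'_def by (rule fresh_name_notin) (simp add: fA)
  have leg: "legal_res a' b' T = legal_res a b T"
    by (rule legal_res_cong) (simp_all add: a'_def b'_def)
  have "wt (\<Gamma>(a' \<mapsto> TI U, b' \<mapsto> TO U)) (psubst (\<sigma>(a := Nm a', b := Nm b')) P)
      \<longleftrightarrow> wt ((\<lambda>c. type_of \<Gamma> (\<sigma> c))(a \<mapsto> TI U, b \<mapsto> TO U)) P" for U
  proof -
    have "wt (\<Gamma>(a' \<mapsto> TI U, b' \<mapsto> TO U)) (psubst (\<sigma>(a := Nm a', b := Nm b')) P)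
      \<longleftrightarrow> wt (\<lambda>c. type_of (\<Gamma>(a' \<mapsto> TI U, b' \<mapsto> TO U)) ((\<sigma>(a := Nm a', b := Nm b')) c)) P"
      by (rule Res.IH) (use Res.prems in auto)
    also have "\<dots> \<longleftrightarrow> wt ((\<lambda>c. type_of \<Gamma> (\<sigma> c))(a \<mapsto> TI U, b \<mapsto> TO U)) P"
      by (rule wt_cong) (use a' b' in \<open>auto simp: A_def intro!: type_of_cong simp: names_image_def\<close>)
    finally show ?thesis .
  qed
  then show ?case
    by (simp add: Let_def A_def[symmetric] a'_def[symmetric] b'_def[symmetric] leg)
next
  case (Par P Q)
  then show ?case by simp
qed simp

lemma wt_scong: "scong P Q \<Longrightarrow> wt \<Gamma> P \<longleftrightarrow> wt \<Gamma> Q"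
proof (induction arbitrary: \<Gamma> rule: scong.induct)
  case (sc_alpha_In x y P a)
  have "wt (\<Gamma>(y \<mapsto> T)) (P\<lbrace>Nm y/x\<rbrace>) \<longleftrightarrow> wt (\<Gamma>(x \<mapsto> T)) P" for T
    by (subst wt_psubst) (use sc_alpha_In in \<open>auto intro!: wt_cong split: if_splits\<close>)
  then show ?case by simp
next
  case (sc_alpha_Rep x y P a)
  have "wt (\<Gamma>(y \<mapsto> T)) (P\<lbrace>Nm y/x\<rbrace>) \<longleftrightarrow> wt (\<Gamma>(x \<mapsto> T)) P" for T
    by (subst wt_psubst) (use sc_alpha_Rep in \<open>auto intro!: wt_cong split: if_splits\<close>)
  then show ?case by simp
next
  case (sc_alpha_Res a b a' b' P T)
  have "wt (\<Gamma>(a' \<mapsto> TI U, b' \<mapsto> TO U)) (psubst (Nm(a := Nm a', b := Nm b')) P)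
    \<longleftrightarrow> wt (\<Gamma>(a \<mapsto> TI U, b \<mapsto> TO U)) P" for U
    by (subst wt_psubst) (use sc_alpha_Res in \<open>auto intro!: wt_cong split: if_splits\<close>)
  moreover have "legal_res a' b' T = legal_res a b T"
    by (rule legal_res_cong) (use sc_alpha_Res same_sort_is_I same_sort_is_success in auto)
  ultimately show ?case by simp
next
  case (sc_extrude a P b T Q)
  have "wt (\<Gamma>(a \<mapsto> TI U, b \<mapsto> TO U)) P \<longleftrightarrow> wt \<Gamma> P" for U
    by (rule wt_cong) (use sc_extrude in auto)
  then show ?case by auto
next
  case (sc_Res_comm a b c d T U P)
  then have "\<Gamma>(a \<mapsto> T1, b \<mapsto> T2, c \<mapsto> U1, d \<mapsto> U2) = \<Gamma>(c \<mapsto> U1, d \<mapsto> U2, a \<mapsto> T1, b \<mapsto> T2)" for T1 T2 U1 U2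
    by auto
  then show ?case by auto
next
  \<comment> \<open>Read from right to left the rule creates a restriction; its premise
    \<open>legal_res\<close> is what makes the new binder typable.\<close>
  case (sc_Res_Zero a b T)
  then show ?case by (auto simp: legal_res_def)
qed auto

lemma wt_subst_val:
  assumes "wt (\<Gamma>(x \<mapsto> T)) P" "has_type \<Gamma> v T"
  shows "wt \<Gamma> (P\<lbrace>v/x\<rbrace>)"
proof (subst wt_psubst)
  show "(Nm(x := v)) c \<noteq> Star" if "c \<in> subjects P" for c
    using wt_subjects[OF assms(1) that] assms(2) by (auto split: if_splits)
  have "(\<lambda>c. type_of \<Gamma> ((Nm(x := v)) c)) = \<Gamma>(x \<mapsto> T)"
    using assms(2) by (auto simp: has_type_type_of)
  with assms(1) show "wt (\<lambda>c. type_of \<Gamma> ((Nm(x := v)) c)) P" by simp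
qed

lemma wt_red: "P \<longmapsto> Q \<Longrightarrow> wt \<Gamma> P \<Longrightarrow> wt \<Gamma> Q"
proof (induction arbitrary: \<Gamma> rule: red.induct)
  case (red_In a b T x P v Q)
  then show ?case by (auto simp: legal_res_def split: if_splits intro: wt_subst_val)
next
  case (red_Rep a b T x P v Q)
  then show ?case by (auto simp: legal_res_def split: if_splits intro: wt_subst_val)
next
  case (red_scong P P' Q' Q)
  then show ?case using wt_scong by blast
qed auto

section \<open>Denotations\<close>

text \<open>
  \<open>CI n\<close> and \<open>CO n\<close> are the two ends of channel \<open>n\<close>. Binders denote functions, so that
  alpha-equivalent processes have equal denotations and substitution is a change of the valuation.
\<close>

datatype sv = CI nat | CO nat | Succ nat | SStar

datatype sem =
    SZero
  | SPar sem sem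
  | SIn sv "sv \<Rightarrow> sem"
  | SOut sv sv
  | SRes "nat \<Rightarrow> sem"
  | SRep sv "sv \<Rightarrow> sem"

fun den_val :: "(name \<Rightarrow> sv) \<Rightarrow> val \<Rightarrow> sv" where
  "den_val \<rho> (Nm c) = \<rho> c"
| "den_val \<rho> Star = SStar"

primrec den :: "proc \<Rightarrow> (name \<Rightarrow> sv) \<Rightarrow> sem" where
  "den Zero \<rho> = SZero"
| "den (Par P Q) \<rho> = SPar (den P \<rho>) (den Q \<rho>)"
| "den (In a x P) \<rho> = SIn (\<rho> a) (\<lambda>w. den P (\<rho>(x := w)))"
| "den (Out a v) \<rho> = SOut (\<rho> a) (den_val \<rho> v)"
| "den (Res a b T P) \<rho> = SRes (\<lambda>n. den P (\<rho>(a := CI n, b := CO n)))"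
| "den (Rep a x P) \<rho> = SRep (\<rho> a) (\<lambda>w. den P (\<rho>(x := w)))"

lemma den_val_cong: "(\<And>c. c \<in> names_val v \<Longrightarrow> \<rho> c = \<rho>' c) \<Longrightarrow> den_val \<rho> v = den_val \<rho>' v"
  by (cases v) auto

lemma den_cong: "(\<And>c. c \<in> fn P \<Longrightarrow> \<rho> c = \<rho>' c) \<Longrightarrow> den P \<rho> = den P \<rho>'"
proof (induction P arbitrary: \<rho> \<rho>')
  case (Par P Q)
  then show ?case by (metis UnCI den.simps(2) fn.simps(2))
next
  case (In a x P)
  have "den P (\<rho>(x := w)) = den P (\<rho>'(x := w))" for w
    by (rule In.IH) (use In.prems in auto)
  then show ?case using In.prems by simp
next
  case (Out a v)
  then show ?case using den_val_cong[of v \<rho> \<rho>'] by auto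
next
  case (Res a b T P)
  have "den P (\<rho>(a := CI n, b := CO n)) = den P (\<rho>'(a := CI n, b := CO n))" for n
    by (rule Res.IH) (use Res.prems in auto)
  then show ?case by simp
next
  case (Rep a x P)
  have "den P (\<rho>(x := w)) = den P (\<rho>'(x := w))" for w
    by (rule Rep.IH) (use Rep.prems in auto)
  then show ?case using Rep.prems by simp
qed simp

lemma den_val_subst_val: "den_val \<rho> (subst_val \<sigma> v) = den_val (\<lambda>c. den_val \<rho> (\<sigma> c)) v"
  by (cases v) auto

lemma den_fresh_binder:
  assumes "x' \<notin> names_image \<sigma> (fn P - {x})"
  shows "den P (\<lambda>c. den_val (\<rho>(x' := w)) ((\<sigma>(x := Nm x')) c)) = den P ((\<lambda>c. den_val \<rho> (\<sigma> c))(x := w))"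
  by (rule den_cong) (use assms in \<open>auto intro!: den_val_cong simp: names_image_def\<close>)

text \<open>\<open>psubst\<close> renames every binder it passes, so this also shows that the names
  it picks are invisible to the denotation. Alpha-conversion and communication are both
  instances.\<close>

lemma den_psubst:
  "(\<And>c. c \<in> subjects P \<Longrightarrow> \<sigma> c \<noteq> Star) \<Longrightarrow>
   den (psubst \<sigma> P) \<rho> = den P (\<lambda>c. den_val \<rho> (\<sigma> c))"
proof (induction P arbitrary: \<rho> \<sigma>)
  case (In a x P)
  define x' where "x' = fresh_name x (names_image \<sigma> (fn P - {x}))"
  have x': "x' \<notin> names_image \<sigma> (fn P - {x})" unfolding x'_def by (rule fresh_name_notin) simp
  obtain d where d: "\<sigma> a = Nm d" using In.prems[of a] by (cases "\<sigma> a") auto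
  have "den (psubst (\<sigma>(x := Nm x')) P) (\<rho>(x' := w)) = den P ((\<lambda>c. den_val \<rho> (\<sigma> c))(x := w))" for w
    unfolding den_fresh_binder[OF x', symmetric] by (rule In.IH) (use In.prems in auto)
  then show ?case by (simp add: x'_def[symmetric] subst_subj_def d)
next
  case (Rep a x P)
  define x' where "x' = fresh_name x (names_image \<sigma> (fn P - {x}))"
  have x': "x' \<notin> names_image \<sigma> (fn P - {x})" unfolding x'_def by (rule fresh_name_notin) simp
  obtain d where d: "\<sigma> a = Nm d" using Rep.prems[of a] by (cases "\<sigma> a") auto
  have "den (psubst (\<sigma>(x := Nm x')) P) (\<rho>(x' := w)) = den P ((\<lambda>c. den_val \<rho> (\<sigma> c))(x := w))" for w
    unfolding den_fresh_binder[OF x', symmetric] by (rule Rep.IH) (use Rep.prems in auto)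
  then show ?case by (simp add: x'_def[symmetric] subst_subj_def d)
next
  case (Out a v)
  obtain d where d: "\<sigma> a = Nm d" using Out.prems[of a] by (cases "\<sigma> a") auto
  show ?case by (simp add: subst_subj_def d den_val_subst_val)
next
  case (Res a b T P)
  define A where "A = names_image \<sigma> (fn P - {a, b})"
  define a' where "a' = fresh_name a A"
  define b' where "b' = fresh_name b (insert a' A)"
  have fA: "finite A" by (simp add: A_def)
  have a': "a' \<notin> A" unfolding a'_def by (rule fresh_name_notin) (simp add: fA)
  have b': "b' \<notin> insert a' A" unfolding b'_def by (rule fresh_name_notin) (simp add: fA)
  have "den (psubst (\<sigma>(a := Nm a', b := Nm b')) P) (\<rho>(a' := CI n, b' := CO n))
      = den P ((\<lambda>c. den_val \<rho> (\<sigma> c))(a := CI n, b := CO n))" for n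
  proof -
    have "den (psubst (\<sigma>(a := Nm a', b := Nm b')) P) (\<rho>(a' := CI n, b' := CO n))
      = den P (\<lambda>c. den_val (\<rho>(a' := CI n, b' := CO n)) ((\<sigma>(a := Nm a', b := Nm b')) c))"
      by (rule Res.IH) (use Res.prems in auto)
    also have "\<dots> = den P ((\<lambda>c. den_val \<rho> (\<sigma> c))(a := CI n, b := CO n))"
      by (rule den_cong) (use a' b' in \<open>auto simp: A_def intro!: den_val_cong simp: names_image_def\<close>)
    finally show ?thesis .
  qed
  then show ?case
    by (simp add: Let_def A_def[symmetric] a'_def[symmetric] b'_def[symmetric])
qed simp_all

lemma den_subst_Nm: "den (P\<lbrace>Nm d/x\<rbrace>) \<rho> = den P (\<rho>(x := \<rho> d))"
proof -
  have "(\<lambda>c. den_val \<rho> ((Nm(x := Nm d)) c)) = \<rho>(x := \<rho> d)" by auto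
  then show ?thesis by (subst den_psubst) (auto split: if_splits)
qed

lemma den_subst_typed:
  assumes "wt (\<Gamma>(x \<mapsto> T)) P" "has_type \<Gamma> v T"
  shows "den (P\<lbrace>v/x\<rbrace>) \<rho> = den P (\<rho>(x := den_val \<rho> v))"
proof (subst den_psubst)
  show "(Nm(x := v)) c \<noteq> Star" if "c \<in> subjects P" for c
    using wt_subjects[OF assms(1) that] assms(2) by (auto split: if_splits)
  have "(\<lambda>c. den_val \<rho> ((Nm(x := v)) c)) = \<rho>(x := den_val \<rho> v)" by auto
  then show "den P (\<lambda>c. den_val \<rho> ((Nm(x := v)) c)) = den P (\<rho>(x := den_val \<rho> v))" by simp
qed

text \<open>Structural congruence transported to denotations. There is no alpha rule, because
  alpha-equivalent processes already have equal denotations, and extrusion needs no freshness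
  condition, because \<open>s\<close> cannot mention the argument of \<open>h\<close>. Congruence
  under a binder is pointwise in the value.\<close>

inductive seq :: "sem \<Rightarrow> sem \<Rightarrow> bool" where
  seq_refl: "seq s s"
| seq_sym: "seq s t \<Longrightarrow> seq t s"
| seq_trans: "seq s t \<Longrightarrow> seq t u \<Longrightarrow> seq s u"
| seq_Par: "seq s s' \<Longrightarrow> seq t t' \<Longrightarrow> seq (SPar s t) (SPar s' t')"
| seq_In: "(\<And>w. seq (f w) (g w)) \<Longrightarrow> seq (SIn k f) (SIn k g)"
| seq_Rep: "(\<And>w. seq (f w) (g w)) \<Longrightarrow> seq (SRep k f) (SRep k g)"
| seq_Res: "(\<And>n. seq (h n) (h' n)) \<Longrightarrow> seq (SRes h) (SRes h')"
| seq_assoc: "seq (SPar (SPar s t) u) (SPar s (SPar t u))"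
| seq_comm: "seq (SPar s t) (SPar t s)"
| seq_Zero: "seq (SPar s SZero) s"
| seq_extrude: "seq (SPar s (SRes h)) (SRes (\<lambda>n. SPar s (h n)))"
| seq_Res_comm: "seq (SRes (\<lambda>n. SRes (hh n))) (SRes (\<lambda>m. SRes (\<lambda>n. hh n m)))"
| seq_Res_Zero: "seq (SRes (\<lambda>n. SZero)) SZero"

lemma seq_den: "scong P Q \<Longrightarrow> seq (den P \<rho>) (den Q \<rho>)"
proof (induction arbitrary: \<rho> rule: scong.induct)
  case (sc_alpha_In x y P a)
  have "den (P\<lbrace>Nm y/x\<rbrace>) (\<rho>(y := w)) = den P (\<rho>(x := w))" for w
    unfolding den_subst_Nm by (rule den_cong) (use sc_alpha_In in auto)
  then show ?case by (simp add: seq_refl)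
next
  case (sc_alpha_Rep x y P a)
  have "den (P\<lbrace>Nm y/x\<rbrace>) (\<rho>(y := w)) = den P (\<rho>(x := w))" for w
    unfolding den_subst_Nm by (rule den_cong) (use sc_alpha_Rep in auto)
  then show ?case by (simp add: seq_refl)
next
  case (sc_alpha_Res a b a' b' P T)
  have "den (psubst (Nm(a := Nm a', b := Nm b')) P) (\<rho>(a' := CI n, b' := CO n))
    = den P (\<rho>(a := CI n, b := CO n))" for n
    by (subst den_psubst) (use sc_alpha_Res in \<open>auto intro!: den_cong split: if_splits\<close>)
  then show ?case by (simp add: seq_refl)
next
  case (sc_extrude a P b T Q)
  have "den P (\<rho>(a := CI n, b := CO n)) = den P \<rho>" for n
    by (rule den_cong) (use sc_extrude in auto)
  then show ?case by (simp add: seq_extrude)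
next
  case (sc_Res_comm a b c d T U P)
  then have eq: "\<rho>(c := CI m, d := CO m, a := CI n, b := CO n)
      = \<rho>(a := CI n, b := CO n, c := CI m, d := CO m)" for n m
    by auto
  show ?case
    using seq_Res_comm[of "\<lambda>n m. den P (\<rho>(a := CI n, b := CO n, c := CI m, d := CO m))"]
    by (simp add: eq)
next
  case (sc_sym P Q)
  then show ?case using seq_sym by blast
next
  case (sc_trans P Q R)
  then show ?case using seq_trans by blast
qed (simp_all add: seq_refl seq_Par seq_In seq_Rep seq_Res seq_assoc seq_comm seq_Zero seq_Res_Zero)

section \<open>The machine\<close>

text \<open>
  \<open>spill s A M\<close>: unrolling the top level of \<open>s\<close>, with the distinct channels \<open>A\<close> chosen for its
  restrictions, leaves the prefixes \<open>M\<close>. That \<open>A\<close> is fresh for \<open>s\<close> is not required here; users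
  of \<open>spill\<close> keep \<open>A\<close> disjoint from the channels in use.
\<close>

inductive spill :: "sem \<Rightarrow> nat set \<Rightarrow> sem multiset \<Rightarrow> bool" where
  spill_Zero: "spill SZero {} {#}"
| spill_Par: "spill s A M \<Longrightarrow> spill t B N \<Longrightarrow> A \<inter> B = {} \<Longrightarrow> spill (SPar s t) (A \<union> B) (M + N)"
| spill_In: "spill (SIn k f) {} {#SIn k f#}"
| spill_Out: "spill (SOut k w) {} {#SOut k w#}"
| spill_Rep: "spill (SRep k f) {} {#SRep k f#}"
| spill_Res: "spill (h n) A M \<Longrightarrow> n \<notin> A \<Longrightarrow> spill (SRes h) (insert n A) M"

inductive_cases spill_ZeroE: "spill SZero A M"
inductive_cases spill_ParE: "spill (SPar s t) A M"
inductive_cases spill_InE: "spill (SIn k f) A M"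
inductive_cases spill_OutE: "spill (SOut k w) A M"
inductive_cases spill_RepE: "spill (SRep k f) A M"
inductive_cases spill_ResE: "spill (SRes h) A M"

lemma spill_finite: "spill s A M \<Longrightarrow> finite A"
  by (induction rule: spill.induct) auto

lemma spill_exists: "finite X \<Longrightarrow> \<exists>A M. spill s A M \<and> A \<inter> X = {}"
proof (induction s arbitrary: X)
  case SZero
  then show ?case using spill_Zero by blast
next
  case (SPar s t)
  obtain A M where A: "spill s A M" "A \<inter> X = {}"
    using SPar.IH(1)[OF SPar.prems] by blast
  then have "finite (X \<union> A)" using SPar.prems spill_finite[OF A(1)] by simp
  from SPar.IH(2)[OF this] obtain B N where B: "spill t B N" "B \<inter> (X \<union> A) = {}" by blast
  have "A \<inter> B = {}" using B by blast
  then have "spill (SPar s t) (A \<union> B) (M + N)" by (rule spill_Par[OF A(1) B(1)])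
  moreover have "(A \<union> B) \<inter> X = {}" using A(2) B(2) by blast
  ultimately show ?case by blast
next
  case (SRes h)
  obtain n where n: "n \<notin> X" using SRes.prems ex_new_if_finite infinite_UNIV_nat by blast
  have "finite (insert n X)" using SRes.prems by simp
  from SRes.IH[OF _ this, of "h n"] obtain A M where A: "spill (h n) A M" "A \<inter> insert n X = {}" by blast
  then have "n \<notin> A" by blast
  then have "spill (SRes h) (insert n A) M" by (rule spill_Res[of h n, OF A(1)])
  moreover have "insert n A \<inter> X = {}" using A(2) n by blast
  ultimately show ?case by blast
next
  case (SIn k f)
  show ?case by (intro exI[of _ "{}"] exI[of _ "{#SIn k f#}"]) (simp add: spill_In)
next
  case (SOut k w)
  show ?case by (intro exI[of _ "{}"] exI[of _ "{#SOut k w#}"]) (simp add: spill_Out)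
next
  case (SRep k f)
  show ?case by (intro exI[of _ "{}"] exI[of _ "{#SRep k f#}"]) (simp add: spill_Rep)
qed

text \<open>Structural congruence also acts below prefixes, where unrolling does not reach. Prefixes
  are therefore compared with bodies equivalent at every value, and states up to \<open>meq\<close>,
  the lifting of this relation to multisets.\<close>

inductive peq :: "sem \<Rightarrow> sem \<Rightarrow> bool" where
  peq_In: "(\<And>w. seq (f w) (g w)) \<Longrightarrow> peq (SIn k f) (SIn k g)"
| peq_Rep: "(\<And>w. seq (f w) (g w)) \<Longrightarrow> peq (SRep k f) (SRep k g)"
| peq_refl: "peq s s"

inductive_cases peq_InE': "peq (SIn k f) t"
inductive_cases peq_RepE': "peq (SRep k f) t"
inductive_cases peq_OutE: "peq (SOut k w) t"

lemma peq_InE: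
  assumes "peq (SIn k f) t" obtains g where "t = SIn k g" "\<And>w. seq (f w) (g w)"
  using assms seq_refl by (elim peq_InE') auto

lemma peq_RepE:
  assumes "peq (SRep k f) t" obtains g where "t = SRep k g" "\<And>w. seq (f w) (g w)"
  using assms seq_refl by (elim peq_RepE') auto

abbreviation meq :: "sem multiset \<Rightarrow> sem multiset \<Rightarrow> bool" where
  "meq \<equiv> rel_mset peq"

lemma peq_sym: "peq s t \<Longrightarrow> peq t s"
proof (induction rule: peq.induct)
  case (peq_In f g k)
  show ?case by (rule peq.peq_In) (rule seq_sym[OF peq_In])
next
  case (peq_Rep f g k)
  show ?case by (rule peq.peq_Rep) (rule seq_sym[OF peq_Rep])
qed (rule peq_refl)

lemma peq_trans: "peq s t \<Longrightarrow> peq t u \<Longrightarrow> peq s u"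
proof (induction arbitrary: u rule: peq.induct)
  case (peq_In f g k)
  from peq_In(2) obtain h where h: "u = SIn k h" "\<And>w. seq (g w) (h w)" by (rule peq_InE) blast
  show ?case unfolding h(1) by (rule peq.peq_In) (rule seq_trans[OF peq_In(1) h(2)])
next
  case (peq_Rep f g k)
  from peq_Rep(2) obtain h where h: "u = SRep k h" "\<And>w. seq (g w) (h w)" by (rule peq_RepE) blast
  show ?case unfolding h(1) by (rule peq.peq_Rep) (rule seq_trans[OF peq_Rep(1) h(2)])
qed

lemma meq_refl: "meq M M"
  by (rule multiset.rel_refl) (rule peq_refl)

lemma meq_sym: "meq M N \<Longrightarrow> meq N M"
proof -
  assume "meq M N"
  then have "rel_mset peq\<inverse>\<inverse> N M" by (simp add: multiset.rel_flip)
  then show ?thesis by (rule multiset.rel_mono_strong) (use peq_sym in blast)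
qed

lemma meq_trans: "meq M N \<Longrightarrow> meq N K \<Longrightarrow> meq M K"
proof -
  assume "meq M N" "meq N K"
  then have "rel_mset (peq OO peq) M K" unfolding multiset.rel_compp by blast
  then show ?thesis by (rule multiset.rel_mono_strong) (use peq_trans in blast)
qed

lemma meq_add: "meq M N \<Longrightarrow> meq M' N' \<Longrightarrow> meq (M + M') (N + N')"
  unfolding rel_mset_def by (metis list_all2_appendI mset_append)

text \<open>The channels \<open>B\<close> need not equal \<open>A\<close>: erasing or creating a
  restriction of \<open>Zero\<close> changes their number. Only the prefixes have to agree, and
  \<open>X\<close> is any finite set from which both choices are kept apart.\<close>

definition spill_le :: "sem \<Rightarrow> sem \<Rightarrow> bool" where
  "spill_le s t \<longleftrightarrow> (\<forall>X A M. finite X \<longrightarrow> spill s A M \<longrightarrow> A \<inter> X = {} \<longrightarrow>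
     (\<exists>B N. spill t B N \<and> B \<inter> X = {} \<and> meq M N))"

lemma spill_leD:
  assumes "spill_le s t" "spill s A M" "finite X" "A \<inter> X = {}"
  obtains B N where "spill t B N" "B \<inter> X = {}" "meq M N"
proof -
  from assms(1)[unfolded spill_le_def, rule_format, OF assms(3,2,4)] show thesis
    by (elim exE conjE) (rule that)
qed

lemma spill_leI:
  assumes "\<And>X A M. finite X \<Longrightarrow> spill s A M \<Longrightarrow> A \<inter> X = {} \<Longrightarrow>
    \<exists>B N. spill t B N \<and> B \<inter> X = {} \<and> meq M N"
  shows "spill_le s t"
  unfolding spill_le_def by (intro allI impI) (rule assms)

lemma spill_le_same:
  assumes "\<And>A M. spill s A M \<Longrightarrow> spill t A M"
  shows "spill_le s t"
proof (rule spill_leI)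
  fix X A M assume "spill s A M" "A \<inter> X = {}"
  then show "\<exists>B N. spill t B N \<and> B \<inter> X = {} \<and> meq M N"
    by (intro exI[of _ A] exI[of _ M] conjI assms meq_refl)
qed

lemma spill_le_trans: "spill_le s t \<Longrightarrow> spill_le t u \<Longrightarrow> spill_le s u"
proof (rule spill_leI)
  fix X A M assume le: "spill_le s t" "spill_le t u" and X: "finite X" "spill s A M" "A \<inter> X = {}"
  obtain B N where B: "spill t B N" "B \<inter> X = {}" "meq M N"
    by (rule spill_leD[OF le(1) X(2,1,3)])
  obtain C K where C: "spill u C K" "C \<inter> X = {}" "meq N K"
    by (rule spill_leD[OF le(2) B(1) X(1) B(2)])
  show "\<exists>B N. spill u B N \<and> B \<inter> X = {} \<and> meq M N"
    using C(1,2) meq_trans[OF B(3) C(3)] by (intro exI conjI)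
qed

lemma spill_le_Par:
  assumes "spill_le s s'" "spill_le t t'"
  shows "spill_le (SPar s t) (SPar s' t')"
proof (rule spill_leI)
  fix X A M assume X: "finite X" and "spill (SPar s t) A M" and AX: "A \<inter> X = {}"
  then obtain A1 M1 A2 M2 where A: "spill s A1 M1" "spill t A2 M2" "A1 \<inter> A2 = {}"
    "A = A1 \<union> A2" "M = M1 + M2" by (elim spill_ParE)
  \<comment> \<open>The components are matched one after the other. The first match avoids
    \<open>A2\<close>, so that \<open>A2\<close> is admissible for the second, which in turn avoids
    the channels \<open>B1\<close> just chosen; the two results are then disjoint.\<close>
  have "finite (X \<union> A2)" "A1 \<inter> (X \<union> A2) = {}" using X A AX spill_finite by auto
  from spill_leD[OF assms(1) A(1) this] obtain B1 N1
    where B1: "spill s' B1 N1" "B1 \<inter> (X \<union> A2) = {}" "meq M1 N1" .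
  have "finite (X \<union> B1)" "A2 \<inter> (X \<union> B1) = {}" using X A AX B1 spill_finite by auto
  from spill_leD[OF assms(2) A(2) this] obtain B2 N2
    where B2: "spill t' B2 N2" "B2 \<inter> (X \<union> B1) = {}" "meq M2 N2" .
  have "B1 \<inter> B2 = {}" using B2 by blast
  from spill_Par[OF B1(1) B2(1) this] have "spill (SPar s' t') (B1 \<union> B2) (N1 + N2)" .
  moreover have "(B1 \<union> B2) \<inter> X = {}" using B1(2) B2(2) by blast
  moreover have "meq M (N1 + N2)" unfolding A(5) by (rule meq_add[OF B1(3) B2(3)])
  ultimately show "\<exists>B N. spill (SPar s' t') B N \<and> B \<inter> X = {} \<and> meq M N"
    by (intro exI conjI)
qed

lemma spill_le_Res:
  assumes "\<And>n. spill_le (h n) (h' n)"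
  shows "spill_le (SRes h) (SRes h')"
proof (rule spill_leI)
  fix X A M assume X: "finite X" and "spill (SRes h) A M" and AX: "A \<inter> X = {}"
  then obtain n A1 where A: "spill (h n) A1 M" "n \<notin> A1" "A = insert n A1"
    by (elim spill_ResE)
  have "finite (insert n X)" "A1 \<inter> (insert n X) = {}" using X A AX by auto
  from spill_leD[OF assms A(1) this] obtain B1 N
    where B1: "spill (h' n) B1 N" "B1 \<inter> (insert n X) = {}" "meq M N" .
  have "spill (SRes h') (insert n B1) N"
    by (rule spill_Res[of h' n, OF B1(1)]) (use B1(2) in blast)
  moreover have "insert n B1 \<inter> X = {}" using B1(2) A AX by blast
  ultimately show "\<exists>B N. spill (SRes h') B N \<and> B \<inter> X = {} \<and> meq M N"
    using B1(3) by (intro exI conjI)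
qed

text \<open>Unrolling flattens parallel composition into a union of multisets and restrictions into
  a set of channels, so associativity, commutativity, extrusion and the exchange of restrictions are
  identities of unrollings. Among the structural axioms only the one for a restriction of
  \<open>Zero\<close> changes the channels.\<close>

lemma seq_spill_le: "seq s t \<Longrightarrow> spill_le s t \<and> spill_le t s"
proof (induction rule: seq.induct)
  case (seq_refl s)
  then show ?case using spill_le_same by blast
next
  case (seq_sym s t)
  then show ?case by blast
next
  case (seq_trans s t u)
  then show ?case using spill_le_trans by blast
next
  case (seq_Par s s' t t')
  then show ?case using spill_le_Par by blast
next
  case (seq_In f g k)
  have "spill_le (SIn k f) (SIn k g)" if "\<And>w. seq (f w) (g w)" for f g
  proof (rule spill_leI)
    fix X A M assume "spill (SIn k f) A M"
    then have "A = {}" "M = {#SIn k f#}" by (elim spill_InE; simp)+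
    moreover have "meq {#SIn k f#} {#SIn k g#}"
      by (intro rel_mset_Plus peq_In meq_refl that)
    ultimately show "\<exists>B N. spill (SIn k g) B N \<and> B \<inter> X = {} \<and> meq M N"
      using spill_In[of k g] by (intro exI[of _ "{}"] exI[of _ "{#SIn k g#}"]) simp
  qed
  from this[of f g] this[of g f] seq_In.hyps show ?case by (blast intro: seq.seq_sym)
next
  case (seq_Rep f g k)
  have "spill_le (SRep k f) (SRep k g)" if "\<And>w. seq (f w) (g w)" for f g
  proof (rule spill_leI)
    fix X A M assume "spill (SRep k f) A M"
    then have "A = {}" "M = {#SRep k f#}" by (elim spill_RepE; simp)+
    moreover have "meq {#SRep k f#} {#SRep k g#}"
      by (intro rel_mset_Plus peq_Rep meq_refl that)
    ultimately show "\<exists>B N. spill (SRep k g) B N \<and> B \<inter> X = {} \<and> meq M N"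
      using spill_Rep[of k g] by (intro exI[of _ "{}"] exI[of _ "{#SRep k g#}"]) simp
  qed
  from this[of f g] this[of g f] seq_Rep.hyps show ?case by (blast intro: seq.seq_sym)
next
  case (seq_Res h h')
  then show ?case using spill_le_Res by blast
next
  case (seq_assoc s t u)
  have "spill (SPar s (SPar t u)) A M" if S: "spill (SPar (SPar s t) u) A M" for A M
  proof -
    obtain A1 A2 A3 M1 M2 M3 where *: "spill s A1 M1" "spill t A2 M2" "spill u A3 M3"
      "A1 \<inter> A2 = {}" "(A1 \<union> A2) \<inter> A3 = {}" "A = A1 \<union> A2 \<union> A3" "M = M1 + M2 + M3"
      using S by (elim spill_ParE) (rule that, assumption, assumption, assumption, simp_all)
    have "spill (SPar s (SPar t u)) (A1 \<union> (A2 \<union> A3)) (M1 + (M2 + M3))"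
      by (intro spill_Par) (use * in auto)
    then show ?thesis using * by (simp add: Un_assoc add.assoc)
  qed
  moreover have "spill (SPar (SPar s t) u) A M" if S: "spill (SPar s (SPar t u)) A M" for A M
  proof -
    obtain A1 A2 A3 M1 M2 M3 where *: "spill s A1 M1" "spill t A2 M2" "spill u A3 M3"
      "A2 \<inter> A3 = {}" "A1 \<inter> (A2 \<union> A3) = {}" "A = A1 \<union> (A2 \<union> A3)" "M = M1 + (M2 + M3)"
      using S by (elim spill_ParE) (rule that, assumption, assumption, assumption, simp_all)
    have "spill (SPar (SPar s t) u) ((A1 \<union> A2) \<union> A3) ((M1 + M2) + M3)"
      by (intro spill_Par) (use * in auto)
    then show ?thesis using * by (simp add: Un_assoc add.assoc)
  qed
  ultimately show ?case using spill_le_same by blast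
next
  case (seq_comm s t)
  have "spill (SPar t s) A M" if S: "spill (SPar s t) A M" for A M s t
  proof -
    obtain A1 A2 M1 M2 where *: "spill s A1 M1" "spill t A2 M2" "A1 \<inter> A2 = {}"
      "A = A1 \<union> A2" "M = M1 + M2"
      using S by (elim spill_ParE)
    have "spill (SPar t s) (A2 \<union> A1) (M2 + M1)"
      by (intro spill_Par) (use * in auto)
    then show ?thesis using * by (simp add: Un_commute add.commute)
  qed
  then show ?case using spill_le_same by blast
next
  case (seq_Zero s)
  have "spill s A M" if "spill (SPar s SZero) A M" for A M
    using that by (auto elim!: spill_ParE spill_ZeroE)
  moreover have "spill (SPar s SZero) A M" if "spill s A M" for A M
    using spill_Par[OF that spill_Zero] by simp
  ultimately show ?case using spill_le_same by blast
next
  case (seq_extrude s h)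
  have "spill (SRes (\<lambda>n. SPar s (h n))) A M" if S: "spill (SPar s (SRes h)) A M" for A M
  proof -
    obtain A1 A2 n M1 M2 where *: "spill s A1 M1" "spill (h n) A2 M2"
      "n \<notin> A2" "A1 \<inter> insert n A2 = {}" "A = A1 \<union> insert n A2" "M = M1 + M2"
      using S by (elim spill_ParE spill_ResE) (rule that, assumption, assumption, simp_all)
    have "spill (SRes (\<lambda>n. SPar s (h n))) (insert n (A1 \<union> A2)) (M1 + M2)"
      by (intro spill_Par spill_Res) (use * in auto)
    then show ?thesis using * by simp
  qed
  moreover have "spill (SPar s (SRes h)) A M" if S: "spill (SRes (\<lambda>n. SPar s (h n))) A M" for A M
  proof -
    obtain A1 A2 n M1 M2 where *: "spill s A1 M1" "spill (h n) A2 M2"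
      "n \<notin> A1 \<union> A2" "A1 \<inter> A2 = {}" "A = insert n (A1 \<union> A2)" "M = M1 + M2"
      using S by (elim spill_ParE spill_ResE) (rule that, assumption, assumption, simp_all)
    have "spill (SPar s (SRes h)) (A1 \<union> insert n A2) (M1 + M2)"
      by (intro spill_Par spill_Res) (use * in auto)
    then show ?thesis using * by simp
  qed
  ultimately show ?case using spill_le_same by blast
next
  case (seq_Res_comm hh)
  have swap: "spill (SRes (\<lambda>m. SRes (\<lambda>n. hh n m))) A M" if S: "spill (SRes (\<lambda>n. SRes (hh n))) A M"
    for A M and hh :: "nat \<Rightarrow> nat \<Rightarrow> sem"
  proof -
    obtain n m B where *: "spill (hh n m) B M" "m \<notin> B" "n \<notin> insert m B" "A = insert n (insert m B)"
      using S by (elim spill_ResE) (rule that, assumption, simp_all)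
    have "spill (SRes (\<lambda>m. SRes (\<lambda>n. hh n m))) (insert m (insert n B)) M"
      by (intro spill_Res) (use * in auto)
    then show ?thesis using * by (simp add: insert_commute)
  qed
  show ?case
  proof (intro conjI spill_le_same)
    show "spill (SRes (\<lambda>m. SRes (\<lambda>n. hh n m))) A M" if "spill (SRes (\<lambda>n. SRes (hh n))) A M" for A M
      using that by (rule swap)
    show "spill (SRes (\<lambda>n. SRes (hh n))) A M" if "spill (SRes (\<lambda>m. SRes (\<lambda>n. hh n m))) A M" for A M
      using that by (rule swap[of "\<lambda>m n. hh n m"])
  qed
next
  case seq_Res_Zero
  have "spill_le (SRes (\<lambda>n. SZero)) SZero"
    by (rule spill_leI) (auto elim!: spill_ResE spill_ZeroE intro!: exI[of _ "{}"] spill_Zero)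
  moreover have "spill_le SZero (SRes (\<lambda>n. SZero))"
  proof (rule spill_leI)
    fix X A M assume "finite (X :: nat set)" "spill SZero A M"
    obtain n where n: "n \<notin> X" using \<open>finite X\<close> ex_new_if_finite infinite_UNIV_nat by blast
    have "spill (SRes (\<lambda>n. SZero)) {n} {#}" by (intro spill_Res spill_Zero) simp
    with n \<open>spill SZero A M\<close> show "\<exists>B N. spill (SRes (\<lambda>n. SZero)) B N \<and> B \<inter> X = {} \<and> meq M N"
      by (auto elim!: spill_ZeroE intro!: exI[of _ "{n}"] exI[of _ "{#}"])
  qed
  ultimately show ?case by blast
qed

text \<open>The continuation is unrolled as part of the step, so that states consist of prefixes
  only. Nothing in the rules forbids the new channels to clash with those of the state;
  \<open>Y\<close> is there to exclude it.\<close>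

inductive mstep :: "nat set \<Rightarrow> sem multiset \<Rightarrow> sem multiset \<Rightarrow> bool" for Y where
  mstep_In: "spill (f v) B N \<Longrightarrow> B \<inter> Y = {} \<Longrightarrow>
    mstep Y ({#SIn (CI c) f, SOut (CO c) v#} + M) (N + M)"
| mstep_Rep: "spill (f v) B N \<Longrightarrow> B \<inter> Y = {} \<Longrightarrow>
    mstep Y ({#SRep (CI c) f, SOut (CO c) v#} + M) (add_mset (SRep (CI c) f) (N + M))"

lemma mstep_anti_mono: "mstep Y M N \<Longrightarrow> Y' \<subseteq> Y \<Longrightarrow> mstep Y' M N"
proof (induction rule: mstep.induct)
  case (mstep_In f v B N c M)
  then show ?case by (intro mstep.mstep_In) auto
next
  case (mstep_Rep f v B N c M)
  then show ?case by (intro mstep.mstep_Rep) auto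
qed

lemma mstep_meq:
  assumes "mstep Y M N" "meq M M'" "finite Y"
  shows "\<exists>N'. mstep Y M' N' \<and> meq N N'"
  using assms
proof (induction rule: mstep.induct)
  case (mstep_In f v B N c M)
  from mstep_In.prems obtain g K where K: "M' = {#SIn (CI c) g, SOut (CO c) v#} + K" "meq M K"
    "\<And>w. seq (f w) (g w)"
    by (auto dest!: msed_rel_invL elim!: peq_InE peq_OutE)
  obtain B' N' where B': "spill (g v) B' N'" "B' \<inter> Y = {}" "meq N N'"
    using seq_spill_le[OF K(3)] mstep_In by (metis spill_leD)
  have "mstep Y M' (N' + K)" unfolding K(1) by (rule mstep.mstep_In) (use B' in auto)
  then show ?case using B' K meq_add by blast
next
  case (mstep_Rep f v B N c M)
  from mstep_Rep.prems obtain g K where K: "M' = {#SRep (CI c) g, SOut (CO c) v#} + K" "meq M K"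
    "\<And>w. seq (f w) (g w)"
    by (auto dest!: msed_rel_invL elim!: peq_RepE peq_OutE)
  obtain B' N' where B': "spill (g v) B' N'" "B' \<inter> Y = {}" "meq N N'"
    using seq_spill_le[OF K(3)] mstep_Rep by (metis spill_leD)
  have "meq (add_mset (SRep (CI c) f) (N + M)) (add_mset (SRep (CI c) g) (N' + K))"
    by (intro rel_mset_Plus peq_Rep meq_add B' K)
  moreover have "mstep Y M' (add_mset (SRep (CI c) g) (N' + K))"
    unfolding K(1) by (rule mstep.mstep_Rep) (use B' in auto)
  ultimately show ?case by blast
qed

section \<open>Reductions are machine steps\<close>

lemma mstep_frame: "mstep Y M M' \<Longrightarrow> mstep Y (M + K) (M' + K)"
proof (induction rule: mstep.induct)
  case (mstep_In f v B N c M)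
  then have "mstep Y ({#SIn (CI c) f, SOut (CO c) v#} + (M + K)) (N + (M + K))"
    by (rule mstep.mstep_In)
  then show ?case by (simp add: ac_simps)
next
  case (mstep_Rep f v B N c M)
  then have "mstep Y ({#SRep (CI c) f, SOut (CO c) v#} + (M + K))
      (add_mset (SRep (CI c) f) (N + (M + K)))"
    by (rule mstep.mstep_Rep)
  then show ?case by (simp add: ac_simps)
qed

text \<open>\<open>Y\<close> constrains the channels drawn by the step, \<open>X\<close> those of
  the whole unrolling of the result. They are kept apart because the surroundings of a redex
  determine \<open>X\<close>, whereas \<open>Y\<close> may be any larger finite set prescribed by
  the caller. The detour through \<open>meq\<close> absorbs uses of
  \<open>red_scong\<close>.\<close>

lemma red_mstep:
  assumes "P \<longmapsto> Q" "wt \<Gamma> P" "spill (den P \<rho>) A M" "A \<inter> X = {}" "X \<subseteq> Y" "finite Y"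
  shows "\<exists>M' B N. mstep Y M M' \<and> meq M' N \<and> spill (den Q \<rho>) B N \<and> B \<inter> X = {}"
  using assms
proof (induction arbitrary: \<Gamma> \<rho> A M X Y rule: red.induct)
  case (red_In a b T x P v Q)
  define \<rho>' where "\<rho>' n = \<rho>(a := CI n, b := CO n)" for n
  from red_In.prems(1) obtain U V where ty: "a \<noteq> b" "wt (\<Gamma>(a \<mapsto> TI U, b \<mapsto> TO U, x \<mapsto> U)) P"
    "has_type (\<Gamma>(a \<mapsto> TI U, b \<mapsto> TO U)) v U"
    by (auto simp: legal_res_def split: if_splits)
  from red_In.prems(2) ty(1) obtain n A' M' where n: "spill (den Q (\<rho>' n)) A' M'" "n \<notin> A'" "A = insert n A'"
    "M = {#SIn (CI n) (\<lambda>w. den P ((\<rho>' n)(x := w))), SOut (CO n) (den_val (\<rho>' n) v)#} + M'"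
    unfolding den.simps
    by (elim spill_ResE spill_ParE spill_InE spill_OutE)
      (rule that[unfolded \<rho>'_def], assumption, simp_all add: add_mset_commute)
  \<comment> \<open>The new channels must avoid \<open>A\<close> as well, since the restriction of
    the redex and those of the remaining components stay in place.\<close>
  have "finite (Y \<union> A)" using red_In.prems spill_finite by blast
  then obtain B N where B: "spill (den P ((\<rho>' n)(x := den_val (\<rho>' n) v))) B N" "B \<inter> (Y \<union> A) = {}"
    using spill_exists by blast
  have "mstep Y M (N + M')" unfolding n(4) by (rule mstep_In) (use B in auto)
  moreover have "spill (den (Res a b T (Par (P\<lbrace>v/x\<rbrace>) Q)) \<rho>) (insert n (B \<union> A')) (N + M')"
    unfolding den.simps \<rho>'_def[symmetric] den_subst_typed[OF ty(2,3)]
    by (intro spill_Res[where n = n] spill_Par) (use B n in auto)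
  moreover have "insert n (B \<union> A') \<inter> X = {}" using B n red_In.prems by auto
  ultimately show ?case
    using meq_refl[of "N + M'"] by (intro exI conjI)
next
  case (red_Rep a b T x P v Q)
  define \<rho>' where "\<rho>' n = \<rho>(a := CI n, b := CO n)" for n
  from red_Rep.prems(1) obtain U V where ty: "a \<noteq> b" "wt (\<Gamma>(a \<mapsto> TI U, b \<mapsto> TO U, x \<mapsto> U)) P"
    "has_type (\<Gamma>(a \<mapsto> TI U, b \<mapsto> TO U)) v U"
    by (auto simp: legal_res_def split: if_splits)
  from red_Rep.prems(2) ty(1) obtain n A' M' where n: "spill (den Q (\<rho>' n)) A' M'" "n \<notin> A'" "A = insert n A'"
    "M = {#SRep (CI n) (\<lambda>w. den P ((\<rho>' n)(x := w))), SOut (CO n) (den_val (\<rho>' n) v)#} + M'"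
    unfolding den.simps
    by (elim spill_ResE spill_ParE spill_RepE spill_OutE)
      (rule that[unfolded \<rho>'_def], assumption, simp_all add: add_mset_commute)
  have "finite (Y \<union> A)" using red_Rep.prems spill_finite by blast
  then obtain B N where B: "spill (den P ((\<rho>' n)(x := den_val (\<rho>' n) v))) B N" "B \<inter> (Y \<union> A) = {}"
    using spill_exists by blast
  define R where "R = SRep (CI n) (\<lambda>w. den P ((\<rho>' n)(x := w)))"
  have "mstep Y M (add_mset R (N + M'))" unfolding n(4) R_def by (rule mstep_Rep) (use B in auto)
  moreover have "spill (den (Res a b T (Par (Par (Rep a x P) (P\<lbrace>v/x\<rbrace>)) Q)) \<rho>)
      (insert n (({} \<union> B) \<union> A')) (({#R#} + N) + M')" (is "spill _ ?B ?N")
    unfolding den.simps \<rho>'_def[symmetric] den_subst_typed[OF ty(2,3)] R_def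
    using ty(1) B n
    by (intro spill_Res[where n = n] spill_Par) (auto simp: \<rho>'_def intro: spill_Rep)
  moreover have "insert n (({} \<union> B) \<union> A') \<inter> X = {}" using B n red_Rep.prems by auto
  moreover have "meq (add_mset R (N + M')) ?N" using meq_refl by simp
  ultimately show ?case by (intro exI conjI)
next
  case (red_Par P P' Q)
  from red_Par.prems(2) obtain A1 A2 M1 M2 where *: "spill (den P \<rho>) A1 M1" "spill (den Q \<rho>) A2 M2"
    "A1 \<inter> A2 = {}" "A = A1 \<union> A2" "M = M1 + M2" unfolding den.simps by (elim spill_ParE)
  \<comment> \<open>Both sets grow by \<open>A2\<close>: the channels of the idle component must
    stay disjoint from those of the result.\<close>
  have "wt \<Gamma> P" "A1 \<inter> (X \<union> A2) = {}" "X \<union> A2 \<subseteq> Y \<union> A2" "finite (Y \<union> A2)"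
    using red_Par.prems * spill_finite by auto
  from red_Par.IH[OF this(1) *(1) this(2-)] obtain M' B N where
    IH: "mstep (Y \<union> A2) M1 M'" "meq M' N" "spill (den P' \<rho>) B N" "B \<inter> (X \<union> A2) = {}" by blast
  have "mstep Y M (M' + M2)"
    unfolding *(5) by (rule mstep_frame[OF mstep_anti_mono[OF IH(1)]]) blast
  moreover have "meq (M' + M2) (N + M2)" by (rule meq_add[OF IH(2) meq_refl])
  moreover have "spill (den (Par P' Q) \<rho>) (B \<union> A2) (N + M2)"
    unfolding den.simps by (rule spill_Par) (use IH * in auto)
  moreover have "(B \<union> A2) \<inter> X = {}" using IH(4) *(4) red_Par.prems(3) by blast
  ultimately show ?case by (intro exI conjI)
next
  case (red_Res P P' a b T)
  from red_Res.prems(2) obtain n A' where n: "spill (den P (\<rho>(a := CI n, b := CO n))) A' M" "n \<notin> A'"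
    "A = insert n A'" unfolding den.simps by (elim spill_ResE)
  from red_Res.prems(1) obtain \<Gamma>' where \<Gamma>': "wt \<Gamma>' P" by auto
  have "A' \<inter> (insert n X) = {}" "insert n X \<subseteq> insert n Y" "finite (insert n Y)"
    using red_Res.prems n by auto
  from red_Res.IH[OF \<Gamma>' n(1) this] obtain M' B N where IH: "mstep (insert n Y) M M'" "meq M' N"
    "spill (den P' (\<rho>(a := CI n, b := CO n))) B N" "B \<inter> insert n X = {}"
    by (elim exE conjE) (rule that)
  have "spill (den (Res a b T P') \<rho>) (insert n B) N"
    unfolding den.simps by (rule spill_Res[where n = n]) (use IH in auto)
  moreover have "mstep Y M M'" by (rule mstep_anti_mono[OF IH(1)]) blast
  moreover have "insert n B \<inter> X = {}" using IH n red_Res.prems by auto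
  ultimately show ?case using IH(2) by (intro exI conjI)
next
  case (red_scong P P' Q' Q)
  have fX: "finite X" using red_scong.prems finite_subset by blast
  obtain A1 M1 where 1: "spill (den P' \<rho>) A1 M1" "A1 \<inter> X = {}" "meq M M1"
    by (rule spill_leD[OF seq_spill_le[OF seq_den[OF red_scong.hyps(1)], THEN conjunct1]
          red_scong.prems(2) fX red_scong.prems(3)])
  have "wt \<Gamma> P'" using wt_scong red_scong by blast
  from red_scong.IH[OF this 1(1,2) red_scong.prems(4,5)] obtain M' B N where
    2: "mstep Y M1 M'" "meq M' N" "spill (den Q' \<rho>) B N" "B \<inter> X = {}" by blast
  obtain M'' where 3: "mstep Y M M''" "meq M' M''"
    using mstep_meq[OF 2(1) meq_sym[OF 1(3)] red_scong.prems(5)] by blast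
  obtain B' N' where 4: "spill (den Q \<rho>) B' N'" "B' \<inter> X = {}" "meq N N'"
    by (rule spill_leD[OF seq_spill_le[OF seq_den[OF red_scong.hyps(3)], THEN conjunct1] 2(3) fX 2(4)])
  have "meq M'' N'" by (rule meq_trans[OF meq_sym[OF 3(2)] meq_trans[OF 2(2) 4(3)]])
  with 3(1) 4(1,2) show ?case by (intro exI conjI)
qed

section \<open>Machine steps are reductions\<close>

declare sc_trans [trans]

section \<open>Normal forms: restrictions around parallel prefixes\<close>

fun nus :: "(name \<times> name \<times> ty) list \<Rightarrow> proc \<Rightarrow> proc" where
  "nus [] P = P"
| "nus ((a, b, T) # L) P = Res a b T (nus L P)"

fun nus_names :: "(name \<times> name \<times> ty) list \<Rightarrow> name set" where
  "nus_names [] = {}"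
| "nus_names ((a, b, T) # L) = {a, b} \<union> nus_names L"

fun nus_distinct :: "(name \<times> name \<times> ty) list \<Rightarrow> bool" where
  "nus_distinct [] \<longleftrightarrow> True"
| "nus_distinct ((a, b, T) # L) \<longleftrightarrow> a \<noteq> b \<and> {a, b} \<inter> nus_names L = {} \<and> nus_distinct L"

fun pars :: "proc list \<Rightarrow> proc" where
  "pars [] = Zero"
| "pars (P # Ps) = Par P (pars Ps)"

fun is_prefix :: "proc \<Rightarrow> bool" where
  "is_prefix (In a x P) \<longleftrightarrow> True"
| "is_prefix (Out a v) \<longleftrightarrow> True"
| "is_prefix (Rep a x P) \<longleftrightarrow> True"
| "is_prefix _ \<longleftrightarrow> False"

lemma finite_nus_names [simp]: "finite (nus_names L)"
  by (induction L rule: nus_names.induct) auto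

lemma nus_append: "nus (L @ L') P = nus L (nus L' P)"
  by (induction L P rule: nus.induct) auto

lemma nus_names_append [simp]: "nus_names (L @ L') = nus_names L \<union> nus_names L'"
  by (induction L rule: nus_names.induct) auto

lemma nus_distinct_append:
  "nus_distinct (L @ L') \<longleftrightarrow> nus_distinct L \<and> nus_distinct L' \<and> nus_names L \<inter> nus_names L' = {}"
  by (induction L rule: nus_distinct.induct) auto

lemma scong_nus: "scong P Q \<Longrightarrow> scong (nus L P) (nus L Q)"
  by (induction L P rule: nus.induct) (auto intro: sc_cong_Res)

lemma red_nus: "P \<longmapsto> Q \<Longrightarrow> nus L P \<longmapsto> nus L Q"
  by (induction L P rule: nus.induct) (auto intro: red_Res)

text \<open>The last clause records that restrictions introduce no name of type \<open>Unit\<close>;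
  it later forces the payload sent on a success name to be \<open>Star\<close>.\<close>

lemma wt_nus: "wt \<Gamma> (nus L P) \<Longrightarrow>
   \<exists>\<Gamma>'. wt \<Gamma>' P \<and> (\<forall>c. c \<notin> nus_names L \<longrightarrow> \<Gamma>' c = \<Gamma> c) \<and>
     (\<forall>c. \<Gamma>' c = Some Unit \<longrightarrow> \<Gamma> c = Some Unit)"
proof (induction L P arbitrary: \<Gamma> rule: nus.induct)
  case (2 a b T L P)
  then obtain U where "wt (\<Gamma>(a \<mapsto> TI U, b \<mapsto> TO U)) (nus L P)" by auto
  from 2(1)[OF this] obtain \<Gamma>' where \<Gamma>': "wt \<Gamma>' P"
    "\<And>c. c \<notin> nus_names L \<Longrightarrow> \<Gamma>' c = (\<Gamma>(a \<mapsto> TI U, b \<mapsto> TO U)) c"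
    "\<And>c. \<Gamma>' c = Some Unit \<Longrightarrow> (\<Gamma>(a \<mapsto> TI U, b \<mapsto> TO U)) c = Some Unit" by blast
  have "\<Gamma> c = Some Unit" if "\<Gamma>' c = Some Unit" for c
    using \<Gamma>'(3)[OF that] by (simp split: if_splits)
  with \<Gamma>'(1,2) show ?case by (intro exI[of _ \<Gamma>']) simp
qed auto

lemma nus_extrude: "nus_names L \<inter> fn P = {} \<Longrightarrow> scong (Par P (nus L Q)) (nus L (Par P Q))"
proof (induction L Q rule: nus.induct)
  case (2 a b T L Q)
  then have "scong (Par P (nus ((a, b, T) # L) Q)) (Res a b T (Par P (nus L Q)))"
    by (auto intro: sc_extrude)
  also have "scong (Res a b T (Par P (nus L Q))) (nus ((a, b, T) # L) (Par P Q))"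
    using 2 by (auto intro: sc_cong_Res)
  finally show ?case .
qed (simp add: sc_refl)

lemma nus_Res_comm: "{a, b} \<inter> nus_names L = {} \<Longrightarrow> scong (Res a b T (nus L P)) (nus L (Res a b T P))"
proof (induction L P rule: nus.induct)
  case (2 c d U L P)
  then have "scong (Res a b T (nus ((c, d, U) # L) P)) (Res c d U (Res a b T (nus L P)))"
    by (auto intro!: sc_Res_comm)
  also have "scong (Res c d U (Res a b T (nus L P))) (nus ((c, d, U) # L) (Res a b T P))"
    using 2 by (auto intro: sc_cong_Res)
  finally show ?case .
qed (simp add: sc_refl)

lemma pars_append: "scong (Par (pars Ps) (pars Qs)) (pars (Ps @ Qs))"
proof (induction Ps)
  case Nil
  show ?case using sc_trans[OF sc_Par_comm sc_Par_Zero] by simp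
next
  case (Cons P Ps)
  show ?case using sc_trans[OF sc_Par_assoc sc_cong_Par[OF sc_refl Cons]] by simp
qed

lemma pars_remove1: "Q \<in> set Qs \<Longrightarrow> scong (pars Qs) (Par Q (pars (remove1 Q Qs)))"
proof (induction Qs)
  case (Cons P Qs)
  show ?case
  proof (cases "P = Q")
    case False
    then have "scong (Par P (pars Qs)) (Par P (Par Q (pars (remove1 Q Qs))))"
      using Cons by (auto intro: sc_cong_Par sc_refl)
    also have "scong \<dots> (Par Q (Par P (pars (remove1 Q Qs))))"
      by (meson sc_Par_assoc sc_Par_comm sc_cong_Par sc_refl sc_sym sc_trans)
    finally show ?thesis using False by simp
  qed (simp add: sc_refl)
qed simp

lemma pars_remove2:
  assumes "P \<in> set Qs" "Q \<in> set (remove1 P Qs)"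
  shows "scong (pars Qs) (Par (Par P Q) (pars (remove1 Q (remove1 P Qs))))"
proof -
  have "scong (pars Qs) (Par P (pars (remove1 P Qs)))" using assms pars_remove1 by blast
  also have "scong \<dots> (Par P (Par Q (pars (remove1 Q (remove1 P Qs)))))"
    using assms pars_remove1 sc_cong_Par sc_refl by blast
  also have "scong \<dots> (Par (Par P Q) (pars (remove1 Q (remove1 P Qs))))"
    using sc_Par_assoc sc_sym by blast
  finally show ?thesis .
qed

lemma same_sort_fresh_pair:
  assumes "finite N"
  obtains a' b' where "same_sort a a'" "same_sort b b'" "a' \<noteq> b'" "{a', b'} \<inter> N = {}"
proof -
  define a' where "a' = fresh_name a N"
  define b' where "b' = fresh_name b (insert a' N)"
  have "a' \<notin> N" unfolding a'_def by (rule fresh_name_notin) (rule assms)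
  moreover have "b' \<notin> insert a' N" unfolding b'_def by (rule fresh_name_notin) (simp add: assms)
  ultimately show thesis using that[of a' b'] same_sort_fresh_name a'_def b'_def by auto
qed

text \<open>Pulling restrictions outwards needs binders distinct from one another and from the free
  names of the neighbours, hence the parameter \<open>N\<close>. The induction is on size because a
  renamed body is no longer a subterm, while \<open>psubst\<close> preserves size.\<close>

lemma nf_exists:
  assumes "wt \<Gamma> P" "finite N"
  shows "\<exists>L Qs. scong P (nus L (pars Qs)) \<and> nus_distinct L \<and> nus_names L \<inter> N = {} \<and>
    (\<forall>Q \<in> set Qs. is_prefix Q)"
  using assms
proof (induction P arbitrary: \<Gamma> N rule: measure_induct_rule[of size])
  case (less P)
  have prefix: ?case if "is_prefix P"
  proof -
    have "scong P (nus [] (pars [P]))" using sc_sym[OF sc_Par_Zero] by simp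
    moreover have "nus_distinct [] \<and> nus_names [] \<inter> N = {} \<and> (\<forall>Q \<in> set [P]. is_prefix Q)"
      using that by simp
    ultimately show ?thesis by blast
  qed
  show ?case
  proof (cases P)
    case Zero
    have "scong P (nus [] (pars []))" using Zero sc_refl by simp
    moreover have "nus_distinct [] \<and> nus_names [] \<inter> N = {} \<and> (\<forall>Q \<in> set []. is_prefix Q)" by simp
    ultimately show ?thesis by blast
  next
    case (Par P1 P2)
    have "finite (N \<union> fn P2)" "wt \<Gamma> P1" "size P1 < size P" using less.prems Par by auto
    from less.IH[OF this(3,2,1)] obtain L1 Q1 where 1: "scong P1 (nus L1 (pars Q1))" "nus_distinct L1"
      "nus_names L1 \<inter> (N \<union> fn P2) = {}" "\<forall>Q \<in> set Q1. is_prefix Q" by blast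
    have "finite (N \<union> fn (pars Q1) \<union> nus_names L1)" "wt \<Gamma> P2" "size P2 < size P"
      using less.prems Par by auto
    from less.IH[OF this(3,2,1)] obtain L2 Q2 where 2: "scong P2 (nus L2 (pars Q2))" "nus_distinct L2"
      "nus_names L2 \<inter> (N \<union> fn (pars Q1) \<union> nus_names L1) = {}" "\<forall>Q \<in> set Q2. is_prefix Q" by blast
    have "scong P (Par P2 (nus L1 (pars Q1)))"
      unfolding Par using 1(1) sc_Par_comm sc_cong_Par sc_refl sc_trans by meson
    also have "scong \<dots> (nus L1 (Par P2 (pars Q1)))"
      by (rule nus_extrude) (use 1 in blast)
    also have "scong \<dots> (nus L1 (Par (pars Q1) (nus L2 (pars Q2))))"
      by (rule scong_nus) (meson 2(1) sc_Par_comm sc_cong_Par sc_refl sc_trans)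
    also have "scong \<dots> (nus L1 (nus L2 (Par (pars Q1) (pars Q2))))"
      by (intro scong_nus nus_extrude) (use 2 in blast)
    also have "scong \<dots> (nus (L1 @ L2) (pars (Q1 @ Q2)))"
      unfolding nus_append by (intro scong_nus pars_append)
    finally have "scong P (nus (L1 @ L2) (pars (Q1 @ Q2)))" .
    moreover have "nus_distinct (L1 @ L2)" "nus_names (L1 @ L2) \<inter> N = {}"
      using 1 2 by (auto simp: nus_distinct_append)
    moreover have "\<forall>Q \<in> set (Q1 @ Q2). is_prefix Q" using 1 2 by auto
    ultimately show ?thesis by blast
  next
    case (Res a b T P1)
    have "finite (N \<union> fn P1)" using less.prems by simp
    then obtain a' b' where ab: "same_sort a a'" "same_sort b b'" "a' \<noteq> b'" "{a', b'} \<inter> (N \<union> fn P1) = {}"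
      by (rule same_sort_fresh_pair)
    define P2 where "P2 = psubst (Nm(a := Nm a', b := Nm b')) P1"
    have "a \<noteq> b" using less.prems Res by (auto simp: legal_res_def)
    then have sc: "scong P (Res a' b' T P2)"
      unfolding Res P2_def using ab by (intro sc_alpha_Res) auto
    then have "wt \<Gamma> (Res a' b' T P2)" using less.prems wt_scong by blast
    then obtain \<Gamma>' where "wt \<Gamma>' P2" by auto
    moreover have "size P2 < size P" unfolding P2_def size_psubst Res by simp
    moreover have "finite (insert a' (insert b' N))" using less.prems by simp
    ultimately obtain L Q where Q: "scong P2 (nus L (pars Q))" "nus_distinct L"
      "nus_names L \<inter> (insert a' (insert b' N)) = {}" "\<forall>Q \<in> set Q. is_prefix Q"
      using less.IH by blast
    have "scong P (nus ((a', b', T) # L) (pars Q))"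
      using sc_trans[OF sc sc_cong_Res[OF Q(1)]] by simp
    moreover have "nus_distinct ((a', b', T) # L)" "nus_names ((a', b', T) # L) \<inter> N = {}"
      using Q ab by auto
    ultimately show ?thesis using Q(4) by blast
  qed (use prefix in auto)
qed

section \<open>Valuations below a list of restrictions\<close>

fun upd :: "(name \<Rightarrow> sv) \<Rightarrow> (name \<times> name \<times> ty) list \<Rightarrow> nat list \<Rightarrow> name \<Rightarrow> sv" where
  "upd \<rho> ((a, b, T) # L) (n # ns) = upd (\<rho>(a := CI n, b := CO n)) L ns"
| "upd \<rho> _ _ = \<rho>"

lemma spill_nusE:
  assumes "spill (den (nus L P) \<rho>) A M"
  shows "\<exists>ns B. length ns = length L \<and> distinct ns \<and> set ns \<inter> B = {} \<and> A = set ns \<union> B \<and>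
    spill (den P (upd \<rho> L ns)) B M"
  using assms
proof (induction L P arbitrary: \<rho> A rule: nus.induct)
  case (1 P)
  then show ?case by (intro exI[of _ "[]"] exI[of _ A]) auto
next
  case (2 a b T L P)
  from 2(2) obtain n A' where n: "spill (den (nus L P) (\<rho>(a := CI n, b := CO n))) A' M" "n \<notin> A'"
    "A = insert n A'" unfolding den.simps nus.simps by (elim spill_ResE)
  from 2(1)[OF n(1)] obtain ns B where "length ns = length L" "distinct ns" "set ns \<inter> B = {}"
    "A' = set ns \<union> B" "spill (den P (upd (\<rho>(a := CI n, b := CO n)) L ns)) B M" by blast
  with n(2,3) show ?case by (intro exI[of _ "n # ns"] exI[of _ B]) auto
qed

lemma spill_nusI:
  assumes "spill (den P (upd \<rho> L ns)) B M" "length ns = length L" "distinct ns" "set ns \<inter> B = {}"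
  shows "spill (den (nus L P) \<rho>) (set ns \<union> B) M"
  using assms
proof (induction \<rho> L ns rule: upd.induct)
  case (1 \<rho> a b T L n ns)
  have "spill (den (nus L P) (\<rho>(a := CI n, b := CO n))) (set ns \<union> B) M"
    by (rule 1(1)) (use 1(2-) in \<open>simp_all del: fun_upd_apply\<close>)
  then have "spill (SRes (\<lambda>n. den (nus L P) (\<rho>(a := CI n, b := CO n)))) (insert n (set ns \<union> B)) M"
    by (rule spill_Res[where n = n]) (use 1(4,5) in auto)
  then show ?case by simp
qed auto

lemma spill_pars:
  assumes "\<forall>Q \<in> set Qs. is_prefix Q" "spill (den (pars Qs) \<rho>) A M"
  shows "A = {} \<and> M = mset (map (\<lambda>Q. den Q \<rho>) Qs)"
  using assms
proof (induction Qs arbitrary: A M)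
  case Nil
  then show ?case by (auto elim: spill_ZeroE)
next
  case (Cons Q Qs)
  from Cons.prems(2) obtain A1 A2 M1 M2 where *: "spill (den Q \<rho>) A1 M1" "spill (den (pars Qs) \<rho>) A2 M2"
    "A = A1 \<union> A2" "M = M1 + M2" unfolding den.simps pars.simps by (elim spill_ParE)
  have "A1 = {} \<and> M1 = {#den Q \<rho>#}"
    using Cons.prems(1) *(1) by (cases Q) (auto elim: spill_InE spill_OutE spill_RepE)
  with * Cons show ?case by auto
qed

lemma spill_parsI:
  assumes "\<forall>Q \<in> set Qs. is_prefix Q"
  shows "spill (den (pars Qs) \<rho>) {} (mset (map (\<lambda>Q. den Q \<rho>) Qs))"
  using assms
proof (induction Qs)
  case Nil
  then show ?case by (auto intro: spill_Zero)
next
  case (Cons Q Qs)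
  have "spill (den Q \<rho>) {} {#den Q \<rho>#}"
    using Cons.prems by (cases Q) (auto intro: spill.intros)
  from spill_Par[OF this Cons.IH] Cons.prems show ?case by auto
qed

lemma upd_notin: "upd \<rho> L ns c = CI n \<Longrightarrow> n \<notin> set ns \<Longrightarrow> \<rho> c = CI n"
  "upd \<rho> L ns c = CO n \<Longrightarrow> n \<notin> set ns \<Longrightarrow> \<rho> c = CO n"
  by (induction \<rho> L ns rule: upd.induct) (auto split: if_splits)

lemma upd_Succ: "upd \<rho> L ns c = Succ i \<Longrightarrow> length ns = length L \<Longrightarrow> c \<notin> nus_names L \<and> \<rho> c = Succ i"
  by (induction \<rho> L ns rule: upd.induct) (auto split: if_splits)

text \<open>The two ends of a channel are given out together and each number only once, so two names
  denoting the ends of \<open>n\<close> were bound by the same restriction, unless the outer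
  valuation already supplied one of them. This turns a machine communication, which merely compares
  numbers, back into a redex.\<close>

lemma upd_pair:
  assumes "upd \<rho> L ns a = CI n" "upd \<rho> L ns b = CO n" "\<rho> a \<noteq> CI n" "\<rho> b \<noteq> CO n"
    "nus_distinct L" "distinct ns" "length ns = length L"
  shows "\<exists>L1 T L2. L = L1 @ (a, b, T) # L2"
  using assms
proof (induction \<rho> L ns rule: upd.induct)
  case (1 \<rho> a0 b0 T L m ns)
  show ?case
  proof (cases "m = n")
    case True
    then have "n \<notin> set ns" using 1 by auto
    have "(\<rho>(a0 := CI m, b0 := CO m)) a = CI n"
      using upd_notin(1)[OF 1(2)[unfolded upd.simps] \<open>n \<notin> set ns\<close>] .
    moreover have "(\<rho>(a0 := CI m, b0 := CO m)) b = CO n"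
      using upd_notin(2)[OF 1(3)[unfolded upd.simps] \<open>n \<notin> set ns\<close>] .
    ultimately have "a = a0" "b = b0" using 1 by (auto split: if_splits)
    then show ?thesis by blast
  next
    case False
    then have "\<exists>L1 T L2. L = L1 @ (a, b, T) # L2"
      by (intro 1(1)) (use 1(2-) False in \<open>simp_all only: upd.simps, auto\<close>)
    then show ?thesis by (metis append_Cons)
  qed
qed auto

section \<open>Closed processes as states\<close>

definition closed_env :: env where
  "closed_env c = (if is_success c then Some (TO Unit) else None)"

text \<open>Names other than success names are not free in a closed process. The default
  \<open>SStar\<close> is no channel end, as \<open>upd_pair\<close> requires of the outer
  valuation.\<close>

fun closed_vals :: "name \<Rightarrow> sv" where
  "closed_vals (Success i) = Succ i"
| "closed_vals _ = SStar"

lemma closed_vals [simp]: "closed_vals c \<noteq> CI n" "closed_vals c \<noteq> CO n"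
  by (cases c; simp)+

lemma closed_vals_Succ: "closed_vals c = Succ i \<longleftrightarrow> c = Success i"
  by (cases c) auto

text \<open>The typing asked for is \<open>wt\<close>, which survives reduction and structural
  congruence; \<open>meq\<close> absorbs congruences below prefixes.\<close>

definition rep :: "proc \<Rightarrow> sem multiset \<Rightarrow> bool" where
  "rep P M \<longleftrightarrow> wt closed_env P \<and> (\<exists>A N. spill (den P closed_vals) A N \<and> meq N M)"

lemma rep_nf:
  assumes "rep P M"
  obtains L Qs ns where "scong P (nus L (pars Qs))" "nus_distinct L" "\<forall>Q \<in> set Qs. is_prefix Q"
    "length ns = length L" "distinct ns" "meq (mset (map (\<lambda>Q. den Q (upd closed_vals L ns)) Qs)) M"
proof -
  from assms obtain A N where N: "wt closed_env P" "spill (den P closed_vals) A N" "meq N M"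
    by (auto simp: rep_def)
  obtain L Qs where nf: "scong P (nus L (pars Qs))" "nus_distinct L" "\<forall>Q \<in> set Qs. is_prefix Q"
    using nf_exists[OF N(1), of "{}"] by auto
  obtain B N' where B: "spill (den (nus L (pars Qs)) closed_vals) B N'" "meq N N'"
    by (rule spill_leD[OF seq_spill_le[OF seq_den[OF nf(1)], THEN conjunct1] N(2), of "{}"]) simp_all
  from spill_nusE[OF B(1)] obtain ns C where ns: "length ns = length L" "distinct ns"
    "spill (den (pars Qs) (upd closed_vals L ns)) C N'" by blast
  with spill_pars[OF nf(3)] have "N' = mset (map (\<lambda>Q. den Q (upd closed_vals L ns)) Qs)" by blast
  moreover have "meq N' M" by (rule meq_trans[OF meq_sym[OF B(2)] N(3)])
  ultimately show thesis by (intro that[OF nf ns(1,2)]) simp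
qed

lemma den_SInE: "den P \<rho> = SIn k f \<Longrightarrow> \<exists>a x Q. P = In a x Q \<and> \<rho> a = k \<and> f = (\<lambda>w. den Q (\<rho>(x := w)))"
  by (cases P) auto

lemma den_SRepE: "den P \<rho> = SRep k f \<Longrightarrow> \<exists>a x Q. P = Rep a x Q \<and> \<rho> a = k \<and> f = (\<lambda>w. den Q (\<rho>(x := w)))"
  by (cases P) auto

lemma den_SOutE: "den P \<rho> = SOut k w \<Longrightarrow> \<exists>a v. P = Out a v \<and> \<rho> a = k \<and> w = den_val \<rho> v"
  by (cases P) auto

lemma mset_map_remove1:
  "x \<in> set xs \<Longrightarrow> mset (map f xs) = add_mset (f x) (mset (map f (remove1 x xs)))"
  by (induction xs) (auto simp del: mset_map mset_remove1)

lemma mset_map_pair: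
  assumes "mset (map f xs) = {#s, t#} + K"
  obtains x y where "x \<in> set xs" "y \<in> set (remove1 x xs)" "f x = s" "f y = t"
    "mset (map f (remove1 y (remove1 x xs))) = K"
proof -
  have "s \<in> set_mset (mset (map f xs))" unfolding assms by simp
  then obtain x where x: "x \<in> set xs" "f x = s" unfolding set_mset_mset set_map by blast
  have 1: "mset (map f (remove1 x xs)) = add_mset t K"
    using assms unfolding mset_map_remove1[OF x(1)] x(2) by simp
  have "t \<in> set_mset (mset (map f (remove1 x xs)))" unfolding 1 by simp
  then obtain y where y: "y \<in> set (remove1 x xs)" "f y = t" unfolding set_mset_mset set_map by blast
  have "mset (map f (remove1 y (remove1 x xs))) = K"
    using 1 unfolding mset_map_remove1[OF y(1)] y(2) by simp
  then show thesis by (intro that[OF x(1) y(1) x(2) y(2)])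
qed

text \<open>The reduction axioms want the restriction of the channel directly around the
  communicating prefixes, so it is moved inwards past the others.\<close>

lemma nus_red_context:
  assumes "L = L1 @ (a, b, T) # L2" "nus_distinct L"
  shows "scong (nus L P) (nus (L1 @ L2) (Res a b T P))"
  unfolding assms(1) nus_append nus.simps
  by (intro scong_nus nus_Res_comm) (use assms in \<open>auto simp: nus_distinct_append\<close>)

text \<open>The set \<open>Y\<close> is existential because the channels to be avoided are those
  assigned to the restrictions of one normal form of \<open>P\<close>. Callers first obtain
  \<open>Y\<close> and then exhibit a step that respects it.\<close>

lemma rep_mstep_red:
  assumes "rep P M"
  shows "\<exists>Y. finite Y \<and> (\<forall>N. mstep Y M N \<longrightarrow> (\<exists>Q. P \<longmapsto> Q \<and> rep Q N))"
proof -
  obtain L Qs ns where nf: "scong P (nus L (pars Qs))" "nus_distinct L" "\<forall>Q \<in> set Qs. is_prefix Q"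
    "length ns = length L" "distinct ns" and
    meq: "meq (mset (map (\<lambda>Q. den Q (upd closed_vals L ns)) Qs)) M"
    by (rule rep_nf[OF assms])
  define \<rho> where "\<rho> = upd closed_vals L ns"
  have wtP: "wt closed_env P" using assms by (simp add: rep_def)
  have "\<exists>Q. P \<longmapsto> Q \<and> rep Q N" if step: "mstep (set ns) M N" for N
  proof -
    obtain N' where N': "mstep (set ns) (mset (map (\<lambda>Q. den Q \<rho>) Qs)) N'" "meq N N'"
      using mstep_meq[OF step meq_sym[OF meq]] \<rho>_def by auto
    have fin: ?thesis if red: "P \<longmapsto> nus L R" and sp: "spill (den R \<rho>) B N'" and B: "B \<inter> set ns = {}" for R B
    proof -
      have "spill (den (nus L R) closed_vals) (set ns \<union> B) N'"
        by (rule spill_nusI) (use nf sp B \<rho>_def in auto)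
      then have "rep (nus L R) N"
        unfolding rep_def using wt_red[OF red wtP] meq_sym[OF N'(2)] by (intro conjI exI)
      with red show ?thesis by blast
    qed
    \<comment> \<open>Both kinds of communication share this part: the two prefixes are brought
      together and their common restriction is moved inside. Only the result \<open>E\<close> of the
      redex and its unrolling \<open>K\<close> differ.\<close>
    have comm: ?thesis if Q: "Q1 \<in> set Qs" "Q2 \<in> set (remove1 Q1 Qs)"
      "mset (map (\<lambda>Q. den Q \<rho>) (remove1 Q2 (remove1 Q1 Qs))) = M'"
      and ab: "\<rho> a = CI c" "\<rho> b = CO c"
      and red: "\<And>T S. Res a b T (Par (Par Q1 Q2) S) \<longmapsto> Res a b T (Par E S)"
      and E: "\<And>\<Gamma> T S. wt \<Gamma> (Res a b T (Par (Par Q1 Q2) S)) \<Longrightarrow> spill (den E \<rho>) B K"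
      and B: "B \<inter> set ns = {}" and N'': "N' = K + M'" for Q1 Q2 M' a b c E B K
    proof -
      obtain L1 T L2 where L: "L = L1 @ (a, b, T) # L2"
        using upd_pair[of closed_vals L ns a c b] ab nf(2,4,5) unfolding \<rho>_def by auto
      define S where "S = pars (remove1 Q2 (remove1 Q1 Qs))"
      have "scong P (nus L (Par (Par Q1 Q2) S))"
        using sc_trans[OF nf(1) scong_nus[OF pars_remove2[OF Q(1,2)]]] unfolding S_def .
      also have "scong \<dots> (nus (L1 @ L2) (Res a b T (Par (Par Q1 Q2) S)))"
        by (rule nus_red_context[OF L nf(2)])
      finally have sc: "scong P (nus (L1 @ L2) (Res a b T (Par (Par Q1 Q2) S)))" .
      obtain \<Gamma> where "wt \<Gamma> (Res a b T (Par (Par Q1 Q2) S))"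
        using wtP wt_nus unfolding wt_scong[OF sc] by blast
      note sE = E[OF this]
      have "set (remove1 Q2 (remove1 Q1 Qs)) \<subseteq> set Qs"
        by (meson order_trans set_remove1_subset)
      then have sS: "spill (den S \<rho>) {} M'"
        unfolding S_def Q(3)[symmetric] by (intro spill_parsI) (use nf(3) in blast)
      have "spill (den (Par E S) \<rho>) (B \<union> {}) N'"
        unfolding den.simps N'' by (rule spill_Par[OF sE sS]) simp
      moreover have "P \<longmapsto> nus L (Par E S)"
        by (rule red_scong[OF sc red_nus[OF red] sc_sym[OF nus_red_context[OF L nf(2)]]])
      ultimately show ?thesis using B by (intro fin) (simp_all only: Un_empty_right)
    qed
    from N'(1) show ?thesis
    proof cases
      case (mstep_In f w B K c M')
      obtain Q1 Q2 where Q: "Q1 \<in> set Qs" "Q2 \<in> set (remove1 Q1 Qs)" "den Q1 \<rho> = SIn (CI c) f"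
        "den Q2 \<rho> = SOut (CO c) w" "mset (map (\<lambda>Q. den Q \<rho>) (remove1 Q2 (remove1 Q1 Qs))) = M'"
        by (rule mset_map_pair[OF mstep_In(1)])
      obtain a x R where Q1: "Q1 = In a x R" "\<rho> a = CI c" "f = (\<lambda>w. den R (\<rho>(x := w)))"
        using den_SInE[OF Q(3)] by blast
      obtain b v where Q2: "Q2 = Out b v" "\<rho> b = CO c" "w = den_val \<rho> v"
        using den_SOutE[OF Q(4)] by blast
      have "spill (den (R\<lbrace>v/x\<rbrace>) \<rho>) B K" if wt: "wt \<Gamma> (Res a b T (Par (Par Q1 Q2) S))" for \<Gamma> T S
      proof -
        from wt obtain U where U: "wt (\<Gamma>(a \<mapsto> TI U, b \<mapsto> TO U, x \<mapsto> U)) R"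
          "has_type (\<Gamma>(a \<mapsto> TI U, b \<mapsto> TO U)) v U"
          unfolding Q1 Q2 by (auto simp: legal_res_def split: if_splits)
        show ?thesis unfolding den_subst_typed[OF U] using mstep_In(3) unfolding Q1(3) Q2(3) .
      qed
      then show ?thesis
        by (rule comm[OF Q(1,2,5) Q1(2) Q2(2) red_In[of a b _ x R v, folded Q1(1) Q2(1)] _ mstep_In(4,2)])
    next
      case (mstep_Rep f w B K c M')
      obtain Q1 Q2 where Q: "Q1 \<in> set Qs" "Q2 \<in> set (remove1 Q1 Qs)" "den Q1 \<rho> = SRep (CI c) f"
        "den Q2 \<rho> = SOut (CO c) w" "mset (map (\<lambda>Q. den Q \<rho>) (remove1 Q2 (remove1 Q1 Qs))) = M'"
        by (rule mset_map_pair[OF mstep_Rep(1)])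
      obtain a x R where Q1: "Q1 = Rep a x R" "\<rho> a = CI c" "f = (\<lambda>w. den R (\<rho>(x := w)))"
        using den_SRepE[OF Q(3)] by blast
      obtain b v where Q2: "Q2 = Out b v" "\<rho> b = CO c" "w = den_val \<rho> v"
        using den_SOutE[OF Q(4)] by blast
      have "spill (den (Par Q1 (R\<lbrace>v/x\<rbrace>)) \<rho>) ({} \<union> B) ({#SRep (CI c) f#} + K)"
        if wt: "wt \<Gamma> (Res a b T (Par (Par Q1 Q2) S))" for \<Gamma> T S
      proof -
        from wt obtain U where U: "wt (\<Gamma>(a \<mapsto> TI U, b \<mapsto> TO U, x \<mapsto> U)) R"
          "has_type (\<Gamma>(a \<mapsto> TI U, b \<mapsto> TO U)) v U"
          unfolding Q1 Q2 by (auto simp: legal_res_def split: if_splits)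
        have "spill (den (R\<lbrace>v/x\<rbrace>) \<rho>) B K"
          unfolding den_subst_typed[OF U] using mstep_Rep(3) unfolding Q1(3) Q2(3) .
        from spill_Par[OF spill_Rep this] show ?thesis unfolding den.simps Q(3) by simp
      qed
      then show ?thesis
      proof (rule comm[OF Q(1,2,5) Q1(2) Q2(2) red_Rep[of a b _ x R v, folded Q1(1) Q2(1)]])
        show "({} \<union> B) \<inter> set ns = {}" using mstep_Rep(4) by simp
        show "N' = ({#SRep (CI c) f#} + K) + M'" using mstep_Rep(2) by simp
      qed
    qed
  qed
  then show ?thesis by blast
qed

lemma rep_red_mstep:
  assumes "rep P M" "P \<longmapsto> Q" "finite Y"
  shows "\<exists>N. mstep Y M N \<and> rep Q N"
proof -
  from assms(1) obtain A M0 where M0: "wt closed_env P" "spill (den P closed_vals) A M0" "meq M0 M"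
    by (auto simp: rep_def)
  from red_mstep[OF assms(2) M0(1,2), of "{}" Y] assms(3) obtain M' B N where
    1: "mstep Y M0 M'" "meq M' N" "spill (den Q closed_vals) B N" by auto
  obtain N' where 2: "mstep Y M N'" "meq M' N'" using mstep_meq[OF 1(1) M0(3) assms(3)] by blast
  have "meq N N'" by (rule meq_trans[OF meq_sym[OF 1(2)] 2(2)])
  with wt_red[OF assms(2) M0(1)] 1(3) have "rep Q N'" unfolding rep_def by (intro conjI exI)
  with 2 show ?thesis by blast
qed

lemma rep_barb:
  assumes "rep P M"
  shows "barb P \<omega> \<longleftrightarrow> (\<exists>i. \<omega> = Success i \<and> SOut (Succ i) SStar \<in># M)"
proof
  assume "barb P \<omega>"
  then obtain P' i where P': "scong P (Par (Out \<omega> Star) P')" "\<omega> = Success i"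
    by (auto simp: barb_def elim: is_success.elims)
  from assms obtain A M0 where M0: "wt closed_env P" "spill (den P closed_vals) A M0" "meq M0 M"
    by (auto simp: rep_def)
  obtain B N where B: "spill (den (Par (Out \<omega> Star) P') closed_vals) B N" "meq M0 N"
    by (rule spill_leD[OF seq_spill_le[OF seq_den[OF P'(1)], THEN conjunct1] M0(2), of "{}"]) simp_all
  then obtain K where "N = add_mset (SOut (Succ i) SStar) K"
    unfolding den.simps P'(2) by (auto elim!: spill_ParE spill_OutE)
  moreover have "meq N M" by (rule meq_trans[OF meq_sym[OF B(2)] M0(3)])
  ultimately have "SOut (Succ i) SStar \<in># M" by (auto dest!: msed_rel_invL elim!: peq_OutE)
  with P' show "\<exists>i. \<omega> = Success i \<and> SOut (Succ i) SStar \<in># M" by blast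
next
  assume "\<exists>i. \<omega> = Success i \<and> SOut (Succ i) SStar \<in># M"
  then obtain i where i: "\<omega> = Success i" "SOut (Succ i) SStar \<in># M" by blast
  obtain L Qs ns where nf: "scong P (nus L (pars Qs))" "nus_distinct L" "\<forall>Q \<in> set Qs. is_prefix Q"
    "length ns = length L" "distinct ns" and
    meq: "meq (mset (map (\<lambda>Q. den Q (upd closed_vals L ns)) Qs)) M"
    by (rule rep_nf[OF assms])
  obtain K where "M = add_mset (SOut (Succ i) SStar) K" using i(2) by (metis multi_member_split)
  with meq_sym[OF meq] obtain K'
    where K': "mset (map (\<lambda>Q. den Q (upd closed_vals L ns)) Qs) = add_mset (SOut (Succ i) SStar) K'"
    by (auto dest!: msed_rel_invL elim!: peq_OutE simp del: mset_map)
  have "SOut (Succ i) SStar \<in> set_mset (mset (map (\<lambda>Q. den Q (upd closed_vals L ns)) Qs))"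
    unfolding K' by simp
  then obtain Q where Q: "Q \<in> set Qs" "den Q (upd closed_vals L ns) = SOut (Succ i) SStar"
    unfolding set_mset_mset set_map by (auto dest: sym)
  from den_SOutE[OF Q(2)] obtain a v where a: "Q = Out a v" "upd closed_vals L ns a = Succ i"
    "SStar = den_val (upd closed_vals L ns) v" by blast
  from upd_Succ[OF a(2) nf(4)] have a': "a = \<omega>" "a \<notin> nus_names L"
    using i(1) by (auto simp: closed_vals_Succ)
  have sc: "scong P (nus L (Par Q (pars (remove1 Q Qs))))"
    using sc_trans[OF nf(1) scong_nus[OF pars_remove1[OF Q(1)]]] .
  then have "wt closed_env (nus L (Par Q (pars (remove1 Q Qs))))"
    using assms wt_scong rep_def by blast
  from wt_nus[OF this] obtain \<Gamma> where \<Gamma>: "wt \<Gamma> Q" "\<Gamma> \<omega> = closed_env \<omega>" "\<And>c. \<Gamma> c = Some Unit \<Longrightarrow> closed_env c = Some Unit"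
    using a' by auto
  \<comment> \<open>A success name carries type \<open>Unit\<close>, and no name has this type in
    \<open>closed_env\<close> or below the restrictions of \<open>L\<close>, so the payload can only
    be \<open>Star\<close>.\<close>
  have "closed_env c \<noteq> Some Unit" for c by (simp add: closed_env_def)
  with \<Gamma> i(1) a(1) a'(1) have v: "v = Star" by (cases v) (auto simp: closed_env_def)
  have "scong (nus L (Par Q (pars (remove1 Q Qs)))) (Par Q (nus L (pars (remove1 Q Qs))))"
    by (rule sc_sym, rule nus_extrude) (use a v a' in auto)
  with sc have "scong P (Par (Out \<omega> Star) (nus L (pars (remove1 Q Qs))))"
    using sc_trans a(1) v a'(1) by blast
  with i(1) show "barb P \<omega>" by (auto simp: barb_def)
qed

section \<open>Linear typing\<close>

text \<open>Linear typing with one global environment. Splitting is replaced by the condition that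
  parallel components share no free name of input type, and the output environment of a replication
  by the condition that its body, apart from the parameter, has only output names free. In this form
  typing is monotone in the environment.\<close>

primrec tp :: "env \<Rightarrow> proc \<Rightarrow> bool" where
  "tp \<Gamma> Zero \<longleftrightarrow> True"
| "tp \<Gamma> (Par P Q) \<longleftrightarrow> tp \<Gamma> P \<and> tp \<Gamma> Q \<and> (\<forall>c \<in> fn P \<inter> fn Q. \<forall>T. \<Gamma> c \<noteq> Some (TI T))"
| "tp \<Gamma> (In a x P) \<longleftrightarrow> (\<exists>T. \<Gamma> a = Some (TI T) \<and> tp (\<Gamma>(x \<mapsto> T)) P)"
| "tp \<Gamma> (Out a v) \<longleftrightarrow> (\<exists>T. \<Gamma> a = Some (TO T) \<and> has_type \<Gamma> v T)"
| "tp \<Gamma> (Res a b T P) \<longleftrightarrow> legal_res a b T \<and> (\<exists>U. T = TI U \<and> tp (\<Gamma>(a \<mapsto> TI U, b \<mapsto> TO U)) P)"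
| "tp \<Gamma> (Rep a x P) \<longleftrightarrow> (\<exists>T. \<Gamma> a = Some (TI T) \<and> tp (\<Gamma>(x \<mapsto> T)) P \<and>
     (\<forall>c \<in> fn P - {x}. \<exists>U. \<Gamma> c = Some (TO U)))"

lemma tp_wt: "tp \<Gamma> P \<Longrightarrow> wt \<Gamma> P"
  by (induction P arbitrary: \<Gamma>) auto

lemma tp_fn_dom: "tp \<Gamma> P \<Longrightarrow> fn P \<subseteq> dom \<Gamma>"
  using tp_wt wt_fn_dom by blast

lemma tp_cong: "(\<And>c. c \<in> fn P \<Longrightarrow> \<Gamma> c = \<Gamma>' c) \<Longrightarrow> tp \<Gamma> P = tp \<Gamma>' P"
proof (induction P arbitrary: \<Gamma> \<Gamma>')
  case (Par P Q)
  have "tp \<Gamma> P = tp \<Gamma>' P" "tp \<Gamma> Q = tp \<Gamma>' Q" using Par.prems by (auto intro!: Par.IH)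
  then show ?case using Par.prems by auto
next
  case (In a x P)
  have "tp (\<Gamma>(x \<mapsto> T)) P = tp (\<Gamma>'(x \<mapsto> T)) P" for T
    by (rule In.IH) (use In.prems in auto)
  then show ?case using In.prems by simp
next
  case (Out a v)
  then show ?case using has_type_cong[of v \<Gamma> \<Gamma>'] by auto
next
  case (Res a b T P)
  have "tp (\<Gamma>(a \<mapsto> TI U, b \<mapsto> TO U)) P = tp (\<Gamma>'(a \<mapsto> TI U, b \<mapsto> TO U)) P" for U
    by (rule Res.IH) (use Res.prems in auto)
  then show ?case by simp
next
  case (Rep a x P)
  have "tp (\<Gamma>(x \<mapsto> T)) P = tp (\<Gamma>'(x \<mapsto> T)) P" for T
    by (rule Rep.IH) (use Rep.prems in auto)
  then show ?case using Rep.prems by auto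
qed simp

lemma tp_mono: "tp \<Gamma> P \<Longrightarrow> \<Gamma> \<subseteq>\<^sub>m \<Gamma>' \<Longrightarrow> tp \<Gamma>' P"
proof -
  assume tp: "tp \<Gamma> P" and le: "\<Gamma> \<subseteq>\<^sub>m \<Gamma>'"
  have "\<Gamma> c = \<Gamma>' c" if "c \<in> fn P" for c
    using tp_fn_dom[OF tp] le that by (auto simp: map_le_def)
  with tp tp_cong show ?thesis by blast
qed

lemma agree_map_le:
  assumes "agree \<Gamma> \<Gamma>'"
  shows "\<Gamma> \<subseteq>\<^sub>m \<Gamma> ++ \<Gamma>'" "\<Gamma>' \<subseteq>\<^sub>m \<Gamma> ++ \<Gamma>'"
proof -
  have "\<Gamma> c = (\<Gamma> ++ \<Gamma>') c" if "c \<in> dom \<Gamma>" for c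
    using assms that by (cases "c \<in> dom \<Gamma>'") (auto simp: agree_def map_add_dom_app_simps)
  then show "\<Gamma> \<subseteq>\<^sub>m \<Gamma> ++ \<Gamma>'" by (simp add: map_le_def)
  show "\<Gamma>' \<subseteq>\<^sub>m \<Gamma> ++ \<Gamma>'" by (rule map_le_map_add)
qed

lemma tp_Par:
  assumes "tp \<Gamma>1 P" "tp \<Gamma>2 Q" "agree \<Gamma>1 \<Gamma>2" "inputs \<Gamma>1 \<inter> inputs \<Gamma>2 = {}"
  shows "tp (\<Gamma>1 ++ \<Gamma>2) (Par P Q)"
proof -
  have "(\<Gamma>1 ++ \<Gamma>2) c \<noteq> Some (TI T)" if "c \<in> fn P \<inter> fn Q" for c T
  proof
    assume "(\<Gamma>1 ++ \<Gamma>2) c = Some (TI T)"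
    moreover have "c \<in> dom \<Gamma>1" "c \<in> dom \<Gamma>2" using that tp_fn_dom assms by blast+
    ultimately have "c \<in> inputs \<Gamma>1 \<inter> inputs \<Gamma>2"
      using assms(3) by (auto simp: inputs_def agree_def)
    with assms(4) show False by blast
  qed
  with assms agree_map_le tp_mono show ?thesis by auto
qed

lemma tp_Rep:
  assumes "\<Gamma> a = Some (TI T)" "\<Gamma>o \<subseteq>\<^sub>m \<Gamma>" "output_env \<Gamma>o" "tp (\<Gamma>o(x \<mapsto> T)) P"
  shows "tp \<Gamma> (Rep a x P)"
proof -
  have "tp (\<Gamma>(x \<mapsto> T)) P"
    using assms(4) by (rule tp_mono) (use assms(2) in \<open>auto simp: map_le_def\<close>)
  moreover have "\<exists>U. \<Gamma> c = Some (TO U)" if "c \<in> fn P - {x}" for c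
  proof -
    have "c \<in> dom \<Gamma>o" using tp_fn_dom[OF assms(4)] that by auto
    with assms(2,3) show ?thesis
      by (force simp: output_env_def map_le_def dom_def ran_def)
  qed
  ultimately show ?thesis using assms(1) by simp
qed

lemma typing_tp: "\<Gamma> \<turnstile> P \<Longrightarrow> tp \<Gamma> P"
  by (induction rule: typing.induct) (auto simp del: tp.simps(2,6) fun_upd_apply intro: tp_Par tp_Rep)

lemma ctx_typing_tp: "ctx_typing \<Delta> \<Gamma> C \<Longrightarrow> \<Delta> \<turnstile> P \<Longrightarrow> tp \<Gamma> (C\<langle>P\<rangle>)"
proof (induction rule: ctx_typing.induct)
  case (C_Hole \<Gamma>)
  then have "\<Delta> \<subseteq>\<^sub>m \<Gamma>" using agree_map_le by (auto simp: extends_env_def)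
  with typing_tp[OF C_Hole.prems] tp_mono show ?case by simp
qed (auto simp del: tp.simps(2,6) fun_upd_apply intro: tp_Par tp_Rep typing_tp)

lemma ctx_typing_type_env: "ctx_typing \<Delta> \<Gamma> C \<Longrightarrow> type_env \<Gamma>"
proof -
  have *: "type_env \<Gamma>" if "\<Gamma> \<turnstile> P" for \<Gamma> P
    using that by (induction rule: typing.induct) (auto simp: type_env_def map_add_Some_iff)
  show "ctx_typing \<Delta> \<Gamma> C \<Longrightarrow> type_env \<Gamma>"
  proof (induction rule: ctx_typing.induct)
    case (C_ParL \<Gamma>1 C \<Gamma>2 Q)
    then show ?case using *[OF C_ParL(2)] by (auto simp: type_env_def map_add_Some_iff)
  next
    case (C_ParR \<Gamma>1 P \<Gamma>2 C)
    then show ?case using *[OF C_ParR(1)] by (auto simp: type_env_def map_add_Some_iff)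
  qed (auto simp: extends_env_def)
qed

text \<open>\<open>type_env\<close> forces the type \<open>TO Unit\<close> on success names, so
  every closing environment lies below \<open>closed_env\<close>. The latter may be infinite because
  \<open>tp\<close> looks at free names only.\<close>

lemma closing_tp:
  assumes "closing \<Delta> C" "\<Delta> \<turnstile> P"
  shows "tp closed_env (C\<langle>P\<rangle>)"
proof -
  from assms(1) obtain \<Gamma> where \<Gamma>: "\<forall>c \<in> dom \<Gamma>. is_success c" "ctx_typing \<Delta> \<Gamma> C"
    by (auto simp: closing_def)
  have "\<Gamma> c = closed_env c" if c: "c \<in> dom \<Gamma>" for c
  proof -
    obtain i where "c = Success i" using \<Gamma>(1) c by (metis is_success.elims(2))
    with c ctx_typing_type_env[OF \<Gamma>(2)] show ?thesis
      by (force simp: type_env_def closed_env_def)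
  qed
  then have "\<Gamma> \<subseteq>\<^sub>m closed_env" by (simp add: map_le_def)
  with ctx_typing_tp[OF \<Gamma>(2) assms(2)] tp_mono show ?thesis by blast
qed

section \<open>Contracting wires\<close>

text \<open>The compatible closure of the law. In \<open>contr_wire\<close> the body is contracted
  before the substitution, so nested wires disappear within one derivation. Freshness of
  \<open>b'\<close> for \<open>P\<close> leaves the wire as the only receiver when \<open>b'\<close>
  is the input end; freshness for \<open>P'\<close> makes the value of \<open>b'\<close> irrelevant
  on the contracted side.\<close>

inductive contr :: "proc \<Rightarrow> proc \<Rightarrow> bool" where
  contr_Zero: "contr Zero Zero"
| contr_Par: "contr P P' \<Longrightarrow> contr Q Q' \<Longrightarrow> contr (Par P Q) (Par P' Q')"
| contr_In: "contr P P' \<Longrightarrow> contr (In a x P) (In a x P')"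
| contr_Out: "contr (Out a v) (Out a v)"
| contr_Res: "contr P P' \<Longrightarrow> contr (Res a b T P) (Res a b T P')"
| contr_Rep: "contr P P' \<Longrightarrow> contr (Rep a x P) (Rep a x P')"
| contr_wire: "contr P P' \<Longrightarrow> companions b b' \<Longrightarrow> is_I b = is_I a \<Longrightarrow> b \<noteq> a \<Longrightarrow>
    b' \<notin> fn P \<Longrightarrow> b' \<notin> fn P' \<Longrightarrow>
    contr (nu b b' U (Par (link U b' a) P)) (P'\<lbrace>Nm a/b\<rbrace>)"

lemma contr_refl: "contr P P"
  by (induction P) (auto intro: contr.intros)

lemma contr_fill: "contr P Q \<Longrightarrow> contr (C\<langle>P\<rangle>) (C\<langle>Q\<rangle>)"
  by (induction C) (auto intro: contr.intros contr_refl)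

section \<open>Channel ends and the invariant of states with wires\<close>

fun ids :: "sv \<Rightarrow> nat set" where
  "ids (CI n) = {n}"
| "ids (CO n) = {n}"
| "ids _ = {}"

text \<open>The values on which a message can be sent, hence the possible targets of wires; a wire
  may also lead to a success name.\<close>

fun is_out :: "sv \<Rightarrow> bool" where
  "is_out (CO n) \<longleftrightarrow> True"
| "is_out (Succ i) \<longleftrightarrow> True"
| "is_out _ \<longleftrightarrow> False"

fun svty :: "(nat \<Rightarrow> ty) \<Rightarrow> sv \<Rightarrow> ty" where
  "svty \<Sigma> (CI n) = TI (\<Sigma> n)"
| "svty \<Sigma> (CO n) = TO (\<Sigma> n)"
| "svty \<Sigma> (Succ i) = TO Unit"
| "svty \<Sigma> SStar = Unit"

definition env_of :: "(nat \<Rightarrow> ty) \<Rightarrow> (name \<Rightarrow> sv) \<Rightarrow> env" where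
  "env_of \<Sigma> \<rho> c = Some (svty \<Sigma> (\<rho> c))"

text \<open>
  The last case of \<open>merge\<close> on \<open>CI n\<close> is a dummy: a channel merged with a success name has no
  receiver besides its wire.
\<close>

fun merge :: "(nat \<Rightarrow> sv) \<Rightarrow> sv \<Rightarrow> sv" where
  "merge \<theta> (CO n) = \<theta> n"
| "merge \<theta> (CI n) = (case \<theta> n of CO j \<Rightarrow> CI j | _ \<Rightarrow> CI n)"
| "merge \<theta> w = w"

text \<open>In \<open>(\<rho>, P, P')\<close>, \<open>P\<close> runs in the process with wires and \<open>P'\<close> in the contracted one.\<close>

type_synonym closure = "(name \<Rightarrow> sv) \<times> proc \<times> proc"

text \<open>Any free occurrence counts, not only that of a subject: an input end about to be sent as
  a payload is held as well.\<close>

fun holds :: "nat \<Rightarrow> closure \<Rightarrow> bool" where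
  "holds m (\<rho>, P, P') \<longleftrightarrow> (\<exists>c \<in> fn P. \<rho> c = CI m)"

text \<open>\<open>tp\<close> separates the free names of parallel components, not the channels
  behind them. The last clause, at most one free name for each input end, turns separation of names
  into separation of channels.\<close>

fun closure_ok :: "(nat \<Rightarrow> ty) \<Rightarrow> nat set \<Rightarrow> closure \<Rightarrow> bool" where
  "closure_ok \<Sigma> X (\<rho>, P, P') \<longleftrightarrow> contr P P' \<and> (\<forall>c. ids (\<rho> c) \<subseteq> X) \<and> tp (env_of \<Sigma> \<rho>) P \<and>
     (\<forall>c \<in> fn P. \<forall>d \<in> fn P. \<forall>m. \<rho> c = CI m \<longrightarrow> \<rho> d = CI m \<longrightarrow> c = d)"

definition edges :: "(nat \<rightharpoonup> sv) \<Rightarrow> (sv \<times> sv) set" where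
  "edges W = {(CO m, k) | m k. W m = Some k}"

text \<open>
  \<open>W\<close> maps the source of each wire to its target, and \<open>\<theta>\<close> identifies the ends of wires. By the
  last clause, a channel without outgoing wire receives, through the wires, everything that is
  sent on the channels it is identified with.
\<close>

definition net_ok :: "(nat \<Rightarrow> ty) \<Rightarrow> nat set \<Rightarrow> nat set \<Rightarrow> (nat \<Rightarrow> sv) \<Rightarrow> (nat \<rightharpoonup> sv) \<Rightarrow> bool" where
  "net_ok \<Sigma> X X' \<theta> W \<longleftrightarrow> finite X \<and> finite X' \<and>
     (\<forall>n \<in> X. is_out (\<theta> n) \<and> ids (\<theta> n) \<subseteq> X') \<and>
     (\<forall>m k. W m = Some k \<longrightarrow> m \<in> X \<and> is_out k \<and> ids k \<subseteq> X \<and> merge \<theta> k = \<theta> m \<and>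
        svty \<Sigma> k = TO (\<Sigma> m)) \<and>
     (\<forall>u v. is_out u \<longrightarrow> ids u \<subseteq> X \<longrightarrow> is_out v \<longrightarrow> ids v \<subseteq> X \<longrightarrow> merge \<theta> u = merge \<theta> v \<longrightarrow>
        v \<notin> Domain (edges W) \<longrightarrow> (u, v) \<in> (edges W)\<^sup>*)"

definition holders :: "nat \<Rightarrow> (nat \<rightharpoonup> sv) \<Rightarrow> closure multiset \<Rightarrow> nat" where
  "holders m W K = size (filter_mset (holds m) K) + (if m \<in> dom W then 1 else 0)"

text \<open>
  The bound on \<open>holders\<close> is the linearity of input capabilities: nobody competes with a wire for
  the messages at its source.
\<close>

definition valid :: "(nat \<Rightarrow> ty) \<Rightarrow> nat set \<Rightarrow> nat set \<Rightarrow> (nat \<Rightarrow> sv) \<Rightarrow> (nat \<rightharpoonup> sv) \<Rightarrow> closure multiset \<Rightarrow> bool"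
  where
  "valid \<Sigma> X X' \<theta> W K \<longleftrightarrow> net_ok \<Sigma> X X' \<theta> W \<and> (\<forall>\<kappa> \<in># K. closure_ok \<Sigma> X \<kappa>) \<and> (\<forall>m. holders m W K \<le> 1)"

lemma svty_cong: "(\<And>n. n \<in> ids w \<Longrightarrow> \<Sigma> n = \<Sigma>' n) \<Longrightarrow> svty \<Sigma> w = svty \<Sigma>' w"
  by (cases w) auto

lemma merge_cong: "(\<And>n. n \<in> ids w \<Longrightarrow> \<theta> n = \<theta>' n) \<Longrightarrow> merge \<theta> w = merge \<theta>' w"
  by (cases w) auto

lemma svty_TI: "svty \<Sigma> w = TI T \<Longrightarrow> \<exists>m. w = CI m \<and> \<Sigma> m = T"
  by (cases w) auto

lemma svty_TO: "svty \<Sigma> w = TO T \<Longrightarrow> is_out w"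
  by (cases w) auto

lemma env_of_upd: "env_of \<Sigma> (\<rho>(x := w)) = (env_of \<Sigma> \<rho>)(x \<mapsto> svty \<Sigma> w)"
  by (auto simp: env_of_def)

lemma has_type_env_of: "has_type (env_of \<Sigma> \<rho>) v T \<longleftrightarrow> svty \<Sigma> (den_val \<rho> v) = T"
  by (cases v) (auto simp: env_of_def)

lemma closure_ok_mono:
  assumes "closure_ok \<Sigma> X \<kappa>" "X \<subseteq> X1" "\<And>n. n \<in> X \<Longrightarrow> \<Sigma>1 n = \<Sigma> n"
  shows "closure_ok \<Sigma>1 X1 \<kappa>"
proof -
  obtain \<rho> P P' where \<kappa>: "\<kappa> = (\<rho>, P, P')" by (cases \<kappa>)
  have "svty \<Sigma>1 (\<rho> c) = svty \<Sigma> (\<rho> c)" for c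
    by (rule svty_cong) (use assms \<kappa> in auto)
  then have "env_of \<Sigma>1 \<rho> = env_of \<Sigma> \<rho>" by (simp add: env_of_def fun_eq_iff)
  with assms \<kappa> show ?thesis by auto
qed

lemma holders_add: "holders m W (add_mset \<kappa> K) = (if holds m \<kappa> then 1 else 0) + holders m W K"
  by (simp add: holders_def)

lemma holds_in_X: "closure_ok \<Sigma> X \<kappa> \<Longrightarrow> holds m \<kappa> \<Longrightarrow> m \<in> X"
  by (cases \<kappa>) (auto; metis ids.simps(1) insert_subset)

lemma valid_drop: "valid \<Sigma> X X' \<theta> W (K' + K) \<Longrightarrow> valid \<Sigma> X X' \<theta> W K"
proof -
  have "holders m W K \<le> holders m W (K' + K)" for m by (simp add: holders_def)
  then show "valid \<Sigma> X X' \<theta> W (K' + K) \<Longrightarrow> valid \<Sigma> X X' \<theta> W K"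
    unfolding valid_def by (meson le_trans union_iff)
qed

text \<open>If both components held the input end of \<open>m\<close>, the injectivity clause would
  make it a single shared free name of input type, which \<open>tp\<close> excludes. So the count of
  holders does not grow.\<close>

lemma valid_Par:
  assumes "valid \<Sigma> X X' \<theta> W (add_mset (\<rho>, Par P Q, R) K)" "contr P P'" "contr Q Q'"
  shows "valid \<Sigma> X X' \<theta> W (add_mset (\<rho>, P, P') (add_mset (\<rho>, Q, Q') K))"
proof -
  have ok: "closure_ok \<Sigma> X (\<rho>, Par P Q, R)" using assms(1) by (simp add: valid_def)
  have "\<not> (holds m (\<rho>, P, P') \<and> holds m (\<rho>, Q, Q'))" for m
  proof
    assume "holds m (\<rho>, P, P') \<and> holds m (\<rho>, Q, Q')"
    then obtain c d where c: "c \<in> fn P" "\<rho> c = CI m" "d \<in> fn Q" "\<rho> d = CI m" by auto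
    with ok have "c = d" by auto
    with c have "c \<in> fn P \<inter> fn Q" by simp
    with ok have "env_of \<Sigma> \<rho> c \<noteq> Some (TI (\<Sigma> m))" by (simp del: Int_iff)
    with c(2) show False by (simp add: env_of_def)
  qed
  then have "holders m W (add_mset (\<rho>, P, P') (add_mset (\<rho>, Q, Q') K))
    \<le> holders m W (add_mset (\<rho>, Par P Q, R) K)" for m
    by (auto simp: holders_add)
  moreover have "closure_ok \<Sigma> X (\<rho>, P, P')" "closure_ok \<Sigma> X (\<rho>, Q, Q')" using ok assms by auto
  ultimately show ?thesis using assms(1) unfolding valid_def
    by (metis (no_types, lifting) add_mset_remove_trivial_If insert_iff le_trans set_mset_add_mset_insert)
qed

section \<open>Growing the network of wires\<close>

lemma net_okI:
  assumes "finite X" "finite X'" "\<And>n. n \<in> X \<Longrightarrow> is_out (\<theta> n) \<and> ids (\<theta> n) \<subseteq> X'"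
    "\<And>m k. W m = Some k \<Longrightarrow> m \<in> X \<and> is_out k \<and> ids k \<subseteq> X \<and> merge \<theta> k = \<theta> m \<and> svty \<Sigma> k = TO (\<Sigma> m)"
    "\<And>u v. is_out u \<Longrightarrow> ids u \<subseteq> X \<Longrightarrow> is_out v \<Longrightarrow> ids v \<subseteq> X \<Longrightarrow> merge \<theta> u = merge \<theta> v \<Longrightarrow>
      v \<notin> Domain (edges W) \<Longrightarrow> (u, v) \<in> (edges W)\<^sup>*"
  shows "net_ok \<Sigma> X X' \<theta> W"
  using assms unfolding net_ok_def by simp

lemma net_okD:
  assumes "net_ok \<Sigma> X X' \<theta> W"
  shows "finite X" "finite X'" "\<And>n. n \<in> X \<Longrightarrow> is_out (\<theta> n) \<and> ids (\<theta> n) \<subseteq> X'"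
    "\<And>m k. W m = Some k \<Longrightarrow> m \<in> X \<and> is_out k \<and> ids k \<subseteq> X \<and> merge \<theta> k = \<theta> m \<and> svty \<Sigma> k = TO (\<Sigma> m)"
    "\<And>u v. is_out u \<Longrightarrow> ids u \<subseteq> X \<Longrightarrow> is_out v \<Longrightarrow> ids v \<subseteq> X \<Longrightarrow> merge \<theta> u = merge \<theta> v \<Longrightarrow>
      v \<notin> Domain (edges W) \<Longrightarrow> (u, v) \<in> (edges W)\<^sup>*"
  using assms unfolding net_ok_def by simp_all

lemma merge_fresh: "n \<notin> X \<Longrightarrow> ids w \<subseteq> X \<Longrightarrow> merge (\<theta>(n := t)) w = merge \<theta> w"
  by (rule merge_cong) auto

lemma svty_fresh: "n \<notin> X \<Longrightarrow> ids w \<subseteq> X \<Longrightarrow> svty (\<Sigma>(n := U)) w = svty \<Sigma> w"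
  by (rule svty_cong) auto

lemma is_out_fresh: "is_out w \<Longrightarrow> ids w \<subseteq> insert n X \<Longrightarrow> w = CO n \<or> ids w \<subseteq> X"
  by (cases w) auto

lemma is_out_merge: "net_ok \<Sigma> X X' \<theta> W \<Longrightarrow> is_out w \<Longrightarrow> ids w \<subseteq> X \<Longrightarrow>
    is_out (merge \<theta> w) \<and> ids (merge \<theta> w) \<subseteq> X'"
  using net_okD(3)[of \<Sigma> X X' \<theta> W] by (cases w) auto

lemma edges_upd: "W m = None \<Longrightarrow> edges (W(m \<mapsto> k)) = insert (CO m, k) (edges W)"
  by (auto simp: edges_def split: if_splits)

lemma Domain_edges: "CO m \<in> Domain (edges W) \<longleftrightarrow> m \<in> dom W"
  by (auto simp: edges_def)

lemma Domain_edges_E: "u \<in> Domain (edges W) \<Longrightarrow> \<exists>m \<in> dom W. u = CO m"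
  by (auto simp: edges_def)

text \<open>An ordinary restriction gets a new channel on both sides. No old value is merged to
  \<open>n'\<close>, so \<open>n\<close> is alone in its class and the reachability clause gains
  only a trivial case.\<close>

lemma net_ok_fresh:
  assumes ok: "net_ok \<Sigma> X X' \<theta> W" and n: "n \<notin> X" "n' \<notin> X'"
  shows "net_ok (\<Sigma>(n := U)) (insert n X) (insert n' X') (\<theta>(n := CO n')) W"
proof (rule net_okI)
  note D = net_okD[OF ok] and old = merge_fresh[OF n(1), where \<theta> = \<theta> and t = "CO n'"]
  show "finite (insert n X)" "finite (insert n' X')" using D by auto
  show "is_out ((\<theta>(n := CO n')) k) \<and> ids ((\<theta>(n := CO n')) k) \<subseteq> insert n' X'" if "k \<in> insert n X" for k
    using D(3)[of k] that by auto
  show "m \<in> insert n X \<and> is_out k \<and> ids k \<subseteq> insert n X \<and> merge (\<theta>(n := CO n')) k = (\<theta>(n := CO n')) m \<and>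
      svty (\<Sigma>(n := U)) k = TO ((\<Sigma>(n := U)) m)" if "W m = Some k" for m k
  proof -
    have "ids k \<subseteq> X" "m \<in> X" "m \<noteq> n" using D(4)[OF that] n by auto
    with D(4)[OF that] old[of k] svty_fresh[OF n(1), of k] show ?thesis by auto
  qed
  fix u v
  assume u: "is_out u" "ids u \<subseteq> insert n X" and v: "is_out v" "ids v \<subseteq> insert n X"
    and eq: "merge (\<theta>(n := CO n')) u = merge (\<theta>(n := CO n')) v" and sink: "v \<notin> Domain (edges W)"
  have n': "merge \<theta> w \<noteq> CO n'" if "is_out w" "ids w \<subseteq> X" for w
    using is_out_merge[OF ok that] n(2) by auto
  have new: "merge (\<theta>(n := CO n')) (CO n) = CO n'" by simp
  show "(u, v) \<in> (edges W)\<^sup>*"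
    using is_out_fresh[OF u] is_out_fresh[OF v]
  proof (elim disjE)
    assume "ids u \<subseteq> X" "ids v \<subseteq> X"
    then show ?thesis using D(5) u(1) v(1) eq sink old by simp
  next
    assume "u = CO n" "ids v \<subseteq> X"
    then show ?thesis using eq new old n'[OF v(1)] by metis
  next
    assume "ids u \<subseteq> X" "v = CO n"
    then show ?thesis using eq new old n'[OF u(1)] by metis
  qed simp
qed

text \<open>An O-wire leads from a new channel to an old one, an I-wire from an old channel to a new one.\<close>

lemma net_ok_O_wire:
  assumes ok: "net_ok \<Sigma> X X' \<theta> W" and n: "n \<notin> X"
    and k: "is_out k" "ids k \<subseteq> X" "svty \<Sigma> k = TO U"
  shows "net_ok (\<Sigma>(n := U)) (insert n X) X' (\<theta>(n := merge \<theta> k)) (W(n \<mapsto> k))"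
proof (rule net_okI)
  note D = net_okD[OF ok] and old = merge_fresh[OF n, where \<theta> = \<theta> and t = "merge \<theta> k"]
  have W: "W n = None" using D(4) n by (cases "W n") auto
  note edges = edges_upd[of W n k, OF W]
  show "finite (insert n X)" "finite X'" using D by auto
  show "is_out ((\<theta>(n := merge \<theta> k)) i) \<and> ids ((\<theta>(n := merge \<theta> k)) i) \<subseteq> X'" if "i \<in> insert n X" for i
    using D(3)[of i] that is_out_merge[OF ok k(1,2)] by auto
  show "m \<in> insert n X \<and> is_out h \<and> ids h \<subseteq> insert n X \<and> merge (\<theta>(n := merge \<theta> k)) h = (\<theta>(n := merge \<theta> k)) m \<and>
      svty (\<Sigma>(n := U)) h = TO ((\<Sigma>(n := U)) m)" if "(W(n \<mapsto> k)) m = Some h" for m h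
  proof (cases "m = n")
    case True
    then show ?thesis using that k old[of k] svty_fresh[OF n, of k] by auto
  next
    case False
    then have "W m = Some h" using that by simp
    from D(4)[OF this] False old[of h] svty_fresh[OF n, of h] show ?thesis by auto
  qed
  fix u v
  assume u: "is_out u" "ids u \<subseteq> insert n X" and v: "is_out v" "ids v \<subseteq> insert n X"
    and eq: "merge (\<theta>(n := merge \<theta> k)) u = merge (\<theta>(n := merge \<theta> k)) v"
    and sink: "v \<notin> Domain (edges (W(n \<mapsto> k)))"
  from sink have v': "ids v \<subseteq> X" "v \<notin> Domain (edges W)" using is_out_fresh[OF v] edges by auto
  have mono: "(edges W)\<^sup>* \<subseteq> (edges (W(n \<mapsto> k)))\<^sup>*" by (rule rtrancl_mono) (use edges in auto)
  show "(u, v) \<in> (edges (W(n \<mapsto> k)))\<^sup>*"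
    using is_out_fresh[OF u]
  proof
    assume "ids u \<subseteq> X"
    with D(5)[OF u(1) _ v(1) v'(1) _ v'(2)] eq old v' mono show ?thesis by auto
  next
    \<comment> \<open>The new source takes one step to \<open>k\<close>, and from there an old path
      leads to the sink.\<close>
    assume un: "u = CO n"
    then have "merge \<theta> k = merge \<theta> v" using eq old[OF v'(1)] by simp
    from D(5)[OF k(1,2) v(1) v'(1) this v'(2)] mono have "(k, v) \<in> (edges (W(n \<mapsto> k)))\<^sup>*" by blast
    moreover have "(u, k) \<in> edges (W(n \<mapsto> k))" using un edges by simp
    ultimately show ?thesis by (rule converse_rtrancl_into_rtrancl[rotated])
  qed
qed

lemma net_ok_I_wire:
  assumes ok: "net_ok \<Sigma> X X' \<theta> W" and n: "n \<notin> X"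
    and m: "m \<in> X" "m \<notin> dom W" "\<Sigma> m = U"
  shows "net_ok (\<Sigma>(n := U)) (insert n X) X' (\<theta>(n := \<theta> m)) (W(m \<mapsto> CO n))"
proof (rule net_okI)
  note D = net_okD[OF ok] and old = merge_fresh[OF n, where \<theta> = \<theta> and t = "\<theta> m"]
  have W: "W m = None" using m by auto
  have mn: "m \<noteq> n" using m n by auto
  note edges = edges_upd[of W m "CO n", OF W]
  have msink: "CO m \<notin> Domain (edges W)" using m Domain_edges by blast
  show "finite (insert n X)" "finite X'" using D by auto
  show "is_out ((\<theta>(n := \<theta> m)) i) \<and> ids ((\<theta>(n := \<theta> m)) i) \<subseteq> X'" if "i \<in> insert n X" for i
    using D(3)[of i] D(3)[OF m(1)] that by auto
  show "i \<in> insert n X \<and> is_out h \<and> ids h \<subseteq> insert n X \<and> merge (\<theta>(n := \<theta> m)) h = (\<theta>(n := \<theta> m)) i \<and>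
      svty (\<Sigma>(n := U)) h = TO ((\<Sigma>(n := U)) i)" if "(W(m \<mapsto> CO n)) i = Some h" for i h
  proof (cases "i = m")
    case True
    then show ?thesis using that m mn by auto
  next
    case False
    then have "W i = Some h" using that by simp
    from D(4)[OF this] n old[of h] svty_fresh[OF n, of h] show ?thesis by auto
  qed
  fix u v
  assume u: "is_out u" "ids u \<subseteq> insert n X" and v: "is_out v" "ids v \<subseteq> insert n X"
    and eq: "merge (\<theta>(n := \<theta> m)) u = merge (\<theta>(n := \<theta> m)) v"
    and sink: "v \<notin> Domain (edges (W(m \<mapsto> CO n)))"
  have mono: "(edges W)\<^sup>* \<subseteq> (edges (W(m \<mapsto> CO n)))\<^sup>*" by (rule rtrancl_mono) (use edges in auto)
  have step: "(CO m, CO n) \<in> edges (W(m \<mapsto> CO n))" using edges by simp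
  from sink have v': "v \<notin> Domain (edges W)" "v \<noteq> CO m" using edges by auto
  show "(u, v) \<in> (edges (W(m \<mapsto> CO n)))\<^sup>*"
    using is_out_fresh[OF u] is_out_fresh[OF v]
  proof (elim disjE)
    assume "ids u \<subseteq> X" "ids v \<subseteq> X"
    with D(5)[OF u(1) _ v(1) _ _ v'(1)] eq old mono show ?thesis by auto
  next
    \<comment> \<open>\<open>CO m\<close> was a sink, so the old path from it to \<open>v\<close> is
      empty and \<open>v\<close> would be \<open>CO m\<close>, which has just ceased to be a
      sink.\<close>
    assume "u = CO n" "ids v \<subseteq> X"
    then have "(CO m, v) \<in> (edges W)\<^sup>*"
      using D(5)[of "CO m" v] m(1) v(1) v'(1) eq old[of v] by simp
    with msink v'(2) show ?thesis by (metis DomainI converse_rtranclE)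
  next
    assume "ids u \<subseteq> X" "v = CO n"
    then have "(u, CO m) \<in> (edges W)\<^sup>*"
      using D(5)[of u "CO m"] m(1) u(1) msink eq old[of u] by simp
    with mono step \<open>v = CO n\<close> show ?thesis by (meson rtrancl.rtrancl_into_rtrancl subsetD)
  qed simp
qed

section \<open>Entering a restriction or a wire\<close>

lemma holders_fresh:
  assumes "valid \<Sigma> X X' \<theta> W (add_mset \<kappa> K)" "n \<notin> X"
  shows "holders n W K = 0"
proof -
  have K: "closure_ok \<Sigma> X \<kappa>'" if "\<kappa>' \<in># K" for \<kappa>'
    using assms(1) that unfolding valid_def by auto
  have "\<not> holds n \<kappa>" if "\<kappa> \<in># K" for \<kappa>
    using holds_in_X[OF K[OF that]] assms(2) by blast
  moreover have "n \<notin> dom W"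
    using assms net_okD(4)[of \<Sigma> X X' \<theta> W n] unfolding valid_def by auto
  moreover have "filter_mset (holds n) K = {#}" if "\<And>\<kappa>. \<kappa> \<in># K \<Longrightarrow> \<not> holds n \<kappa>" for K :: "closure multiset"
    using that by (induction K) auto
  ultimately show ?thesis by (simp add: holders_def del: holds.simps)
qed

text \<open>Linearity makes the channel of a receiver a sink of the network, since a wire at
  \<open>m\<close> would be a second holder. It also excludes that \<open>m\<close> is merged with a
  success name, because the reachability clause would then give \<open>CO m\<close> an outgoing
  edge. Hence the input end has a genuine counterpart \<open>CI j\<close> on the contracted side,
  and the dummy case of \<open>merge\<close> is not met.\<close>

lemma valid_held:
  assumes inv: "valid \<Sigma> X X' \<theta> W (add_mset \<kappa> K)" and \<kappa>: "holds m \<kappa>"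
  shows "m \<in> X" "m \<notin> dom W" "holders m W K = 0" "\<exists>j. \<theta> m = CO j \<and> j \<in> X'"
proof -
  have net: "net_ok \<Sigma> X X' \<theta> W" and ok: "closure_ok \<Sigma> X \<kappa>" and "holders m W (add_mset \<kappa> K) \<le> 1"
    using inv by (auto simp: valid_def)
  then show zero: "holders m W K = 0" using \<kappa> by (simp add: holders_add)
  show m: "m \<in> X" using holds_in_X[OF ok \<kappa>] .
  show dom: "m \<notin> dom W" using zero by (simp add: holders_def split: if_splits)
  have "\<theta> m \<noteq> Succ i" for i
  proof
    assume "\<theta> m = Succ i"
    then have "(CO m, Succ i) \<in> (edges W)\<^sup>*"
      using net_okD(5)[OF net, of "CO m" "Succ i"] m Domain_edges_E by fastforce
    then have "CO m \<in> Domain (edges W)" by (metis DomainI converse_rtranclE sv.distinct(7))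
    with dom Domain_edges show False by blast
  qed
  with net_okD(3)[OF net m] show "\<exists>j. \<theta> m = CO j \<and> j \<in> X'" by (cases "\<theta> m") auto
qed

text \<open>Stated for a part \<open>P\<close> of the restricted body \<open>S\<close>, so that it
  serves both an ordinary restriction, where \<open>S\<close> is \<open>P\<close>, and a wire, where
  \<open>S\<close> also contains the forwarder.\<close>

lemma closure_Res:
  assumes ok: "closure_ok \<Sigma> X (\<rho>, Res p q T S, R)" and n: "n \<notin> X" and c: "contr P P'"
    and PS: "fn P \<subseteq> fn S" and pq: "p \<noteq> q" and tp: "tp ((env_of \<Sigma> \<rho>)(p \<mapsto> TI U, q \<mapsto> TO U)) P"
  shows "closure_ok (\<Sigma>(n := U)) (insert n X) (\<rho>(p := CI n, q := CO n), P, P')"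
    "\<And>m. m \<noteq> n \<Longrightarrow> holds m (\<rho>(p := CI n, q := CO n), P, P') \<Longrightarrow> holds m (\<rho>, Res p q T S, R)"
    "holds n (\<rho>(p := CI n, q := CO n), P, P') \<Longrightarrow> p \<in> fn P"
proof -
  have ids: "ids (\<rho> c) \<subseteq> X" for c using ok by simp
  have fresh: "\<rho> c \<noteq> CI n" for c
  proof
    assume "\<rho> c = CI n"
    with ids[of c] n show False by simp
  qed
  have env: "env_of (\<Sigma>(n := U)) (\<rho>(p := CI n, q := CO n)) = (env_of \<Sigma> \<rho>)(p \<mapsto> TI U, q \<mapsto> TO U)"
  proof -
    have "env_of (\<Sigma>(n := U)) \<rho> = env_of \<Sigma> \<rho>"
      by (rule ext) (simp only: env_of_def svty_fresh[OF n ids])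
    then show ?thesis unfolding env_of_upd by simp
  qed
  have old: "c \<in> fn (Res p q T S) \<and> \<rho> c = CI m"
    if "c \<in> fn P" "(\<rho>(p := CI n, q := CO n)) c = CI m" "m \<noteq> n" for c m
  proof -
    have "c \<notin> {p, q}" using that(2,3) by (auto split: if_splits)
    then show ?thesis using that(1,2) PS by auto
  qed
  have new: "c = p" if "(\<rho>(p := CI n, q := CO n)) c = CI n" for c
  proof (rule ccontr)
    assume "c \<noteq> p"
    with that fresh[of c] show False by (simp split: if_splits)
  qed
  have oinj: "c = d" if "c \<in> fn (Res p q T S)" "d \<in> fn (Res p q T S)" "\<rho> c = CI m" "\<rho> d = CI m" for c d m
    using ok that unfolding closure_ok.simps by blast
  have inj: "c = d" if "c \<in> fn P" "d \<in> fn P" "(\<rho>(p := CI n, q := CO n)) c = CI m"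
    "(\<rho>(p := CI n, q := CO n)) d = CI m" for c d m
  proof (cases "m = n")
    case True
    then show ?thesis using new that by blast
  next
    case False
    from old[OF that(1,3) False] old[OF that(2,4) False] oinj show ?thesis by blast
  qed
  show "closure_ok (\<Sigma>(n := U)) (insert n X) (\<rho>(p := CI n, q := CO n), P, P')"
    unfolding closure_ok.simps env
  proof (intro conjI allI ballI impI)
    show "ids ((\<rho>(p := CI n, q := CO n)) c) \<subseteq> insert n X" for c using ids[of c] by auto
  qed (rule c tp inj; assumption)+
  show "holds m (\<rho>, Res p q T S, R)" if m: "m \<noteq> n" "holds m (\<rho>(p := CI n, q := CO n), P, P')" for m
  proof -
    from m(2) obtain c where "c \<in> fn P" "(\<rho>(p := CI n, q := CO n)) c = CI m" unfolding holds.simps by blast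
    from old[OF this m(1)] show ?thesis unfolding holds.simps by blast
  qed
  show "p \<in> fn P" if "holds n (\<rho>(p := CI n, q := CO n), P, P')"
    using that new unfolding holds.simps by blast
qed

declare closure_ok.simps [simp del] holds.simps [simp del]

lemma valid_addI:
  assumes "net_ok \<Sigma> X X' \<theta> W" "closure_ok \<Sigma> X \<kappa>" "\<And>\<kappa>'. \<kappa>' \<in># K \<Longrightarrow> closure_ok \<Sigma> X \<kappa>'"
    "\<And>m. holders m W (add_mset \<kappa> K) \<le> 1"
  shows "valid \<Sigma> X X' \<theta> W (add_mset \<kappa> K)"
  using assms unfolding valid_def by auto

lemma valid_addD:
  assumes "valid \<Sigma> X X' \<theta> W (add_mset \<kappa> K)"
  shows "net_ok \<Sigma> X X' \<theta> W" "closure_ok \<Sigma> X \<kappa>" "\<And>\<kappa>'. \<kappa>' \<in># K \<Longrightarrow> closure_ok \<Sigma> X \<kappa>'"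
    "\<And>m. holders m W (add_mset \<kappa> K) \<le> 1"
  using assms unfolding valid_def by auto

lemma valid_Res:
  assumes inv: "valid \<Sigma> X X' \<theta> W (add_mset (\<rho>, Res a b T P, R) K)" and c: "contr P P'"
    and n: "n \<notin> X" "n' \<notin> X'"
  shows "\<exists>U. valid (\<Sigma>(n := U)) (insert n X) (insert n' X') (\<theta>(n := CO n')) W
    (add_mset (\<rho>(a := CI n, b := CO n), P, P') K)"
proof -
  note D = valid_addD[OF inv]
  from D(2) obtain U where U: "a \<noteq> b" "tp ((env_of \<Sigma> \<rho>)(a \<mapsto> TI U, b \<mapsto> TO U)) P"
    unfolding closure_ok.simps by (auto simp: legal_res_def)
  note new = closure_Res[OF D(2) n(1) c subset_refl U]
  have "valid (\<Sigma>(n := U)) (insert n X) (insert n' X') (\<theta>(n := CO n')) W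
    (add_mset (\<rho>(a := CI n, b := CO n), P, P') K)"
  proof (rule valid_addI)
    show "net_ok (\<Sigma>(n := U)) (insert n X) (insert n' X') (\<theta>(n := CO n')) W"
      by (rule net_ok_fresh[OF D(1) n])
    show "closure_ok (\<Sigma>(n := U)) (insert n X) (\<rho>(a := CI n, b := CO n), P, P')" by (rule new(1))
    show "closure_ok (\<Sigma>(n := U)) (insert n X) \<kappa>" if "\<kappa> \<in># K" for \<kappa>
      by (rule closure_ok_mono[OF D(3)[OF that]]) (use n in auto)
    show "holders m W (add_mset (\<rho>(a := CI n, b := CO n), P, P') K) \<le> 1" for m
    proof (cases "m = n")
      case True
      have "holders n W K = 0"
        by (rule holders_fresh[OF inv n(1)])
      then show ?thesis using True by (simp add: holders_add)
    next
      case False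
      from D(4)[of m] new(2)[OF False] show ?thesis
        by (auto simp: holders_add split: if_splits)
    qed
  qed
  then show ?thesis by blast
qed

text \<open>Both polarities in one statement: the new channel \<open>n\<close> joins the class
  \<open>t\<close> of an old value, and the contracted side gets no new channel. For an O-name the
  wire leads from \<open>n\<close> to the value of \<open>a\<close>; for an I-name it leads from the
  channel of \<open>a\<close> to \<open>n\<close>. By the last clause the merged valuation is,
  except at \<open>b'\<close>, the one under which the substitution of \<open>a\<close> for
  \<open>b\<close> is evaluated.\<close>

lemma valid_wire:
  fixes P :: proc and b b' a :: name and U :: ty
  defines "L \<equiv> nu b b' U (Par (link U b' a) P)"
  assumes inv: "valid \<Sigma> X X' \<theta> W (add_mset (\<rho>, L, R) K)" and c: "contr P P'"
    and comp: "companions b b'" and pol: "is_I b = is_I a" and ba: "b \<noteq> a" and b': "b' \<notin> fn P"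
    and n: "n \<notin> X"
  shows "\<exists>\<rho>1 m k t h. valid (\<Sigma>(n := U)) (insert n X) X' (\<theta>(n := t)) (W(m \<mapsto> k)) (add_mset (\<rho>1, P, P') K) \<and>
    m \<notin> dom W \<and> den L \<rho> = SRes h \<and> h n = SPar (SRep (CI m) (SOut k)) (den P \<rho>1) \<and>
    (\<forall>c. c \<noteq> b' \<longrightarrow> merge (\<theta>(n := t)) (\<rho>1 c) = ((merge \<theta> \<circ> \<rho>)(b := merge \<theta> (\<rho> a))) c)"
proof (cases "is_I b")
  case True
  then have pol': "is_I a" "\<not> is_I b'" "b \<noteq> b'" "a \<noteq> b'"
    using comp pol by (auto simp: companions_def)
  define x where "x = fresh_name (name_for U) {a, b'}"
  define V where "V = Rep a x (Out b' (Nm x))"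
  have "x \<notin> {a, b'}" unfolding x_def by (rule fresh_name_notin) simp
  then have x: "x \<noteq> a" "x \<noteq> b'" by simp_all
  have link: "link U b' a = V" using pol' by (simp add: link_def wire_def Let_def x_def V_def)
  have L: "L = Res b b' (TI U) (Par V P)" unfolding L_def nu_def link using True by simp
  define \<Gamma> where "\<Gamma> = (env_of \<Sigma> \<rho>)(b \<mapsto> TI U, b' \<mapsto> TO U)"
  note D = valid_addD[OF inv[unfolded L]]
  from D(2) have "tp \<Gamma> (Par V P)" unfolding closure_ok.simps tp.simps(5) \<Gamma>_def by blast
  then have tp: "tp \<Gamma> V" "tp \<Gamma> P" "\<forall>c \<in> fn V \<inter> fn P. \<forall>T. \<Gamma> c \<noteq> Some (TI T)"
    unfolding tp.simps(2) by blast+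
  from tp(1) have "\<Gamma> a = Some (TI U)" unfolding V_def using pol' x by (auto simp: \<Gamma>_def)
  then have "svty \<Sigma> (\<rho> a) = TI U" using ba pol' by (simp add: \<Gamma>_def env_of_def)
  from svty_TI[OF this] obtain m where m: "\<rho> a = CI m" "\<Sigma> m = U" by blast
  have aL: "a \<in> fn (Res b b' (TI U) (Par V P))" using ba pol' by (auto simp: V_def)
  then have hm: "holds m (\<rho>, Res b b' (TI U) (Par V P), R)" using m unfolding holds.simps by blast
  note held = valid_held[OF inv[unfolded L] hm]
  have mn: "m \<noteq> n" using held(1) n by auto
  have PV: "fn P \<subseteq> fn (Par V P)" by simp
  note new = closure_Res[OF D(2) n c PV pol'(3) tp(2)[unfolded \<Gamma>_def]]
  define \<rho>1 where "\<rho>1 = \<rho>(b := CI n, b' := CO n)"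
  have "\<not> holds m (\<rho>1, P, P')"
  proof
    assume "holds m (\<rho>1, P, P')"
    then obtain c where c: "c \<in> fn P" "\<rho>1 c = CI m" unfolding holds.simps by blast
    then have "c \<noteq> b" "c \<noteq> b'" "\<rho> c = CI m" using mn by (auto simp: \<rho>1_def split: if_splits)
    moreover from this have "c \<in> fn (Res b b' (TI U) (Par V P))" using c by simp
    ultimately have "c = a" using D(2) aL m(1) unfolding closure_ok.simps by blast
    with c tp(3) \<open>\<Gamma> a = Some (TI U)\<close> show False by (auto simp: V_def)
  qed
  note nm = this
  have 1: "valid (\<Sigma>(n := U)) (insert n X) X' (\<theta>(n := \<theta> m)) (W(m \<mapsto> CO n)) (add_mset (\<rho>1, P, P') K)"
  proof (rule valid_addI)
    show "net_ok (\<Sigma>(n := U)) (insert n X) X' (\<theta>(n := \<theta> m)) (W(m \<mapsto> CO n))"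
      by (rule net_ok_I_wire[OF D(1) n held(1,2) m(2)])
    show "closure_ok (\<Sigma>(n := U)) (insert n X) (\<rho>1, P, P')" unfolding \<rho>1_def by (rule new(1))
    show "closure_ok (\<Sigma>(n := U)) (insert n X) \<kappa>" if "\<kappa> \<in># K" for \<kappa>
      by (rule closure_ok_mono[OF D(3)[OF that]]) (use n in auto)
    show "holders i (W(m \<mapsto> CO n)) (add_mset (\<rho>1, P, P') K) \<le> 1" for i
    proof -
      have K: "holders i (W(m \<mapsto> CO n)) K = (if i = m then 1 else holders i W K)"
        using held(2,3) by (auto simp: holders_def)
      consider "i = m" | "i = n" | "i \<noteq> m" "i \<noteq> n" by blast
      then show ?thesis
      proof cases
        case 1
        then show ?thesis using nm K by (simp add: holders_add)
      next
        case 2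
        then show ?thesis using K mn holders_fresh[OF inv n] by (simp add: holders_add)
      next
        case 3
        from D(4)[of i] new(2)[OF 3(2), folded \<rho>1_def] show ?thesis
          using K 3 by (auto simp: holders_add split: if_splits)
      qed
    qed
  qed
  have 2: "den L \<rho> = SRes (\<lambda>n. den (Par V P) (\<rho>(b := CI n, b' := CO n)))" unfolding L by simp
  have 3: "den (Par V P) (\<rho>(b := CI n, b' := CO n)) = SPar (SRep (CI m) (SOut (CO n))) (den P \<rho>1)"
    using ba pol' x m by (simp add: V_def \<rho>1_def)
  have 4: "merge (\<theta>(n := \<theta> m)) (\<rho>1 c) = ((merge \<theta> \<circ> \<rho>)(b := merge \<theta> (\<rho> a))) c" if "c \<noteq> b'" for c
  proof (cases "c = b")
    case True
    obtain j where "\<theta> m = CO j" using held(4) by blast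
    then show ?thesis using True that m by (simp add: \<rho>1_def)
  next
    case False
    have "ids (\<rho> c) \<subseteq> X" using D(2) unfolding closure_ok.simps by blast
    with merge_fresh[OF n this] False that show ?thesis by (simp add: \<rho>1_def)
  qed
  show ?thesis
    by (rule exI[of _ \<rho>1], rule exI[of _ m], rule exI[of _ "CO n"], rule exI[of _ "\<theta> m"], rule exI,
        intro conjI allI impI, rule 1, rule held(2), rule 2, rule 3, rule 4)
next
  case False
  then have pol': "\<not> is_I a" "is_I b'" "b' \<noteq> b" "a \<noteq> b'"
    using comp pol by (auto simp: companions_def)
  define x where "x = fresh_name (name_for U) {b', a}"
  define V where "V = Rep b' x (Out a (Nm x))"
  have "x \<notin> {b', a}" unfolding x_def by (rule fresh_name_notin) simp
  then have x: "x \<noteq> a" "x \<noteq> b'" by simp_all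
  have link: "link U b' a = V" using pol' by (simp add: link_def wire_def Let_def x_def V_def)
  have L: "L = Res b' b (TI U) (Par V P)" unfolding L_def nu_def link using False by simp
  define \<Gamma> where "\<Gamma> = (env_of \<Sigma> \<rho>)(b' \<mapsto> TI U, b \<mapsto> TO U)"
  note D = valid_addD[OF inv[unfolded L]]
  from D(2) have "tp \<Gamma> (Par V P)" unfolding closure_ok.simps tp.simps(5) \<Gamma>_def by blast
  then have tp: "tp \<Gamma> V" "tp \<Gamma> P" unfolding tp.simps(2) by blast+
  from tp(1) have "\<Gamma> a = Some (TO U)" unfolding V_def using pol' x by (auto simp: \<Gamma>_def)
  then have ty: "svty \<Sigma> (\<rho> a) = TO U" using ba pol' by (simp add: \<Gamma>_def env_of_def)
  have ids: "ids (\<rho> c) \<subseteq> X" for c using D(2) unfolding closure_ok.simps by blast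
  have dom: "n \<notin> dom W" using net_okD(4)[OF D(1)] n by blast
  have PV: "fn P \<subseteq> fn (Par V P)" by simp
  note new = closure_Res[OF D(2) n c PV pol'(3) tp(2)[unfolded \<Gamma>_def]]
  define \<rho>1 where "\<rho>1 = \<rho>(b' := CI n, b := CO n)"
  have 1: "valid (\<Sigma>(n := U)) (insert n X) X' (\<theta>(n := merge \<theta> (\<rho> a))) (W(n \<mapsto> \<rho> a)) (add_mset (\<rho>1, P, P') K)"
  proof (rule valid_addI)
    show "net_ok (\<Sigma>(n := U)) (insert n X) X' (\<theta>(n := merge \<theta> (\<rho> a))) (W(n \<mapsto> \<rho> a))"
      by (rule net_ok_O_wire[OF D(1) n svty_TO[OF ty] ids ty])
    show "closure_ok (\<Sigma>(n := U)) (insert n X) (\<rho>1, P, P')" unfolding \<rho>1_def by (rule new(1))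
    show "closure_ok (\<Sigma>(n := U)) (insert n X) \<kappa>" if "\<kappa> \<in># K" for \<kappa>
      by (rule closure_ok_mono[OF D(3)[OF that]]) (use n in auto)
    show "holders i (W(n \<mapsto> \<rho> a)) (add_mset (\<rho>1, P, P') K) \<le> 1" for i
    proof (cases "i = n")
      case True
      \<comment> \<open>This is where freshness of \<open>b'\<close> enters: it is the input end of
        the new channel, which is thus left to the wire.\<close>
      have "\<not> holds n (\<rho>1, P, P')" using new(3) b' unfolding \<rho>1_def by blast
      moreover have "holders n (W(n \<mapsto> \<rho> a)) K = 1"
        using holders_fresh[OF inv n] by (simp add: holders_def)
      ultimately show ?thesis using True by (simp add: holders_add)
    next
      case False
      have "holders i (W(n \<mapsto> \<rho> a)) K = holders i W K" using False by (simp add: holders_def)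
      with D(4)[of i] new(2)[OF False, folded \<rho>1_def] show ?thesis
        by (auto simp: holders_add split: if_splits)
    qed
  qed
  have 2: "den L \<rho> = SRes (\<lambda>n. den (Par V P) (\<rho>(b' := CI n, b := CO n)))" unfolding L by simp
  have 3: "den (Par V P) (\<rho>(b' := CI n, b := CO n)) = SPar (SRep (CI n) (SOut (\<rho> a))) (den P \<rho>1)"
    using ba pol' x by (simp add: V_def \<rho>1_def)
  have 4: "merge (\<theta>(n := merge \<theta> (\<rho> a))) (\<rho>1 c) = ((merge \<theta> \<circ> \<rho>)(b := merge \<theta> (\<rho> a))) c" if "c \<noteq> b'" for c
    using that merge_fresh[OF n ids[of c]] by (simp add: \<rho>1_def)
  show ?thesis
    by (rule exI[of _ \<rho>1], rule exI[of _ n], rule exI[of _ "\<rho> a"], rule exI[of _ "merge \<theta> (\<rho> a)"], rule exI,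
        intro conjI allI impI, rule 1, rule dom, rule 2, rule 3, rule 4)
qed

section \<open>Unrolling both sides together\<close>

definition wires :: "(nat \<rightharpoonup> sv) \<Rightarrow> sem multiset" where
  "wires W = image_mset (\<lambda>m. SRep (CI m) (SOut (the (W m)))) (mset_set (dom W))"

fun den_l :: "closure \<Rightarrow> sem" where
  "den_l (\<rho>, P, P') = den P \<rho>"

text \<open>The contracted half has no valuation of its own: it runs under that of the wired half
  followed by \<open>merge \<theta>\<close>, so a value received by one half is at once received, in
  merged form, by the other.\<close>

fun den_r :: "(nat \<Rightarrow> sv) \<Rightarrow> closure \<Rightarrow> sem" where
  "den_r \<theta> (\<rho>, P, P') = den P' (merge \<theta> \<circ> \<rho>)"

abbreviation state_r :: "(nat \<Rightarrow> sv) \<Rightarrow> closure multiset \<Rightarrow> sem multiset" where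
  "state_r \<theta> \<equiv> image_mset (den_r \<theta>)"

lemma wires_upd:
  assumes "finite (dom W)" "m \<notin> dom W"
  shows "wires (W(m \<mapsto> k)) = add_mset (SRep (CI m) (SOut k)) (wires W)"
proof -
  have "image_mset (\<lambda>i. SRep (CI i) (SOut (the ((W(m \<mapsto> k)) i)))) (mset_set (dom W)) = wires W"
    unfolding wires_def by (rule image_mset_cong) (use assms in auto)
  then show ?thesis using assms by (simp add: wires_def del: fun_upd_apply) simp
qed

lemma valid_finite_dom: "valid \<Sigma> X X' \<theta> W K \<Longrightarrow> finite (dom W)"
proof -
  assume "valid \<Sigma> X X' \<theta> W K"
  then have "net_ok \<Sigma> X X' \<theta> W" by (simp add: valid_def)
  from net_okD(1,4)[OF this] have "finite X" "dom W \<subseteq> X" by auto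
  then show ?thesis by (rule finite_subset[rotated])
qed

lemma merge_comp_cong:
  assumes "closure_ok \<Sigma> X (\<rho>, P, P')" "\<And>n. n \<in> X \<Longrightarrow> \<theta>1 n = \<theta> n"
  shows "merge \<theta>1 \<circ> \<rho> = merge \<theta> \<circ> \<rho>"
proof
  fix c
  have "ids (\<rho> c) \<subseteq> X" using assms(1) unfolding closure_ok.simps by blast
  with assms(2) show "(merge \<theta>1 \<circ> \<rho>) c = (merge \<theta> \<circ> \<rho>) c"
    unfolding comp_def by (intro merge_cong) blast
qed

lemma den_r_cong:
  assumes "\<And>\<kappa>. \<kappa> \<in># K \<Longrightarrow> closure_ok \<Sigma> X \<kappa>" "\<And>n. n \<in> X \<Longrightarrow> \<theta>1 n = \<theta> n"
  shows "state_r \<theta>1 K = state_r \<theta> K"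
proof (rule image_mset_cong)
  fix \<kappa> assume K: "\<kappa> \<in># K"
  obtain \<rho> P P' where \<kappa>: "\<kappa> = (\<rho>, P, P')" by (cases \<kappa>)
  have "merge \<theta>1 \<circ> \<rho> = merge \<theta> \<circ> \<rho>"
    by (rule merge_comp_cong[OF assms(1)[OF K, unfolded \<kappa>] assms(2)])
  then show "den_r \<theta>1 \<kappa> = den_r \<theta> \<kappa>" by (simp add: \<kappa>)
qed

definition prefixes :: "closure multiset \<Rightarrow> bool" where
  "prefixes K \<longleftrightarrow> (\<forall>(\<rho>, P, P') \<in># K. is_prefix P)"

text \<open>
  A closure has been unrolled on both sides, into \<open>M\<close> with new channels \<open>A\<close> and into \<open>N\<close> with
  new channels \<open>B\<close>, while \<open>K\<close> is the rest of the state.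
\<close>

definition unrolled where
  "unrolled \<Sigma> X X' \<theta> W K A B M N \<longleftrightarrow> (\<exists>\<Sigma>1 \<theta>1 W1 K1. valid \<Sigma>1 (X \<union> A) (X' \<union> B) \<theta>1 W1 (K1 + K) \<and>
     (\<forall>n \<in> X. \<theta>1 n = \<theta> n) \<and> prefixes K1 \<and> M + wires W = wires W1 + image_mset den_l K1 \<and> N = state_r \<theta>1 K1)"

lemma unrolled_empty:
  assumes "valid \<Sigma> X X' \<theta> W (add_mset \<kappa> K)"
  shows "unrolled \<Sigma> X X' \<theta> W K {} {} {#} {#}"
proof -
  have "valid \<Sigma> X X' \<theta> W K" by (rule valid_drop[of _ _ _ _ _ "{#\<kappa>#}"]) (use assms in simp)
  then show ?thesis unfolding unrolled_def
    by (intro exI[of _ \<Sigma>] exI[of _ \<theta>] exI[of _ W] exI[of _ "{#}"]) (simp add: prefixes_def)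
qed

lemma unrolled_single:
  assumes "valid \<Sigma> X X' \<theta> W (add_mset (\<rho>, P, P') K)" "is_prefix P"
  shows "unrolled \<Sigma> X X' \<theta> W K {} {} {#den P \<rho>#} {#den P' (merge \<theta> \<circ> \<rho>)#}"
  unfolding unrolled_def using assms
  by (intro exI[of _ \<Sigma>] exI[of _ \<theta>] exI[of _ W] exI[of _ "{#(\<rho>, P, P')#}"]) (simp add: prefixes_def)

text \<open>While the left component is unrolled, the right one waits in the rest of the state, so
  that the invariant counts the input ends of both. Then the roles change, with the prefixes
  \<open>K1\<close> waiting.\<close>

lemma unrolled_Par:
  assumes inv: "valid \<Sigma>1 (X \<union> A1) (X' \<union> B1) \<theta>1 W1 (K1 + K')" and \<theta>: "\<forall>n \<in> X. \<theta>1 n = \<theta> n"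
    and pre: "prefixes K1" and M: "M1 + wires W = wires W1 + image_mset den_l K1" and N: "N1 = state_r \<theta>1 K1"
    and u: "unrolled \<Sigma>1 (X \<union> A1) (X' \<union> B1) \<theta>1 W1 (K1 + K) A2 B2 M2 N2"
  shows "unrolled \<Sigma> X X' \<theta> W K (A1 \<union> A2) (B1 \<union> B2) (M1 + M2) (N1 + N2)"
proof -
  from u obtain \<Sigma>2 \<theta>2 W2 K2 where 2: "valid \<Sigma>2 (X \<union> A1 \<union> A2) (X' \<union> B1 \<union> B2) \<theta>2 W2 (K2 + (K1 + K))"
    "\<forall>n \<in> X \<union> A1. \<theta>2 n = \<theta>1 n" "M2 + wires W1 = wires W2 + image_mset den_l K2"
    "N2 = state_r \<theta>2 K2" "prefixes K2" unfolding unrolled_def by blast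
  have K1: "\<And>\<kappa>. \<kappa> \<in># K1 \<Longrightarrow> closure_ok \<Sigma>1 (X \<union> A1) \<kappa>" using inv unfolding valid_def by auto
  have "N1 = state_r \<theta>2 K1"
    unfolding N by (rule den_r_cong[symmetric, OF K1]) (use 2(2) in auto)
  with 2(4) have "N1 + N2 = state_r \<theta>2 (K2 + K1)" by (simp add: union_commute)
  moreover have "(M1 + M2) + wires W = wires W2 + image_mset den_l (K2 + K1)"
  proof -
    have "(M1 + M2) + wires W = (M1 + wires W) + M2" by (simp add: ac_simps)
    also have "\<dots> = (M2 + wires W1) + image_mset den_l K1" unfolding M by (simp add: ac_simps)
    finally show ?thesis unfolding 2(3) by (simp add: ac_simps)
  qed
  moreover have "valid \<Sigma>2 (X \<union> (A1 \<union> A2)) (X' \<union> (B1 \<union> B2)) \<theta>2 W2 ((K2 + K1) + K)"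
    using 2(1) by (simp add: Un_assoc union_assoc)
  moreover have "\<forall>n \<in> X. \<theta>2 n = \<theta> n" using 2(2) \<theta> by simp
  moreover have "prefixes (K2 + K1)" using 2(5) pre by (auto simp: prefixes_def)
  ultimately show ?thesis unfolding unrolled_def by (intro exI conjI)
qed

lemma unrolled_Res:
  assumes "unrolled \<Sigma>1 (insert n X) (insert n' X') (\<theta>(n := t)) W K A B M N" "n \<notin> X"
  shows "unrolled \<Sigma> X X' \<theta> W K (insert n A) (insert n' B) M N"
proof -
  from assms(1) obtain \<Sigma>2 \<theta>2 W2 K2 where 2: "valid \<Sigma>2 (insert n X \<union> A) (insert n' X' \<union> B) \<theta>2 W2 (K2 + K)"
    "\<forall>k \<in> insert n X. \<theta>2 k = (\<theta>(n := t)) k" "M + wires W = wires W2 + image_mset den_l K2"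
    "N = state_r \<theta>2 K2" "prefixes K2" unfolding unrolled_def by blast
  have "valid \<Sigma>2 (X \<union> insert n A) (X' \<union> insert n' B) \<theta>2 W2 (K2 + K)" using 2(1) by simp
  moreover have "\<forall>k \<in> X. \<theta>2 k = \<theta> k" using 2(2) assms(2) by auto
  ultimately show ?thesis using 2(3,4,5) unfolding unrolled_def by (intro exI conjI)
qed

text \<open>The forwarder is booked under the wires rather than among the closures, since it has no
  counterpart on the contracted side; accordingly \<open>B\<close> and \<open>N\<close> do not
  change.\<close>

lemma unrolled_wire:
  assumes "unrolled \<Sigma>1 (insert n X) X' (\<theta>(n := t)) (W(m \<mapsto> k)) K A B M N" "n \<notin> X"
    "finite (dom W)" "m \<notin> dom W"
  shows "unrolled \<Sigma> X X' \<theta> W K (insert n A) B (add_mset (SRep (CI m) (SOut k)) M) N"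
proof -
  from assms(1) obtain \<Sigma>2 \<theta>2 W2 K2 where 2: "valid \<Sigma>2 (insert n X \<union> A) (X' \<union> B) \<theta>2 W2 (K2 + K)"
    "\<forall>k \<in> insert n X. \<theta>2 k = (\<theta>(n := t)) k" "M + wires (W(m \<mapsto> k)) = wires W2 + image_mset den_l K2"
    "N = state_r \<theta>2 K2" "prefixes K2" unfolding unrolled_def by blast
  have "valid \<Sigma>2 (X \<union> insert n A) (X' \<union> B) \<theta>2 W2 (K2 + K)" using 2(1) by simp
  moreover have "\<forall>k \<in> X. \<theta>2 k = \<theta> k" using 2(2) assms(2) by auto
  moreover have "add_mset (SRep (CI m) (SOut k)) M + wires W = wires W2 + image_mset den_l K2"
    using 2(3) unfolding wires_upd[OF assms(3,4)] by simp
  ultimately show ?thesis using 2(4,5) unfolding unrolled_def by (intro exI conjI)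
qed

lemma spill_prefix:
  assumes "is_prefix P"
  shows "spill (den P \<rho>) A M \<longleftrightarrow> A = {} \<and> M = {#den P \<rho>#}"
  using assms by (cases P) (auto intro: spill.intros elim: spill_InE spill_OutE spill_RepE)

lemma merge_Res:
  assumes "closure_ok \<Sigma> X (\<rho>, P, P')" "n \<notin> X"
  shows "merge (\<theta>(n := CO n')) \<circ> \<rho>(a := CI n, b := CO n) = (merge \<theta> \<circ> \<rho>)(a := CI n', b := CO n')"
proof
  fix c
  have "ids (\<rho> c) \<subseteq> X" using assms(1) unfolding closure_ok.simps by blast
  from merge_fresh[OF assms(2) this]
  show "(merge (\<theta>(n := CO n')) \<circ> \<rho>(a := CI n, b := CO n)) c = ((merge \<theta> \<circ> \<rho>)(a := CI n', b := CO n')) c"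
    by simp
qed

lemma unrolledE:
  assumes "unrolled \<Sigma> X X' \<theta> W K A B M N"
  obtains \<Sigma>1 \<theta>1 W1 K1 where "valid \<Sigma>1 (X \<union> A) (X' \<union> B) \<theta>1 W1 (K1 + K)"
    "\<forall>n \<in> X. \<theta>1 n = \<theta> n" "prefixes K1" "M + wires W = wires W1 + image_mset den_l K1"
    "N = state_r \<theta>1 K1"
  using assms unfolding unrolled_def by (elim exE conjE) (rule that)

lemma spill_contr_prefix:
  assumes inv: "valid \<Sigma> X X' \<theta> W (add_mset (\<rho>, P, P') K)" and P: "is_prefix P" "is_prefix P'"
  shows "spill (den P \<rho>) A M \<Longrightarrow>
      \<exists>B N. spill (den P' (merge \<theta> \<circ> \<rho>)) B N \<and> B \<inter> Y = {} \<and> unrolled \<Sigma> X X' \<theta> W K A B M N"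
    and "spill (den P' (merge \<theta> \<circ> \<rho>)) B N \<Longrightarrow>
      \<exists>A M. spill (den P \<rho>) A M \<and> A \<inter> Y = {} \<and> unrolled \<Sigma> X X' \<theta> W K A B M N"
  unfolding spill_prefix[OF P(1)] spill_prefix[OF P(2)]
  using unrolled_single[OF inv P(1)] by simp_all

text \<open>The induction follows the contraction rather than the process, because a wire has to be
  consumed as one construct whose restriction draws a channel on the wired side only. Avoiding
  \<open>X'\<close> keeps the chosen channels apart from those in use; \<open>Z\<close> lets the
  caller exclude further ones, as a machine step must.\<close>

lemma spill_contr:
  assumes "contr P P'" "valid \<Sigma> X X' \<theta> W (add_mset (\<rho>, P, P') K)" "spill (den P \<rho>) A M"
    "A \<inter> X = {}" "finite Z"
  shows "\<exists>B N. spill (den P' (merge \<theta> \<circ> \<rho>)) B N \<and> B \<inter> (X' \<union> Z) = {} \<and> unrolled \<Sigma> X X' \<theta> W K A B M N"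
  using assms
proof (induction arbitrary: \<Sigma> X X' \<theta> W \<rho> K A M Z rule: contr.induct)
  case contr_Zero
  have "A = {}" "M = {#}" using contr_Zero.prems(2) by (auto elim: spill_ZeroE)
  with unrolled_empty[OF contr_Zero.prems(1)] spill_Zero show ?case
    by (intro exI[of _ "{}"] exI[of _ "{#}"]) simp
next
  case (contr_In P P' a x)
  show ?case by (rule spill_contr_prefix(1)[OF contr_In.prems(1) _ _ contr_In.prems(2)]) simp_all
next
  case (contr_Out a v)
  show ?case by (rule spill_contr_prefix(1)[OF contr_Out.prems(1) _ _ contr_Out.prems(2)]) simp_all
next
  case (contr_Rep P P' a x)
  show ?case by (rule spill_contr_prefix(1)[OF contr_Rep.prems(1) _ _ contr_Rep.prems(2)]) simp_all
next
  case (contr_Par P P' Q Q')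
  note inv = valid_Par[OF contr_Par.prems(1) contr_Par.hyps]
  from contr_Par.prems(2) obtain A1 A2 M1 M2 where S: "spill (den P \<rho>) A1 M1" "spill (den Q \<rho>) A2 M2"
    "A1 \<inter> A2 = {}" "A = A1 \<union> A2" "M = M1 + M2" unfolding den.simps by (elim spill_ParE)
  have "A1 \<inter> X = {}" using S contr_Par.prems(3) by blast
  from contr_Par.IH(1)[OF inv S(1) this contr_Par.prems(4)] obtain B1 N1 where
    1: "spill (den P' (merge \<theta> \<circ> \<rho>)) B1 N1" "B1 \<inter> (X' \<union> Z) = {}"
      "unrolled \<Sigma> X X' \<theta> W (add_mset (\<rho>, Q, Q') K) A1 B1 M1 N1" by blast
  from 1(3) obtain \<Sigma>1 \<theta>1 W1 K1 where u: "valid \<Sigma>1 (X \<union> A1) (X' \<union> B1) \<theta>1 W1 (K1 + add_mset (\<rho>, Q, Q') K)"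
    "\<forall>n \<in> X. \<theta>1 n = \<theta> n" "prefixes K1" "M1 + wires W = wires W1 + image_mset den_l K1"
    "N1 = state_r \<theta>1 K1" by (rule unrolledE)
  have inv1: "valid \<Sigma>1 (X \<union> A1) (X' \<union> B1) \<theta>1 W1 (add_mset (\<rho>, Q, Q') (K1 + K))" using u(1) by simp
  have "closure_ok \<Sigma> X (\<rho>, Q, Q')" using valid_addD(3)[OF inv] by simp
  from merge_comp_cong[OF this] u(2) have eq: "merge \<theta>1 \<circ> \<rho> = merge \<theta> \<circ> \<rho>" by blast
  have "A2 \<inter> (X \<union> A1) = {}" using S contr_Par.prems(3) by blast
  from contr_Par.IH(2)[OF inv1 S(2) this contr_Par.prems(4)] obtain B2 N2 where
    2: "spill (den Q' (merge \<theta> \<circ> \<rho>)) B2 N2" "B2 \<inter> (X' \<union> B1 \<union> Z) = {}"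
      "unrolled \<Sigma>1 (X \<union> A1) (X' \<union> B1) \<theta>1 W1 (K1 + K) A2 B2 M2 N2" unfolding eq by blast
  have "spill (den (Par P' Q') (merge \<theta> \<circ> \<rho>)) (B1 \<union> B2) (N1 + N2)"
    unfolding den.simps by (rule spill_Par[OF 1(1) 2(1)]) (use 2(2) in blast)
  moreover have "(B1 \<union> B2) \<inter> (X' \<union> Z) = {}" using 1(2) 2(2) by blast
  moreover have "unrolled \<Sigma> X X' \<theta> W K A (B1 \<union> B2) M (N1 + N2)"
    unfolding S(4,5) by (rule unrolled_Par[OF u 2(3)])
  ultimately show ?case by (intro exI conjI)
next
  case (contr_Res P P' a b T)
  from contr_Res.prems(2) obtain n A1 where S: "spill (den P (\<rho>(a := CI n, b := CO n))) A1 M" "n \<notin> A1"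
    "A = insert n A1" unfolding den.simps by (elim spill_ResE)
  have n: "n \<notin> X" using S contr_Res.prems(3) by blast
  have "finite (X' \<union> Z)"
    using contr_Res.prems(4) net_okD(2)[OF valid_addD(1)[OF contr_Res.prems(1)]] by blast
  then obtain n' where "n' \<notin> X' \<union> Z" using ex_new_if_finite infinite_UNIV_nat by blast
  then have n': "n' \<notin> X'" "n' \<notin> Z" by auto
  from valid_Res[OF contr_Res.prems(1) contr_Res.hyps n n'(1)] obtain U where
    inv: "valid (\<Sigma>(n := U)) (insert n X) (insert n' X') (\<theta>(n := CO n')) W
      (add_mset (\<rho>(a := CI n, b := CO n), P, P') K)" by blast
  have "A1 \<inter> insert n X = {}" using S contr_Res.prems(3) by blast
  from contr_Res.IH[OF inv S(1) this contr_Res.prems(4)] obtain B N where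
    1: "spill (den P' ((merge \<theta> \<circ> \<rho>)(a := CI n', b := CO n'))) B N" "B \<inter> (insert n' X' \<union> Z) = {}"
    "unrolled (\<Sigma>(n := U)) (insert n X) (insert n' X') (\<theta>(n := CO n')) W K A1 B M N"
    unfolding merge_Res[OF valid_addD(2)[OF contr_Res.prems(1)] n] by (elim exE conjE) (rule that)
  have "spill (den (Res a b T P') (merge \<theta> \<circ> \<rho>)) (insert n' B) N"
    unfolding den.simps by (rule spill_Res[where n = n'], rule 1(1)) (use 1(2) in blast)
  moreover have "insert n' B \<inter> (X' \<union> Z) = {}" using 1(2) n' by blast
  moreover have "unrolled \<Sigma> X X' \<theta> W K A (insert n' B) M N"
    unfolding S(3) by (rule unrolled_Res[OF 1(3) n])
  ultimately show ?case by (intro exI conjI)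
next
  case (contr_wire P P' b b' a U)
  define L where "L = nu b b' U (Par (link U b' a) P)"
  have "\<exists>h. den L \<rho> = SRes h" unfolding L_def nu_def by simp
  then obtain h where h: "den L \<rho> = SRes h" by blast
  from contr_wire.prems(2)[folded L_def, unfolded h] obtain n A1
    where S: "spill (h n) A1 M" "n \<notin> A1" "A = insert n A1" by (rule spill_ResE)
  have n: "n \<notin> X" using S contr_wire.prems(3) by blast
  from valid_wire[OF contr_wire.prems(1) contr_wire.hyps(1-5) n] obtain \<rho>1 m k t h' where
    inv: "valid (\<Sigma>(n := U)) (insert n X) X' (\<theta>(n := t)) (W(m \<mapsto> k)) (add_mset (\<rho>1, P, P') K)"
    and w: "m \<notin> dom W" "den L \<rho> = SRes h'" "h' n = SPar (SRep (CI m) (SOut k)) (den P \<rho>1)"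
      "\<forall>c. c \<noteq> b' \<longrightarrow> merge (\<theta>(n := t)) (\<rho>1 c) = ((merge \<theta> \<circ> \<rho>)(b := merge \<theta> (\<rho> a))) c"
    unfolding L_def[symmetric] by blast
  have hn: "h n = SPar (SRep (CI m) (SOut k)) (den P \<rho>1)"
  proof -
    have "SRes h' = SRes h" by (rule trans[OF w(2)[symmetric] h])
    then have "h' = h" by (rule sem.inject(4)[THEN iffD1])
    with w(3) show ?thesis by (simp only:)
  qed
  from S(1)[unfolded hn] obtain A2 A3 M2 M1 where S': "spill (SRep (CI m) (SOut k)) A2 M2"
    "spill (den P \<rho>1) A3 M1" "A1 = A2 \<union> A3" "M = M2 + M1" by (rule spill_ParE)
  have "A2 = {} \<and> M2 = {#SRep (CI m) (SOut k)#}" using S'(1) by (auto elim: spill_RepE)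
  with S' have M1: "spill (den P \<rho>1) A1 M1" "M = add_mset (SRep (CI m) (SOut k)) M1" by simp_all
  have "A1 \<inter> insert n X = {}" using S contr_wire.prems(3) by blast
  from contr_wire.IH[OF inv M1(1) this contr_wire.prems(4)] obtain B N where
    1: "spill (den P' (merge (\<theta>(n := t)) \<circ> \<rho>1)) B N" "B \<inter> (X' \<union> Z) = {}"
    "unrolled (\<Sigma>(n := U)) (insert n X) X' (\<theta>(n := t)) (W(m \<mapsto> k)) K A1 B M1 N" by blast
  \<comment> \<open>Substitution is a change of the valuation, and the two valuations differ at most
    at \<open>b'\<close>, which is not free in \<open>P'\<close>.\<close>
  have "den P' (merge (\<theta>(n := t)) \<circ> \<rho>1) = den (P'\<lbrace>Nm a/b\<rbrace>) (merge \<theta> \<circ> \<rho>)"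
    unfolding den_subst_Nm
    by (rule den_cong) (use w(4) contr_wire.hyps(6) in \<open>metis comp_apply\<close>)
  with 1(1) have "spill (den (P'\<lbrace>Nm a/b\<rbrace>) (merge \<theta> \<circ> \<rho>)) B N" by simp
  moreover have "unrolled \<Sigma> X X' \<theta> W K A B M N"
    unfolding S(3) M1(2)
    by (rule unrolled_wire[OF 1(3) n valid_finite_dom[OF contr_wire.prems(1)] w(1)])
  ultimately show ?case using 1(2) by (intro exI conjI)
qed

text \<open>The same induction with the unrolling of the contracted side given. Now the channels of
  the wired side have to be chosen, including one for every wire, about which the given unrolling
  says nothing.\<close>

lemma spill_contr_converse:
  assumes "contr P P'" "valid \<Sigma> X X' \<theta> W (add_mset (\<rho>, P, P') K)" "spill (den P' (merge \<theta> \<circ> \<rho>)) B N"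
    "B \<inter> X' = {}" "finite Z"
  shows "\<exists>A M. spill (den P \<rho>) A M \<and> A \<inter> (X \<union> Z) = {} \<and> unrolled \<Sigma> X X' \<theta> W K A B M N"
  using assms
proof (induction arbitrary: \<Sigma> X X' \<theta> W \<rho> K B N Z rule: contr.induct)
  case contr_Zero
  have "B = {}" "N = {#}" using contr_Zero.prems(2) by (auto elim: spill_ZeroE)
  with unrolled_empty[OF contr_Zero.prems(1)] spill_Zero show ?case
    by (intro exI[of _ "{}"] exI[of _ "{#}"]) simp
next
  case (contr_In P P' a x)
  show ?case by (rule spill_contr_prefix(2)[OF contr_In.prems(1) _ _ contr_In.prems(2)]) simp_all
next
  case (contr_Out a v)
  show ?case by (rule spill_contr_prefix(2)[OF contr_Out.prems(1) _ _ contr_Out.prems(2)]) simp_all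
next
  case (contr_Rep P P' a x)
  show ?case by (rule spill_contr_prefix(2)[OF contr_Rep.prems(1) _ _ contr_Rep.prems(2)]) simp_all
next
  case (contr_Par P P' Q Q')
  note inv = valid_Par[OF contr_Par.prems(1) contr_Par.hyps]
  from contr_Par.prems(2) obtain B1 B2 N1 N2 where S: "spill (den P' (merge \<theta> \<circ> \<rho>)) B1 N1"
    "spill (den Q' (merge \<theta> \<circ> \<rho>)) B2 N2"
    "B1 \<inter> B2 = {}" "B = B1 \<union> B2" "N = N1 + N2" unfolding den.simps by (elim spill_ParE)
  have "B1 \<inter> X' = {}" using S contr_Par.prems(3) by blast
  from contr_Par.IH(1)[OF inv S(1) this contr_Par.prems(4)] obtain A1 M1 where
    1: "spill (den P \<rho>) A1 M1" "A1 \<inter> (X \<union> Z) = {}"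
      "unrolled \<Sigma> X X' \<theta> W (add_mset (\<rho>, Q, Q') K) A1 B1 M1 N1" by blast
  from 1(3) obtain \<Sigma>1 \<theta>1 W1 K1 where u: "valid \<Sigma>1 (X \<union> A1) (X' \<union> B1) \<theta>1 W1 (K1 + add_mset (\<rho>, Q, Q') K)"
    "\<forall>n \<in> X. \<theta>1 n = \<theta> n" "prefixes K1" "M1 + wires W = wires W1 + image_mset den_l K1"
    "N1 = state_r \<theta>1 K1" by (rule unrolledE)
  have inv1: "valid \<Sigma>1 (X \<union> A1) (X' \<union> B1) \<theta>1 W1 (add_mset (\<rho>, Q, Q') (K1 + K))" using u(1) by simp
  have "closure_ok \<Sigma> X (\<rho>, Q, Q')" using valid_addD(3)[OF inv] by simp
  from merge_comp_cong[OF this] u(2) have eq: "merge \<theta>1 \<circ> \<rho> = merge \<theta> \<circ> \<rho>" by blast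
  have "B2 \<inter> (X' \<union> B1) = {}" using S contr_Par.prems(3) by blast
  from contr_Par.IH(2)[OF inv1 S(2)[folded eq] this contr_Par.prems(4)] obtain A2 M2 where
    2: "spill (den Q \<rho>) A2 M2" "A2 \<inter> (X \<union> A1 \<union> Z) = {}"
      "unrolled \<Sigma>1 (X \<union> A1) (X' \<union> B1) \<theta>1 W1 (K1 + K) A2 B2 M2 N2" by blast
  have "spill (den (Par P Q) \<rho>) (A1 \<union> A2) (M1 + M2)"
    unfolding den.simps by (rule spill_Par[OF 1(1) 2(1)]) (use 2(2) in blast)
  moreover have "(A1 \<union> A2) \<inter> (X \<union> Z) = {}" using 1(2) 2(2) by blast
  moreover have "unrolled \<Sigma> X X' \<theta> W K (A1 \<union> A2) B (M1 + M2) N"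
    unfolding S(4,5) by (rule unrolled_Par[OF u 2(3)])
  ultimately show ?case by (intro exI conjI)
next
  case (contr_Res P P' a b T)
  from contr_Res.prems(2) obtain n' B1 where
    S: "spill (den P' ((merge \<theta> \<circ> \<rho>)(a := CI n', b := CO n'))) B1 N" "n' \<notin> B1"
    "B = insert n' B1" unfolding den.simps by (elim spill_ResE)
  have n': "n' \<notin> X'" using S contr_Res.prems(3) by blast
  have "finite (X \<union> Z)"
    using contr_Res.prems(4) net_okD(1)[OF valid_addD(1)[OF contr_Res.prems(1)]] by blast
  then obtain n where "n \<notin> X \<union> Z" using ex_new_if_finite infinite_UNIV_nat by blast
  then have n: "n \<notin> X" "n \<notin> Z" by auto
  from valid_Res[OF contr_Res.prems(1) contr_Res.hyps n(1) n'] obtain U where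
    inv: "valid (\<Sigma>(n := U)) (insert n X) (insert n' X') (\<theta>(n := CO n')) W
      (add_mset (\<rho>(a := CI n, b := CO n), P, P') K)" by blast
  have S1: "spill (den P' (merge (\<theta>(n := CO n')) \<circ> \<rho>(a := CI n, b := CO n))) B1 N"
    unfolding merge_Res[OF valid_addD(2)[OF contr_Res.prems(1)] n(1)] by (rule S(1))
  have "B1 \<inter> insert n' X' = {}" using S contr_Res.prems(3) by blast
  from contr_Res.IH[OF inv S1 this contr_Res.prems(4)] obtain A M where
    1: "spill (den P (\<rho>(a := CI n, b := CO n))) A M" "A \<inter> (insert n X \<union> Z) = {}"
    "unrolled (\<Sigma>(n := U)) (insert n X) (insert n' X') (\<theta>(n := CO n')) W K A B1 M N"
    by (elim exE conjE) (rule that)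
  have "spill (den (Res a b T P) \<rho>) (insert n A) M"
    unfolding den.simps by (rule spill_Res[where n = n], rule 1(1)) (use 1(2) in blast)
  moreover have "insert n A \<inter> (X \<union> Z) = {}" using 1(2) n by blast
  moreover have "unrolled \<Sigma> X X' \<theta> W K (insert n A) B M N"
    unfolding S(3) by (rule unrolled_Res[OF 1(3) n(1)])
  ultimately show ?case by (intro exI conjI)
next
  case (contr_wire P P' b b' a U)
  define L where "L = nu b b' U (Par (link U b' a) P)"
  have "finite (X \<union> Z)"
    using contr_wire.prems(4) net_okD(1)[OF valid_addD(1)[OF contr_wire.prems(1)]] by blast
  then obtain n where "n \<notin> X \<union> Z" using ex_new_if_finite infinite_UNIV_nat by blast
  then have n: "n \<notin> X" "n \<notin> Z" by auto
  from valid_wire[OF contr_wire.prems(1) contr_wire.hyps(1-5) n(1)] obtain \<rho>1 m k t h where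
    inv: "valid (\<Sigma>(n := U)) (insert n X) X' (\<theta>(n := t)) (W(m \<mapsto> k)) (add_mset (\<rho>1, P, P') K)"
    and w: "m \<notin> dom W" "den L \<rho> = SRes h" "h n = SPar (SRep (CI m) (SOut k)) (den P \<rho>1)"
      "\<forall>c. c \<noteq> b' \<longrightarrow> merge (\<theta>(n := t)) (\<rho>1 c) = ((merge \<theta> \<circ> \<rho>)(b := merge \<theta> (\<rho> a))) c"
    unfolding L_def[symmetric] by (elim exE conjE) (rule that)
  have "den P' (merge (\<theta>(n := t)) \<circ> \<rho>1) = den (P'\<lbrace>Nm a/b\<rbrace>) (merge \<theta> \<circ> \<rho>)"
    unfolding den_subst_Nm
    by (rule den_cong) (use w(4) contr_wire.hyps(6) in \<open>metis comp_apply\<close>)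
  with contr_wire.prems(2) have "spill (den P' (merge (\<theta>(n := t)) \<circ> \<rho>1)) B N" by (simp only:)
  from contr_wire.IH[OF inv this contr_wire.prems(3,4)] obtain A M where
    1: "spill (den P \<rho>1) A M" "A \<inter> (insert n X \<union> Z) = {}"
    "unrolled (\<Sigma>(n := U)) (insert n X) X' (\<theta>(n := t)) (W(m \<mapsto> k)) K A B M N" by blast
  have "spill (h n) ({} \<union> A) ({#SRep (CI m) (SOut k)#} + M)"
    unfolding w(3) by (rule spill_Par[OF spill_Rep 1(1)]) simp
  then have "spill (den L \<rho>) (insert n A) (add_mset (SRep (CI m) (SOut k)) M)"
    unfolding w(2) by (intro spill_Res[where n = n]) (use 1(2) in auto)
  moreover have "insert n A \<inter> (X \<union> Z) = {}" using 1(2) n by blast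
  moreover have "unrolled \<Sigma> X X' \<theta> W K (insert n A) B (add_mset (SRep (CI m) (SOut k)) M) N"
    by (rule unrolled_wire[OF 1(3) n(1) valid_finite_dom[OF contr_wire.prems(1)] w(1)])
  ultimately show ?case unfolding L_def by (intro exI conjI)
qed

section \<open>Simulation\<close>

text \<open>An output as a closure over two fixed names, so that a message is determined by its
  channel and value and can be forwarded by exchanging \<open>k\<close>. The names matter only in
  being distinct: \<open>tp\<close> reads types from the valuation, not from the sort of a
  name.\<close>

definition msg :: "sv \<Rightarrow> sv \<Rightarrow> closure" where
  "msg k v = ((\<lambda>_. SStar)(OName 0 := k, IName 0 := v), Out (OName 0) (Nm (IName 0)), Out (OName 0) (Nm (IName 0)))"

lemma den_msg [simp]: "den_l (msg k v) = SOut k v" "den_r \<theta> (msg k v) = SOut (merge \<theta> k) (merge \<theta> v)"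
  by (simp_all add: msg_def)

lemma holds_msg: "holds m (msg k v) \<longleftrightarrow> k = CI m \<or> v = CI m"
  by (auto simp: msg_def holds.simps)

lemma closure_ok_msg:
  "closure_ok \<Sigma> X (msg k v) \<longleftrightarrow> ids k \<subseteq> X \<and> ids v \<subseteq> X \<and> svty \<Sigma> k = TO (svty \<Sigma> v)"
proof -
  have "k \<noteq> CI m" if "svty \<Sigma> k = TO T" for m T using that by auto
  then show ?thesis
    by (auto simp: msg_def closure_ok.simps env_of_def contr_refl)
qed

lemma prefixes_add [simp]:
  "prefixes (add_mset (\<rho>, P, P') K) \<longleftrightarrow> is_prefix P \<and> prefixes K"
  "prefixes (add_mset (msg k v) K) \<longleftrightarrow> prefixes K"
  "prefixes (K1 + K) \<longleftrightarrow> prefixes K1 \<and> prefixes K"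
  by (simp_all add: prefixes_def msg_def ball_Un)

lemma merge_den_val: "merge \<theta> (den_val \<rho> v) = den_val (merge \<theta> \<circ> \<rho>) v"
  by (cases v) auto

lemma contr_OutE:
  assumes "contr (Out a v) R" shows "R = Out a v"
  using assms by cases (auto simp: nu_def split: if_splits)

lemma contr_InE:
  assumes "contr (In a x P) R" obtains P' where "R = In a x P'" "contr P P'"
  using assms by cases (auto simp: nu_def split: if_splits)

lemma contr_RepE:
  assumes "contr (Rep a x P) R" obtains P' where "R = Rep a x P'" "contr P P'"
  using assms by cases (auto simp: nu_def split: if_splits)

lemma valid_replace:
  assumes inv: "valid \<Sigma> X X' \<theta> W (add_mset \<kappa> K)" and ok: "closure_ok \<Sigma> X \<kappa>'"
    and "\<And>m. holds m \<kappa>' \<Longrightarrow> holds m \<kappa>"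
  shows "valid \<Sigma> X X' \<theta> W (add_mset \<kappa>' K)"
proof (rule valid_addI)
  note D = valid_addD[OF inv]
  show "holders m W (add_mset \<kappa>' K) \<le> 1" for m
    using D(4)[of m] assms(3)[of m] by (auto simp: holders_add split: if_splits)
qed (use valid_addD[OF inv] ok in auto)

lemma valid_msg:
  assumes "valid \<Sigma> X X' \<theta> W (add_mset (\<rho>, Out a u, R) K)"
  shows "valid \<Sigma> X X' \<theta> W (add_mset (msg (\<rho> a) (den_val \<rho> u)) K)"
    "den_r \<theta> (\<rho>, Out a u, R) = den_r \<theta> (msg (\<rho> a) (den_val \<rho> u))"
proof -
  have ok: "closure_ok \<Sigma> X (\<rho>, Out a u, R)" using valid_addD[OF assms] by blast
  then have c: "contr (Out a u) R" and ids: "\<And>c. ids (\<rho> c) \<subseteq> X" and tp: "tp (env_of \<Sigma> \<rho>) (Out a u)"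
    unfolding closure_ok.simps by blast+
  from c have R: "R = Out a u" by (rule contr_OutE)
  show "den_r \<theta> (\<rho>, Out a u, R) = den_r \<theta> (msg (\<rho> a) (den_val \<rho> u))"
    by (simp add: R merge_den_val)
  have "svty \<Sigma> (\<rho> a) = TO (svty \<Sigma> (den_val \<rho> u))"
    using tp by (auto simp: has_type_env_of env_of_def)
  moreover have "ids (den_val \<rho> u) \<subseteq> X" using ids by (cases u) auto
  ultimately have "closure_ok \<Sigma> X (msg (\<rho> a) (den_val \<rho> u))" using ids closure_ok_msg by blast
  moreover have "holds m (\<rho>, Out a u, R)" if "holds m (msg (\<rho> a) (den_val \<rho> u))" for m
    using that unfolding holds_msg holds.simps by (cases u) auto
  ultimately show "valid \<Sigma> X X' \<theta> W (add_mset (msg (\<rho> a) (den_val \<rho> u)) K)"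
    by (rule valid_replace[OF assms])
qed

text \<open>A wire identifies its ends, so the forwarded message is still the same message on the
  contracted side. Its new channel is an output end, so no input end changes hands.\<close>

lemma valid_forward:
  assumes inv: "valid \<Sigma> X X' \<theta> W (add_mset (msg (CO m) v) K)" and W: "W m = Some k"
  shows "valid \<Sigma> X X' \<theta> W (add_mset (msg k v) K)" "merge \<theta> k = merge \<theta> (CO m)"
proof -
  from net_okD(4)[OF valid_addD(1)[OF inv] W]
  have k: "is_out k" "ids k \<subseteq> X" "merge \<theta> k = \<theta> m" "svty \<Sigma> k = TO (\<Sigma> m)" by auto
  show "merge \<theta> k = merge \<theta> (CO m)" using k by simp
  have "closure_ok \<Sigma> X (msg k v)" using valid_addD(2)[OF inv] k by (simp add: closure_ok_msg)
  moreover have "holds i (msg (CO m) v)" if "holds i (msg k v)" for i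
    using that k(1) unfolding holds_msg by auto
  ultimately show "valid \<Sigma> X X' \<theta> W (add_mset (msg k v) K)" by (rule valid_replace[OF inv])
qed

text \<open>An input end carried by the message passes to the receiver. Before the step the message
  was its only holder, so it does not meet another free name of the receiver for the same end, and
  injectivity survives.\<close>

lemma valid_comm_In:
  assumes inv: "valid \<Sigma> X X' \<theta> W (add_mset (\<rho>, In a x P, R) (add_mset (msg (CO c) v) K))"
    and c: "\<rho> a = CI c"
  shows "\<exists>P'. R = In a x P' \<and> contr P P' \<and> valid \<Sigma> X X' \<theta> W (add_mset (\<rho>(x := v), P, P') K)"
proof -
  note D = valid_addD[OF inv]
  have ok: "closure_ok \<Sigma> X (msg (CO c) v)" and K: "\<And>\<kappa>. \<kappa> \<in># K \<Longrightarrow> closure_ok \<Sigma> X \<kappa>" using D(3) by auto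
  from D(2) have contr: "contr (In a x P) R" and ids: "\<And>c. ids (\<rho> c) \<subseteq> X"
    and tp: "tp (env_of \<Sigma> \<rho>) (In a x P)"
    and inj: "\<And>c d m. c \<in> fn (In a x P) \<Longrightarrow> d \<in> fn (In a x P) \<Longrightarrow> \<rho> c = CI m \<Longrightarrow> \<rho> d = CI m \<Longrightarrow> c = d"
    unfolding closure_ok.simps by blast+
  from contr obtain P' where P': "R = In a x P'" "contr P P'" by (rule contr_InE)
  have v: "ids v \<subseteq> X" "svty \<Sigma> v = \<Sigma> c" using ok by (auto simp: closure_ok_msg)
  have tp': "tp (env_of \<Sigma> (\<rho>(x := v))) P"
    unfolding env_of_upd using tp v(2) c by (auto simp: env_of_def)
  have excl: "\<not> (holds m (\<rho>, In a x P, R) \<and> v = CI m)" for m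
    using D(4)[of m] by (auto simp: holders_add holds_msg split: if_splits)
  have old: "(c = x \<and> v = CI m) \<or> (c \<noteq> x \<and> c \<in> fn (In a x P) \<and> \<rho> c = CI m)"
    if "c \<in> fn P" "(\<rho>(x := v)) c = CI m" for c m
    using that by (cases "c = x") auto
  have "closure_ok \<Sigma> X (\<rho>(x := v), P, P')"
    unfolding closure_ok.simps
  proof (intro conjI allI ballI impI)
    show "ids ((\<rho>(x := v)) c) \<subseteq> X" for c using ids v(1) by simp
    show "d = e" if "d \<in> fn P" "e \<in> fn P" "(\<rho>(x := v)) d = CI m" "(\<rho>(x := v)) e = CI m" for d e m
      using old[OF that(1,3)] old[OF that(2,4)] excl[of m] inj unfolding holds.simps by blast
  qed (rule P'(2) tp')+
  moreover have "holds m (\<rho>, In a x P, R) \<or> v = CI m" if "holds m (\<rho>(x := v), P, P')" for m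
    using that old unfolding holds.simps by blast
  then have "holders m W (add_mset (\<rho>(x := v), P, P') K) \<le> 1" for m
    using D(4)[of m] by (auto simp: holders_add holds_msg split: if_splits)
  ultimately have "valid \<Sigma> X X' \<theta> W (add_mset (\<rho>(x := v), P, P') K)"
    using D(1) K by (intro valid_addI)
  with P' show ?thesis by blast
qed

text \<open>Replication copies its body, which is harmless because linear typing leaves the body no
  input end but possibly the received one; otherwise a copy would duplicate a right to
  receive.\<close>

lemma valid_comm_Rep:
  assumes inv: "valid \<Sigma> X X' \<theta> W (add_mset (\<rho>, Rep a x P, R) (add_mset (msg (CO c) v) K))"
    and c: "\<rho> a = CI c"
  shows "\<exists>P'. R = Rep a x P' \<and> contr P P' \<and>
    valid \<Sigma> X X' \<theta> W (add_mset (\<rho>(x := v), P, P') (add_mset (\<rho>, Rep a x P, R) K))"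
proof -
  note D = valid_addD[OF inv]
  have ok: "closure_ok \<Sigma> X (msg (CO c) v)" using D(3) by auto
  from D(2) have contr: "contr (Rep a x P) R" and ids: "\<And>c. ids (\<rho> c) \<subseteq> X"
    and tp: "tp (env_of \<Sigma> \<rho>) (Rep a x P)"
    unfolding closure_ok.simps by blast+
  from contr obtain P' where P': "R = Rep a x P'" "contr P P'" by (rule contr_RepE)
  have v: "ids v \<subseteq> X" "svty \<Sigma> v = \<Sigma> c" using ok by (auto simp: closure_ok_msg)
  from tp obtain T where T: "env_of \<Sigma> \<rho> a = Some (TI T)" "tp ((env_of \<Sigma> \<rho>)(x \<mapsto> T)) P"
    and out: "\<forall>d \<in> fn P - {x}. \<exists>U. env_of \<Sigma> \<rho> d = Some (TO U)" unfolding tp.simps(6) by blast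
  from T(1) c have "T = \<Sigma> c" by (simp add: env_of_def)
  with T(2) have tp': "tp (env_of \<Sigma> (\<rho>(x := v))) P" unfolding env_of_upd v(2) by simp
  have old: "d = x \<and> v = CI m" if "d \<in> fn P" "(\<rho>(x := v)) d = CI m" for d m
  proof (cases "d = x")
    case False
    with out that(1) obtain T where "env_of \<Sigma> \<rho> d = Some (TO T)" by blast
    with that(2) False show ?thesis by (simp add: env_of_def)
  qed (use that in simp)
  have new: "closure_ok \<Sigma> X (\<rho>(x := v), P, P')"
    unfolding closure_ok.simps
  proof (intro conjI allI ballI impI)
    show "ids ((\<rho>(x := v)) c) \<subseteq> X" for c using ids v(1) by simp
    show "d = e" if "d \<in> fn P" "e \<in> fn P" "(\<rho>(x := v)) d = CI m" "(\<rho>(x := v)) e = CI m" for d e m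
      using old[OF that(1,3)] old[OF that(2,4)] by simp
  qed (rule P'(2) tp')+
  have held: "holds m (msg (CO c) v)" if "holds m (\<rho>(x := v), P, P')" for m
    using that old unfolding holds.simps holds_msg by blast
  have "valid \<Sigma> X X' \<theta> W (add_mset (\<rho>(x := v), P, P') (add_mset (\<rho>, Rep a x P, R) K))"
    by (rule valid_replace[OF inv[unfolded add_mset_commute[of "(\<rho>, Rep a x P, R)"]] new held])
  with P' show ?thesis by blast
qed

section \<open>Messages and receivers in a pair of states\<close>

definition state_l :: "(nat \<rightharpoonup> sv) \<Rightarrow> closure multiset \<Rightarrow> sem multiset" where
  "state_l W K = wires W + image_mset den_l K"

definition contracts :: "sem multiset \<Rightarrow> sem multiset \<Rightarrow> bool" where
  "contracts M M' \<longleftrightarrow> (\<exists>\<Sigma> X X' \<theta> W K. valid \<Sigma> X X' \<theta> W K \<and> prefixes K \<and>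
     M = state_l W K \<and> M' = state_r \<theta> K)"

lemma contractsI:
  "valid \<Sigma> X X' \<theta> W K \<Longrightarrow> prefixes K \<Longrightarrow> contracts (state_l W K) (state_r \<theta> K)"
  unfolding contracts_def by blast

lemma wires_member: "W m = Some k \<Longrightarrow> finite (dom W) \<Longrightarrow> SRep (CI m) (SOut k) \<in># wires W"
  unfolding wires_def by (force intro: rev_image_eqI)

lemma wiresE:
  assumes "s \<in># wires W" obtains m k where "W m = Some k" "s = SRep (CI m) (SOut k)"
proof -
  from assms obtain m where m: "m \<in># mset_set (dom W)" "s = SRep (CI m) (SOut (the (W m)))"
    unfolding wires_def set_image_mset by (elim imageE)
  have "m \<in> dom W" using m(1) by (cases "finite (dom W)") simp_all
  then obtain k where k: "W m = Some k" by blast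
  show thesis by (rule that[OF k m(2)[unfolded k option.sel]])
qed

lemma unrolled_contracts:
  assumes "unrolled \<Sigma> X X' \<theta> W K A B M N" "\<And>\<kappa>. \<kappa> \<in># K \<Longrightarrow> closure_ok \<Sigma> X \<kappa>" "prefixes K"
  shows "contracts (M + state_l W K) (N + state_r \<theta> K)"
proof -
  from assms(1) obtain \<Sigma>1 \<theta>1 W1 K1 where u: "valid \<Sigma>1 (X \<union> A) (X' \<union> B) \<theta>1 W1 (K1 + K)"
    "\<forall>n \<in> X. \<theta>1 n = \<theta> n" "prefixes K1" "M + wires W = wires W1 + image_mset den_l K1"
    "N = state_r \<theta>1 K1" by (rule unrolledE)
  have "state_r \<theta>1 K = state_r \<theta> K"
    by (rule den_r_cong[OF assms(2)]) (use u(2) in auto)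
  then have "N + state_r \<theta> K = state_r \<theta>1 (K1 + K)" using u(5) by simp
  moreover have "M + state_l W K = state_l W1 (K1 + K)"
    unfolding state_l_def add.assoc[symmetric] u(4) by simp
  ultimately show ?thesis using contractsI[OF u(1)] u(3) assms(3) by simp
qed

lemma den_r_In:
  "den_r \<theta> (\<rho>, In a x P, In a x P') = SIn (merge \<theta> (\<rho> a)) (\<lambda>w. den P' ((merge \<theta> \<circ> \<rho>)(x := w)))"
  "den_r \<theta> (\<rho>, Rep a x P, Rep a x P') = SRep (merge \<theta> (\<rho> a)) (\<lambda>w. den P' ((merge \<theta> \<circ> \<rho>)(x := w)))"
  by simp_all

lemma merge_upd: "merge \<theta> \<circ> \<rho>(x := v) = (merge \<theta> \<circ> \<rho>)(x := merge \<theta> v)"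
  by auto

lemma state_l_add: "state_l W (add_mset \<kappa> K) = add_mset (den_l \<kappa>) (state_l W K)"
  by (simp add: state_l_def)

lemma take_out:
  assumes inv: "valid \<Sigma> X X' \<theta> W K" and pre: "prefixes K" and \<kappa>: "(\<rho>, Out a u, R) \<in># K"
  shows "\<exists>K0. valid \<Sigma> X X' \<theta> W (add_mset (msg (\<rho> a) (den_val \<rho> u)) K0) \<and> prefixes K0 \<and>
    state_l W K = add_mset (SOut (\<rho> a) (den_val \<rho> u)) (state_l W K0) \<and>
    den_r \<theta> (\<rho>, Out a u, R) = SOut (merge \<theta> (\<rho> a)) (merge \<theta> (den_val \<rho> u)) \<and>
    state_r \<theta> K = add_mset (SOut (merge \<theta> (\<rho> a)) (merge \<theta> (den_val \<rho> u))) (state_r \<theta> K0)"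
proof -
  from \<kappa> obtain K0 where K: "K = add_mset (\<rho>, Out a u, R) K0" by (rule mset_add)
  note inv' = valid_msg[OF inv[unfolded K]]
  have "prefixes K0" using pre unfolding K by simp
  moreover have "den_r \<theta> (\<rho>, Out a u, R) = SOut (merge \<theta> (\<rho> a)) (merge \<theta> (den_val \<rho> u))"
    unfolding inv'(2) den_msg ..
  moreover from this have "state_r \<theta> K =
      add_mset (SOut (merge \<theta> (\<rho> a)) (merge \<theta> (den_val \<rho> u))) (state_r \<theta> K0)"
    unfolding K image_mset_add_mset by (simp only:)
  moreover have "state_l W K = add_mset (SOut (\<rho> a) (den_val \<rho> u)) (state_l W K0)"
    unfolding K state_l_add den_l.simps den.simps ..
  ultimately show ?thesis using inv'(1) by (intro exI conjI)
qed

lemma take_out_l: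
  assumes inv: "valid \<Sigma> X X' \<theta> W K" and pre: "prefixes K" and k: "SOut k v \<in># state_l W K"
  shows "\<exists>K0. valid \<Sigma> X X' \<theta> W (add_mset (msg k v) K0) \<and> prefixes K0 \<and>
    state_l W K = add_mset (SOut k v) (state_l W K0) \<and>
    state_r \<theta> K = add_mset (SOut (merge \<theta> k) (merge \<theta> v)) (state_r \<theta> K0)"
proof -
  have "SOut k v \<notin># wires W" using wiresE sem.distinct by metis
  with k have "SOut k v \<in> den_l ` set_mset K" unfolding state_l_def by simp
  then obtain \<kappa> where \<kappa>: "\<kappa> \<in># K" "SOut k v = den_l \<kappa>" by (elim imageE) (rule that)
  obtain \<rho> P R where P: "\<kappa> = (\<rho>, P, R)" by (cases \<kappa>)
  from den_SOutE[OF \<kappa>(2)[unfolded P den_l.simps, symmetric]] obtain a u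
    where a: "P = Out a u" "\<rho> a = k" "v = den_val \<rho> u" by (elim exE conjE) (rule that)
  from take_out[OF inv pre \<kappa>(1)[unfolded P a(1)], unfolded a(2) a(3)[symmetric]]
  show ?thesis by (elim exE conjE) (intro exI conjI)
qed

lemma take_out_r:
  assumes inv: "valid \<Sigma> X X' \<theta> W K" and pre: "prefixes K" and k: "SOut k' v' \<in># state_r \<theta> K"
  shows "\<exists>k v K0. k' = merge \<theta> k \<and> v' = merge \<theta> v \<and> valid \<Sigma> X X' \<theta> W (add_mset (msg k v) K0) \<and>
    prefixes K0 \<and> state_l W K = add_mset (SOut k v) (state_l W K0) \<and>
    state_r \<theta> K = add_mset (SOut k' v') (state_r \<theta> K0)"
proof -
  from k have "SOut k' v' \<in> den_r \<theta> ` set_mset K" by (simp only: set_image_mset)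
  then obtain \<kappa> where \<kappa>: "\<kappa> \<in># K" "SOut k' v' = den_r \<theta> \<kappa>" by (elim imageE) (rule that)
  obtain \<rho> P R where P: "\<kappa> = (\<rho>, P, R)" by (cases \<kappa>)
  from den_SOutE[OF \<kappa>(2)[unfolded P den_r.simps, symmetric]] obtain a u where R: "R = Out a u"
    by (elim exE conjE) (rule that)
  have "closure_ok \<Sigma> X \<kappa>" using inv \<kappa>(1) unfolding valid_def by blast
  then have "contr P R" unfolding P closure_ok.simps by blast
  \<comment> \<open>A restricted wire can itself contract to an output, namely when its body does;
    in an unrolled state this cannot occur.\<close>
  moreover have "is_prefix P" using pre \<kappa>(1) unfolding prefixes_def P by blast
  ultimately have a: "P = Out a u" unfolding R by cases (auto simp: nu_def split: if_splits)
  from take_out[OF inv pre \<kappa>(1)[unfolded P a]] obtain K0 where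
    K0: "valid \<Sigma> X X' \<theta> W (add_mset (msg (\<rho> a) (den_val \<rho> u)) K0)" "prefixes K0"
    "state_l W K = add_mset (SOut (\<rho> a) (den_val \<rho> u)) (state_l W K0)"
    "den_r \<theta> (\<rho>, Out a u, R) = SOut (merge \<theta> (\<rho> a)) (merge \<theta> (den_val \<rho> u))"
    "state_r \<theta> K = add_mset (SOut (merge \<theta> (\<rho> a)) (merge \<theta> (den_val \<rho> u))) (state_r \<theta> K0)"
    by (elim exE conjE) (rule that)
  have "SOut k' v' = SOut (merge \<theta> (\<rho> a)) (merge \<theta> (den_val \<rho> u))"
    using \<kappa>(2) K0(4) unfolding P a by (rule trans)
  then have kv: "k' = merge \<theta> (\<rho> a)" "v' = merge \<theta> (den_val \<rho> u)" unfolding sem.inject by blast+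
  from kv K0(1-3) K0(5)[folded kv] show ?thesis by (intro exI conjI)
qed

lemma comm_l:
  assumes inv: "valid \<Sigma> X X' \<theta> W (add_mset (\<rho>(x := v), P, P') K)" and c: "contr P P'" and pre: "prefixes K"
    and B: "spill (den P (\<rho>(x := v))) B N" "B \<inter> X = {}" and Z: "finite Z"
  shows "\<exists>B' N'. spill (den P' ((merge \<theta> \<circ> \<rho>)(x := merge \<theta> v))) B' N' \<and> B' \<inter> Z = {} \<and>
    contracts (N + state_l W K) (N' + state_r \<theta> K)"
proof -
  from spill_contr[OF c inv B Z] obtain B' N' where
    1: "spill (den P' ((merge \<theta> \<circ> \<rho>)(x := merge \<theta> v))) B' N'" "B' \<inter> (X' \<union> Z) = {}"
    "unrolled \<Sigma> X X' \<theta> W K B B' N N'" unfolding merge_upd by (elim exE conjE) (rule that)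
  have "B' \<inter> Z = {}" using 1(2) by blast
  with unrolled_contracts[OF 1(3) valid_addD(3)[OF inv] pre] 1(1) show ?thesis by (intro exI conjI)
qed

lemma comm_r:
  assumes inv: "valid \<Sigma> X X' \<theta> W (add_mset (\<rho>(x := v), P, P') K)" and c: "contr P P'" and pre: "prefixes K"
    and B: "spill (den P' ((merge \<theta> \<circ> \<rho>)(x := merge \<theta> v))) B N" "B \<inter> X' = {}" and Z: "finite Z"
  shows "\<exists>A M. spill (den P (\<rho>(x := v))) A M \<and> A \<inter> Z = {} \<and>
    contracts (M + state_l W K) (N + state_r \<theta> K)"
proof -
  from spill_contr_converse[OF c inv _ B(2) Z, unfolded merge_upd, OF B(1)] obtain A M where
    1: "spill (den P (\<rho>(x := v))) A M" "A \<inter> (X \<union> Z) = {}" "unrolled \<Sigma> X X' \<theta> W K A B M N"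
    by (elim exE conjE) (rule that)
  have "A \<inter> Z = {}" using 1(2) by blast
  with unrolled_contracts[OF 1(3) valid_addD(3)[OF inv] pre] 1(1) show ?thesis by (intro exI conjI)
qed

text \<open>Three receivers are possible. A wire moves the message within its class, so the
  contracted state stays put. A linear or a replicated input of a closure has a counterpart on the
  merged channel, and the step is copied. \<open>Y\<close> contains \<open>X\<close> so that the
  channels drawn are new; \<open>Z\<close> is what the copied step has to avoid.\<close>

lemma contracts_step_l:
  assumes inv: "valid \<Sigma> X X' \<theta> W K" and pre: "prefixes K"
    and step: "mstep Y (state_l W K) M1" and Y: "X \<subseteq> Y" and Z: "finite Z"
  shows "contracts M1 (state_r \<theta> K) \<or>
    (\<exists>M1'. mstep Z (state_r \<theta> K) M1' \<and> contracts M1 M1')"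
  using step
proof cases
  case (mstep_In f v B N c T)
  from mstep_In(1) have "SOut (CO c) v \<in># state_l W K" by (simp only:) simp
  from take_out_l[OF inv pre this] obtain K0 where
    K0: "valid \<Sigma> X X' \<theta> W (add_mset (msg (CO c) v) K0)" "prefixes K0"
    "state_l W K = add_mset (SOut (CO c) v) (state_l W K0)"
    "state_r \<theta> K = add_mset (SOut (merge \<theta> (CO c)) (merge \<theta> v)) (state_r \<theta> K0)"
    by (elim exE conjE) (rule that)
  have "add_mset (SOut (CO c) v) (state_l W K0) = add_mset (SOut (CO c) v) (add_mset (SIn (CI c) f) T)"
    unfolding K0(3)[symmetric] mstep_In(1) by (simp add: add_mset_commute)
  then have T: "state_l W K0 = add_mset (SIn (CI c) f) T" unfolding add_mset_add_mset_same_iff .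
  have "SIn (CI c) f \<in># state_l W K0" unfolding T by (rule union_single_eq_member[OF refl])
  moreover have "SIn (CI c) f \<notin># wires W" using wiresE sem.distinct by metis
  ultimately have "SIn (CI c) f \<in> den_l ` set_mset K0" unfolding state_l_def by simp
  then obtain \<kappa> where \<kappa>: "\<kappa> \<in># K0" "SIn (CI c) f = den_l \<kappa>" by (elim imageE) (rule that)
  obtain \<rho> P0 R where P0: "\<kappa> = (\<rho>, P0, R)" by (cases \<kappa>)
  from den_SInE[OF \<kappa>(2)[unfolded P0 den_l.simps, symmetric]] obtain a x P
    where a: "P0 = In a x P" "\<rho> a = CI c" "f = (\<lambda>w. den P (\<rho>(x := w)))" by (elim exE conjE) (rule that)
  from \<kappa>(1) obtain K1 where K1: "K0 = add_mset (\<rho>, In a x P, R) K1" unfolding P0 a(1) by (rule mset_add)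
  have inv1: "valid \<Sigma> X X' \<theta> W (add_mset (\<rho>, In a x P, R) (add_mset (msg (CO c) v) K1))"
    using K0(1) unfolding K1 add_mset_commute[of "msg (CO c) v"] .
  from valid_comm_In[OF inv1 a(2)] obtain P' where P': "R = In a x P'" "contr P P'"
    "valid \<Sigma> X X' \<theta> W (add_mset (\<rho>(x := v), P, P') K1)" by blast
  have "holds c (\<rho>, In a x P, R)" using a(2) unfolding holds.simps by auto
  from valid_held(4)[OF inv1 this] obtain j where j: "\<theta> c = CO j" by blast
  have TK: "T = state_l W K1"
    using T[unfolded K1 state_l_add den_l.simps den.simps a(2,3) add_mset_add_mset_same_iff] by (rule sym)
  have pre1: "prefixes K1" using K0(2) unfolding K1 by simp
  have "B \<inter> X = {}" using mstep_In(4) Y by blast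
  from comm_l[OF P'(3,2) pre1 mstep_In(3)[unfolded a(3)] this Z] obtain B' N' where
    1: "spill (den P' ((merge \<theta> \<circ> \<rho>)(x := merge \<theta> v))) B' N'" "B' \<inter> Z = {}"
    "contracts (N + state_l W K1) (N' + state_r \<theta> K1)" by (elim exE conjE) (rule that)
  define f' where "f' = (\<lambda>w. den P' ((merge \<theta> \<circ> \<rho>)(x := w)))"
  have "state_r \<theta> K = {#SIn (CI j) f', SOut (CO j) (merge \<theta> v)#} + state_r \<theta> K1"
    unfolding K0(4) K1 image_mset_add_mset P'(1) den_r_In a(2) merge.simps j sv.case f'_def
    by (simp add: add_mset_commute)
  moreover have "mstep Z ({#SIn (CI j) f', SOut (CO j) (merge \<theta> v)#} + state_r \<theta> K1)
      (N' + state_r \<theta> K1)"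
    by (rule mstep.mstep_In[OF _ 1(2)]) (unfold f'_def, rule 1(1))
  ultimately show ?thesis using 1(3) unfolding mstep_In(2) TK by (intro disjI2 exI conjI) (simp only:)
next
  case (mstep_Rep f v B N c T)
  from mstep_Rep(1) have "SOut (CO c) v \<in># state_l W K" by (simp only:) simp
  from take_out_l[OF inv pre this] obtain K0 where
    K0: "valid \<Sigma> X X' \<theta> W (add_mset (msg (CO c) v) K0)" "prefixes K0"
    "state_l W K = add_mset (SOut (CO c) v) (state_l W K0)"
    "state_r \<theta> K = add_mset (SOut (merge \<theta> (CO c)) (merge \<theta> v)) (state_r \<theta> K0)"
    by (elim exE conjE) (rule that)
  have "add_mset (SOut (CO c) v) (state_l W K0) = add_mset (SOut (CO c) v) (add_mset (SRep (CI c) f) T)"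
    unfolding K0(3)[symmetric] mstep_Rep(1) by (simp add: add_mset_commute)
  then have T: "state_l W K0 = add_mset (SRep (CI c) f) T" unfolding add_mset_add_mset_same_iff .
  have M1: "M1 = N + state_l W K0" unfolding mstep_Rep(2) T by simp
  have "SRep (CI c) f \<in># wires W + image_mset den_l K0"
    unfolding T[unfolded state_l_def] by (rule union_single_eq_member[OF refl])
  then consider "SRep (CI c) f \<in># wires W" | "SRep (CI c) f \<in> den_l ` set_mset K0"
    unfolding union_iff set_image_mset by blast
  then show ?thesis
  proof cases
    case 1
    then obtain m k where W: "W m = Some k" "SRep (CI c) f = SRep (CI m) (SOut k)" by (rule wiresE)
    then have m: "c = m" "f = SOut k" unfolding sem.inject sv.inject by blast+
    have N: "N = {#SOut k v#}" using mstep_Rep(3) unfolding m(2) by (rule spill_OutE)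
    note fwd = valid_forward[OF K0(1)[unfolded m(1)] W(1)]
    have "contracts (state_l W (add_mset (msg k v) K0)) (state_r \<theta> (add_mset (msg k v) K0))"
      by (rule contractsI[OF fwd(1)]) (simp add: K0(2))
    moreover have "state_r \<theta> (add_mset (msg k v) K0) = state_r \<theta> K"
      unfolding image_mset_add_mset den_msg fwd(2) K0(4) m(1) ..
    moreover have "state_l W (add_mset (msg k v) K0) = M1"
      unfolding M1 N state_l_add den_msg by simp
    ultimately have "contracts M1 (state_r \<theta> K)" by (simp only:)
    then show ?thesis by (rule disjI1)
  next
    case 2
    then obtain \<kappa> where \<kappa>: "\<kappa> \<in># K0" "SRep (CI c) f = den_l \<kappa>" by (elim imageE) (rule that)
    obtain \<rho> P0 R where P0: "\<kappa> = (\<rho>, P0, R)" by (cases \<kappa>)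
    from den_SRepE[OF \<kappa>(2)[unfolded P0 den_l.simps, symmetric]] obtain a x P
      where a: "P0 = Rep a x P" "\<rho> a = CI c" "f = (\<lambda>w. den P (\<rho>(x := w)))" by (elim exE conjE) (rule that)
    from \<kappa>(1) obtain K1 where K1: "K0 = add_mset (\<rho>, Rep a x P, R) K1" unfolding P0 a(1) by (rule mset_add)
    have inv1: "valid \<Sigma> X X' \<theta> W (add_mset (\<rho>, Rep a x P, R) (add_mset (msg (CO c) v) K1))"
      using K0(1) unfolding K1 add_mset_commute[of "msg (CO c) v"] .
    from valid_comm_Rep[OF inv1 a(2)] obtain P' where P': "R = Rep a x P'" "contr P P'"
      "valid \<Sigma> X X' \<theta> W (add_mset (\<rho>(x := v), P, P') K0)" unfolding K1 by blast
    have "holds c (\<rho>, Rep a x P, R)" using a(2) unfolding holds.simps by auto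
    from valid_held(4)[OF inv1 this] obtain j where j: "\<theta> c = CO j" by blast
    have "B \<inter> X = {}" using mstep_Rep(4) Y by blast
    from comm_l[OF P'(3,2) K0(2) mstep_Rep(3)[unfolded a(3)] this Z] obtain B' N' where
      1: "spill (den P' ((merge \<theta> \<circ> \<rho>)(x := merge \<theta> v))) B' N'" "B' \<inter> Z = {}"
      "contracts (N + state_l W K0) (N' + state_r \<theta> K0)" by (elim exE conjE) (rule that)
    define f' where "f' = (\<lambda>w. den P' ((merge \<theta> \<circ> \<rho>)(x := w)))"
    have imK0: "state_r \<theta> K0 = add_mset (SRep (CI j) f') (state_r \<theta> K1)"
      unfolding K1 image_mset_add_mset P'(1) den_r_In a(2) merge.simps j sv.case f'_def ..
    have "state_r \<theta> K = {#SRep (CI j) f', SOut (CO j) (merge \<theta> v)#} + state_r \<theta> K1"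
      unfolding K0(4) imK0 merge.simps j by (simp add: add_mset_commute)
    moreover have "mstep Z ({#SRep (CI j) f', SOut (CO j) (merge \<theta> v)#} + state_r \<theta> K1)
        (add_mset (SRep (CI j) f') (N' + state_r \<theta> K1))"
      by (rule mstep.mstep_Rep[OF _ 1(2)]) (unfold f'_def, rule 1(1))
    moreover have "add_mset (SRep (CI j) f') (N' + state_r \<theta> K1) = N' + state_r \<theta> K0"
      unfolding imK0 by simp
    ultimately show ?thesis using 1(3) unfolding M1 by (intro disjI2 exI conjI) (simp only:)
  qed
qed

text \<open>Forwarding draws no channels, so each hop along an edge is a reduction whatever set has
  to be avoided.\<close>

lemma forward_red:
  assumes "(u, u') \<in> (edges W)\<^sup>*" "valid \<Sigma> X X' \<theta> W (add_mset (msg u v) K)"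
    "rep P (state_l W (add_mset (msg u v) K))"
  shows "\<exists>Q. P \<longmapsto>* Q \<and> rep Q (state_l W (add_mset (msg u' v) K)) \<and> valid \<Sigma> X X' \<theta> W (add_mset (msg u' v) K)"
  using assms
proof (induction rule: rtrancl_induct)
  case base
  then show ?case by blast
next
  case (step y z)
  then obtain Q where Q: "P \<longmapsto>* Q" "rep Q (state_l W (add_mset (msg y v) K))"
    "valid \<Sigma> X X' \<theta> W (add_mset (msg y v) K)" by blast
  from step.hyps(2) obtain m where m: "y = CO m" "W m = Some z" unfolding edges_def by blast
  from wires_member[OF m(2) valid_finite_dom[OF Q(3)]] obtain T
    where T: "wires W = add_mset (SRep (CI m) (SOut z)) T" by (rule mset_add)
  obtain Y where Y: "\<And>N. mstep Y (state_l W (add_mset (msg y v) K)) N \<Longrightarrow> \<exists>Q'. Q \<longmapsto> Q' \<and> rep Q' N"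
    using rep_mstep_red[OF Q(2)] by blast
  have "mstep Y ({#SRep (CI m) (SOut z), SOut (CO m) v#} + (T + image_mset den_l K))
    (add_mset (SRep (CI m) (SOut z)) ({#SOut z v#} + (T + image_mset den_l K)))"
    by (rule mstep_Rep[OF spill_Out]) simp
  moreover have "{#SRep (CI m) (SOut z), SOut (CO m) v#} + (T + image_mset den_l K) = state_l W (add_mset (msg y v) K)"
    unfolding state_l_def T m(1) image_mset_add_mset den_msg by (simp add: add_mset_commute)
  moreover have "add_mset (SRep (CI m) (SOut z)) ({#SOut z v#} + (T + image_mset den_l K)) = state_l W (add_mset (msg z v) K)"
    unfolding state_l_def T image_mset_add_mset den_msg by (simp add: add_mset_commute)
  ultimately have "mstep Y (state_l W (add_mset (msg y v) K)) (state_l W (add_mset (msg z v) K))"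
    by (simp only:)
  from Y[OF this] obtain Q' where Q': "Q \<longmapsto> Q'" "rep Q' (state_l W (add_mset (msg z v) K))" by blast
  have "P \<longmapsto>* Q'" by (rule rtranclp.rtrancl_into_rtrancl[OF Q(1) Q'(1)])
  moreover have "valid \<Sigma> X X' \<theta> W (add_mset (msg z v) K)" by (rule valid_forward(1)[OF Q(3)[unfolded m(1)] m(2)])
  ultimately show ?case using Q'(2) by (intro exI conjI)
qed

lemma reach_sink:
  assumes inv: "valid \<Sigma> X X' \<theta> W (add_mset (msg k v) K)" and "is_out u" "ids u \<subseteq> X"
    and "merge \<theta> k = merge \<theta> u" "u \<notin> Domain (edges W)"
  shows "(k, u) \<in> (edges W)\<^sup>*"
proof -
  note D = valid_addD[OF inv]
  have "ids k \<subseteq> X" "is_out k" using D(2) svty_TO unfolding closure_ok_msg by blast+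
  with net_okD(5)[OF D(1)] assms(2-) show ?thesis by blast
qed

text \<open>A communication on the merged channel \<open>j\<close> says only that the channels of
  message and receiver lie in one class. By linearity the channel \<open>c\<close> of the receiver
  is a sink, so the reachability clause provides a path of wires from \<open>k\<close> to
  it.\<close>

lemma take_receiver_r:
  assumes inv: "valid \<Sigma> X X' \<theta> W (add_mset (msg k v) K)" and pre: "prefixes K"
    and s: "s \<in># state_r \<theta> K" and k: "merge \<theta> k = CO j"
  shows "s = SIn (CI j) f \<Longrightarrow> \<exists>\<rho> a x P P' c K1. K = add_mset (\<rho>, In a x P, In a x P') K1 \<and>
      contr P P' \<and> \<rho> a = CI c \<and> merge \<theta> (\<rho> a) = CI j \<and> (k, CO c) \<in> (edges W)\<^sup>* \<and> f = (\<lambda>w. den P' ((merge \<theta> \<circ> \<rho>)(x := w)))"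
    and "s = SRep (CI j) f \<Longrightarrow> \<exists>\<rho> a x P P' c K1. K = add_mset (\<rho>, Rep a x P, Rep a x P') K1 \<and>
      contr P P' \<and> \<rho> a = CI c \<and> merge \<theta> (\<rho> a) = CI j \<and> (k, CO c) \<in> (edges W)\<^sup>* \<and> f = (\<lambda>w. den P' ((merge \<theta> \<circ> \<rho>)(x := w)))"
proof -
  from s have "s \<in> den_r \<theta> ` set_mset K" by (simp only: set_image_mset)
  then obtain \<kappa> where \<kappa>: "\<kappa> \<in># K" "s = den_r \<theta> \<kappa>" by (elim imageE) (rule that)
  obtain \<rho> P0 R where P0: "\<kappa> = (\<rho>, P0, R)" by (cases \<kappa>)
  from \<kappa>(1) obtain K1 where K1: "K = add_mset (\<rho>, P0, R) K1" unfolding P0 by (rule mset_add)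
  have inv1: "valid \<Sigma> X X' \<theta> W (add_mset (\<rho>, P0, R) (add_mset (msg k v) K1))"
    using inv unfolding K1 add_mset_commute[of "msg k v"] .
  have ok: "contr P0 R" "tp (env_of \<Sigma> \<rho>) P0" using valid_addD(2)[OF inv1] unfolding closure_ok.simps by blast+
  have prefix: "is_prefix P0" using pre unfolding K1 by simp
  have chan: "\<exists>c. \<rho> a = CI c \<and> (k, CO c) \<in> (edges W)\<^sup>*"
    if tp: "env_of \<Sigma> \<rho> a = Some (TI T)" and a: "a \<in> fn P0" and m: "merge \<theta> (\<rho> a) = CI j" for a T
  proof -
    from tp have "svty \<Sigma> (\<rho> a) = TI T" by (simp add: env_of_def)
    from svty_TI[OF this] obtain c where c: "\<rho> a = CI c" by blast
    with a have "holds c (\<rho>, P0, R)" unfolding holds.simps by blast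
    note held = valid_held[OF inv1 this]
    from held(4) obtain i where i: "\<theta> c = CO i" by blast
    with m c have "merge \<theta> k = merge \<theta> (CO c)" using k by simp
    moreover have "CO c \<notin> Domain (edges W)" using held(2) Domain_edges by blast
    ultimately have "(k, CO c) \<in> (edges W)\<^sup>*" by (intro reach_sink[OF inv]) (use held(1) in simp_all)
    with c show ?thesis by blast
  qed
  show "\<exists>\<rho> a x P P' c K1. K = add_mset (\<rho>, In a x P, In a x P') K1 \<and>
      contr P P' \<and> \<rho> a = CI c \<and> merge \<theta> (\<rho> a) = CI j \<and> (k, CO c) \<in> (edges W)\<^sup>* \<and> f = (\<lambda>w. den P' ((merge \<theta> \<circ> \<rho>)(x := w)))"
    if s': "s = SIn (CI j) f"
  proof -
    have "den R (merge \<theta> \<circ> \<rho>) = SIn (CI j) f" using \<kappa>(2) s' unfolding P0 den_r.simps by (rule subst)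
    from den_SInE[OF this] obtain a x P' where R: "R = In a x P'" "(merge \<theta> \<circ> \<rho>) a = CI j"
      "f = (\<lambda>w. den P' ((merge \<theta> \<circ> \<rho>)(x := w)))" by (elim exE conjE) (rule that)
    from ok(1) prefix obtain P where P: "P0 = In a x P" "contr P P'"
      unfolding R by cases (auto simp: nu_def split: if_splits)
    from ok(2) obtain T where "env_of \<Sigma> \<rho> a = Some (TI T)" unfolding P tp.simps by blast
    from chan[OF this] R(2) obtain c where "\<rho> a = CI c" "(k, CO c) \<in> (edges W)\<^sup>*"
      unfolding P comp_apply by auto
    with K1[unfolded P(1) R(1)] P(2) R(2)[unfolded comp_apply] R(3) show ?thesis by (intro exI conjI)
  qed
  show "\<exists>\<rho> a x P P' c K1. K = add_mset (\<rho>, Rep a x P, Rep a x P') K1 \<and>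
      contr P P' \<and> \<rho> a = CI c \<and> merge \<theta> (\<rho> a) = CI j \<and> (k, CO c) \<in> (edges W)\<^sup>* \<and> f = (\<lambda>w. den P' ((merge \<theta> \<circ> \<rho>)(x := w)))"
    if s': "s = SRep (CI j) f"
  proof -
    have "den R (merge \<theta> \<circ> \<rho>) = SRep (CI j) f" using \<kappa>(2) s' unfolding P0 den_r.simps by (rule subst)
    from den_SRepE[OF this] obtain a x P' where R: "R = Rep a x P'" "(merge \<theta> \<circ> \<rho>) a = CI j"
      "f = (\<lambda>w. den P' ((merge \<theta> \<circ> \<rho>)(x := w)))" by (elim exE conjE) (rule that)
    from ok(1) prefix obtain P where P: "P0 = Rep a x P" "contr P P'"
      unfolding R by cases (auto simp: nu_def split: if_splits)
    from ok(2) obtain T where "env_of \<Sigma> \<rho> a = Some (TI T)" unfolding P tp.simps by blast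
    from chan[OF this] R(2) obtain c where "\<rho> a = CI c" "(k, CO c) \<in> (edges W)\<^sup>*"
      unfolding P comp_apply by auto
    with K1[unfolded P(1) R(1)] P(2) R(2)[unfolded comp_apply] R(3) show ?thesis by (intro exI conjI)
  qed
qed

text \<open>Which channels must be avoided depends on how \<open>Q\<close> represents
  \<open>M\<close>, so the premise asks for a suitable step for every finite set.\<close>

lemma rep_step:
  assumes "P \<longmapsto>* Q" "rep Q M" "\<And>Y. finite Y \<Longrightarrow> \<exists>N. mstep Y M N \<and> contracts N M'"
  shows "\<exists>Q' N. P \<longmapsto>* Q' \<and> rep Q' N \<and> contracts N M'"
proof -
  obtain Y where Y: "finite Y" "\<And>N. mstep Y M N \<Longrightarrow> \<exists>Q'. Q \<longmapsto> Q' \<and> rep Q' N"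
    using rep_mstep_red[OF assms(2)] by blast
  from assms(3)[OF Y(1)] obtain N where N: "mstep Y M N" "contracts N M'" by blast
  from Y(2)[OF N(1)] obtain Q' where Q': "Q \<longmapsto> Q'" "rep Q' N" by blast
  have "P \<longmapsto>* Q'" by (rule rtranclp.rtrancl_into_rtrancl[OF assms(1) Q'(1)])
  with Q'(2) N(2) show ?thesis by (intro exI conjI)
qed

text \<open>The wired side enters as a process \<open>P\<close> rather than as a mere state: several
  reductions may precede the communication, and the set to be avoided is known only for the process
  reached by them.\<close>

lemma contracts_step_r:
  assumes inv: "valid \<Sigma> X X' \<theta> W K" and pre: "prefixes K"
    and step: "mstep Y (state_r \<theta> K) M1'" and Y: "X' \<subseteq> Y" and rep: "rep P (state_l W K)"
  shows "\<exists>Q M1. P \<longmapsto>* Q \<and> rep Q M1 \<and> contracts M1 M1'"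
proof -
  \<comment> \<open>What remains once the message has reached the channel of its receiver, common to
    both kinds of input; \<open>comm\<close> describes the communication on the wired side.\<close>
  have finish: ?thesis if P2: "P \<longmapsto>* P2" "rep P2 M"
    and inv2: "valid \<Sigma> X X' \<theta> W (add_mset (\<rho>(x := v), Q, Q') K2)" and Q: "contr Q Q'" "prefixes K2"
    and B: "spill (den Q' ((merge \<theta> \<circ> \<rho>)(x := merge \<theta> v))) B N" "B \<inter> Y = {}"
    and M1': "M1' = N + state_r \<theta> K2"
    and comm: "\<And>Z A N. spill (den Q (\<rho>(x := v))) A N \<Longrightarrow> A \<inter> Z = {} \<Longrightarrow> mstep Z M (N + state_l W K2)"
    for P2 M \<rho> x v Q Q' K2 B N
  proof (rule rep_step[OF P2])
    fix Z :: "nat set" assume "finite Z"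
    have "B \<inter> X' = {}" using B(2) Y by blast
    from comm_r[OF inv2 Q B(1) this \<open>finite Z\<close>] obtain A N1 where
      1: "spill (den Q (\<rho>(x := v))) A N1" "A \<inter> Z = {}"
        "contracts (N1 + state_l W K2) (N + state_r \<theta> K2)" by (elim exE conjE) (rule that)
    from comm[OF 1(1,2)] 1(3) show "\<exists>N. mstep Z M N \<and> contracts N M1'"
      unfolding M1' by (intro exI conjI)
  qed
  from step show ?thesis
  proof cases
    case (mstep_In f' v' B N j T)
    from mstep_In(1) have "SOut (CO j) v' \<in># state_r \<theta> K" by (simp only:) simp
    from take_out_r[OF inv pre this] obtain k v K0 where
      k: "CO j = merge \<theta> k" "v' = merge \<theta> v" and
      K0: "valid \<Sigma> X X' \<theta> W (add_mset (msg k v) K0)" "prefixes K0"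
      "state_l W K = add_mset (SOut k v) (state_l W K0)"
      "state_r \<theta> K = add_mset (SOut (CO j) v') (state_r \<theta> K0)"
      by (elim exE conjE) (rule that)
    have "add_mset (SOut (CO j) v') (state_r \<theta> K0) = add_mset (SOut (CO j) v') (add_mset (SIn (CI j) f') T)"
      unfolding K0(4)[symmetric] mstep_In(1) by (simp add: add_mset_commute)
    then have T: "state_r \<theta> K0 = add_mset (SIn (CI j) f') T" unfolding add_mset_add_mset_same_iff .
    have "SIn (CI j) f' \<in># state_r \<theta> K0" unfolding T by (rule union_single_eq_member[OF refl])
    from take_receiver_r(1)[OF K0(1,2) this k(1)[symmetric] refl] obtain \<rho> a x Q Q' c K1 where
      K1: "K0 = add_mset (\<rho>, In a x Q, In a x Q') K1" and Q: "contr Q Q'" "\<rho> a = CI c"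
        "(k, CO c) \<in> (edges W)\<^sup>*" and m: "merge \<theta> (\<rho> a) = CI j" and f': "f' = (\<lambda>w. den Q' ((merge \<theta> \<circ> \<rho>)(x := w)))"
      by (elim exE conjE) (rule that)
    have "rep P (state_l W (add_mset (msg k v) K0))" using rep unfolding K0(3) state_l_add den_msg .
    from forward_red[OF Q(3) K0(1) this] obtain P2 where
      P2: "P \<longmapsto>* P2" "rep P2 (state_l W (add_mset (msg (CO c) v) K0))"
        "valid \<Sigma> X X' \<theta> W (add_mset (msg (CO c) v) K0)" by blast
    have inv1: "valid \<Sigma> X X' \<theta> W (add_mset (\<rho>, In a x Q, In a x Q') (add_mset (msg (CO c) v) K1))"
      using P2(3) unfolding K1 add_mset_commute[of "msg (CO c) v"] .
    from valid_comm_In[OF inv1 Q(2)] obtain Q'' where "In a x Q' = In a x Q''"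
      "valid \<Sigma> X X' \<theta> W (add_mset (\<rho>(x := v), Q, Q'') K1)" by blast
    then have inv2: "valid \<Sigma> X X' \<theta> W (add_mset (\<rho>(x := v), Q, Q') K1)" by simp
    have pre1: "prefixes K1" using K0(2) unfolding K1 by simp
    have TK: "T = state_r \<theta> K1"
      using T[unfolded K1 image_mset_add_mset den_r_In m f' add_mset_add_mset_same_iff] by (rule sym)
    define f where "f = (\<lambda>w. den Q (\<rho>(x := w)))"
    have st: "state_l W (add_mset (msg (CO c) v) K0) = {#SIn (CI c) f, SOut (CO c) v#} + state_l W K1"
      unfolding K1 state_l_add den_msg den_l.simps den.simps Q(2) f_def by (simp add: add_mset_commute)
    show ?thesis
    proof (rule finish[OF P2(1,2) inv2 Q(1) pre1 mstep_In(3)[unfolded f' k(2)] mstep_In(4) mstep_In(2)[unfolded TK]])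
      fix Z A M assume "spill (den Q (\<rho>(x := v))) A M" "A \<inter> Z = {}"
      then show "mstep Z (state_l W (add_mset (msg (CO c) v) K0)) (M + state_l W K1)"
        unfolding st by (intro mstep.mstep_In) (unfold f_def)
    qed
  next
    case (mstep_Rep f' v' B N j T)
    from mstep_Rep(1) have "SOut (CO j) v' \<in># state_r \<theta> K" by (simp only:) simp
    from take_out_r[OF inv pre this] obtain k v K0 where
      k: "CO j = merge \<theta> k" "v' = merge \<theta> v" and
      K0: "valid \<Sigma> X X' \<theta> W (add_mset (msg k v) K0)" "prefixes K0"
      "state_l W K = add_mset (SOut k v) (state_l W K0)"
      "state_r \<theta> K = add_mset (SOut (CO j) v') (state_r \<theta> K0)"
      by (elim exE conjE) (rule that)
    have "add_mset (SOut (CO j) v') (state_r \<theta> K0) = add_mset (SOut (CO j) v') (add_mset (SRep (CI j) f') T)"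
      unfolding K0(4)[symmetric] mstep_Rep(1) by (simp add: add_mset_commute)
    then have T: "state_r \<theta> K0 = add_mset (SRep (CI j) f') T" unfolding add_mset_add_mset_same_iff .
    have "SRep (CI j) f' \<in># state_r \<theta> K0" unfolding T by (rule union_single_eq_member[OF refl])
    from take_receiver_r(2)[OF K0(1,2) this k(1)[symmetric] refl] obtain \<rho> a x Q Q' c K1 where
      K1: "K0 = add_mset (\<rho>, Rep a x Q, Rep a x Q') K1" and Q: "contr Q Q'" "\<rho> a = CI c"
        "(k, CO c) \<in> (edges W)\<^sup>*" and m: "merge \<theta> (\<rho> a) = CI j" and f': "f' = (\<lambda>w. den Q' ((merge \<theta> \<circ> \<rho>)(x := w)))"
      by (elim exE conjE) (rule that)
    have "rep P (state_l W (add_mset (msg k v) K0))" using rep unfolding K0(3) state_l_add den_msg .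
    from forward_red[OF Q(3) K0(1) this] obtain P2 where
      P2: "P \<longmapsto>* P2" "rep P2 (state_l W (add_mset (msg (CO c) v) K0))"
        "valid \<Sigma> X X' \<theta> W (add_mset (msg (CO c) v) K0)" by blast
    have inv1: "valid \<Sigma> X X' \<theta> W (add_mset (\<rho>, Rep a x Q, Rep a x Q') (add_mset (msg (CO c) v) K1))"
      using P2(3) unfolding K1 add_mset_commute[of "msg (CO c) v"] .
    from valid_comm_Rep[OF inv1 Q(2)] obtain Q'' where "Rep a x Q' = Rep a x Q''"
      "valid \<Sigma> X X' \<theta> W (add_mset (\<rho>(x := v), Q, Q'') K0)" unfolding K1 by blast
    then have inv2: "valid \<Sigma> X X' \<theta> W (add_mset (\<rho>(x := v), Q, Q') K0)" by simp
    have M1': "M1' = N + state_r \<theta> K0" unfolding mstep_Rep(2) T by simp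
    define f where "f = (\<lambda>w. den Q (\<rho>(x := w)))"
    have stK0: "state_l W K0 = add_mset (SRep (CI c) f) (state_l W K1)"
      unfolding K1 state_l_add den_l.simps den.simps Q(2) f_def ..
    have st: "state_l W (add_mset (msg (CO c) v) K0) = {#SRep (CI c) f, SOut (CO c) v#} + state_l W K1"
      unfolding state_l_add den_msg stK0 by (simp add: add_mset_commute)
    show ?thesis
    proof (rule finish[OF P2(1,2) inv2 Q(1) K0(2) mstep_Rep(3)[unfolded f' k(2)] mstep_Rep(4) M1'])
      fix Z A M assume "spill (den Q (\<rho>(x := v))) A M" "A \<inter> Z = {}"
      then have "mstep Z ({#SRep (CI c) f, SOut (CO c) v#} + state_l W K1)
          (add_mset (SRep (CI c) f) (M + state_l W K1))"
        by (intro mstep.mstep_Rep) (unfold f_def)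
      then show "mstep Z (state_l W (add_mset (msg (CO c) v) K0)) (M + state_l W K0)"
        unfolding st unfolding stK0 by (simp only: union_mset_add_mset_right)
    qed
  qed
qed

lemma contracts_barb_l:
  assumes "contracts M M'" "SOut (Succ i) SStar \<in># M"
  shows "SOut (Succ i) SStar \<in># M'"
proof -
  from assms(1) obtain \<Sigma> X X' \<theta> W K where K: "valid \<Sigma> X X' \<theta> W K" "prefixes K"
    "M = state_l W K" "M' = state_r \<theta> K" unfolding contracts_def by blast
  from take_out_l[OF K(1,2) assms(2)[unfolded K(3)]] obtain K0 where
    K0: "state_r \<theta> K = add_mset (SOut (Succ i) SStar) (state_r \<theta> K0)"
    unfolding merge.simps by (elim exE conjE) (rule that)
  show ?thesis unfolding K(4) K0 by (rule union_single_eq_member[OF refl])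
qed

text \<open>A success name may be the target of wires but never the source of one, so it is a sink
  of its class and every message merged to it can be forwarded there.\<close>

lemma contracts_barb_r:
  assumes "contracts M M'" "SOut (Succ i) SStar \<in># M'" "rep P M"
  shows "weak_barb P (Success i)"
proof -
  from assms(1) obtain \<Sigma> X X' \<theta> W K where K: "valid \<Sigma> X X' \<theta> W K" "prefixes K"
    "M = state_l W K" "M' = state_r \<theta> K" unfolding contracts_def by blast
  from take_out_r[OF K(1,2) assms(2)[unfolded K(4)]] obtain k v K0 where
    k: "Succ i = merge \<theta> k" "SStar = merge \<theta> v" and
    K0: "valid \<Sigma> X X' \<theta> W (add_mset (msg k v) K0)" "state_l W K = add_mset (SOut k v) (state_l W K0)"
    by (elim exE conjE) (rule that)
  \<comment> \<open>No other value merges to \<open>SStar\<close>: output ends in use go to values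
    satisfying \<open>is_out\<close>, and input ends stay input ends.\<close>
  have v: "v = SStar"
  proof -
    have ok: "closure_ok \<Sigma> X (msg k v)" using valid_addD(2)[OF K0(1)] .
    have "v \<noteq> CO n" for n
    proof
      assume "v = CO n"
      with ok have "n \<in> X" by (simp add: closure_ok_msg)
      from net_okD(3)[OF valid_addD(1)[OF K0(1)] this] k(2) \<open>v = CO n\<close> show False by auto
    qed
    with k(2) show ?thesis by (cases v) (auto split: sv.splits)
  qed
  have "Succ i \<notin> Domain (edges W)" using Domain_edges_E by blast
  then have "(k, Succ i) \<in> (edges W)\<^sup>*"
    by (intro reach_sink[OF K0(1)]) (use k(1)[symmetric] in simp_all)
  moreover have "rep P (state_l W (add_mset (msg k v) K0))"
    using assms(3) unfolding K(3) K0(2) state_l_add den_msg .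
  ultimately obtain Q where Q: "P \<longmapsto>* Q" "rep Q (state_l W (add_mset (msg (Succ i) v) K0))"
    using forward_red[OF _ K0(1)] by blast
  have "SOut (Succ i) SStar \<in># state_l W (add_mset (msg (Succ i) v) K0)"
    unfolding state_l_add den_msg v by (rule union_single_eq_member[OF refl])
  with rep_barb[OF Q(2)] have "barb Q (Success i)" by blast
  with Q(1) show ?thesis unfolding weak_barb_def by blast
qed

section \<open>Barbed bisimilarity\<close>

lemma rep_closed: "rep P M \<Longrightarrow> closed_proc P"
  using wt_fn_dom[of closed_env P] unfolding rep_def closed_proc_def
  by (auto simp: closed_env_def dom_def split: if_splits)

definition contracted :: "proc \<Rightarrow> proc \<Rightarrow> bool" where
  "contracted P Q \<longleftrightarrow> (\<exists>M M'. rep P M \<and> rep Q M' \<and> contracts M M')"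

lemma contractedI: "rep P M \<Longrightarrow> rep Q M' \<Longrightarrow> contracts M M' \<Longrightarrow> contracted P Q"
  unfolding contracted_def by (intro exI conjI)

lemma contracted_step_l:
  assumes "contracted P Q" "P \<longmapsto> P'"
  shows "\<exists>Q'. Q \<longmapsto>* Q' \<and> contracted P' Q'"
proof -
  from assms(1) obtain M M' where M: "rep P M" "rep Q M'" "contracts M M'"
    unfolding contracted_def by (elim exE conjE)
  from M(3) obtain \<Sigma> X X' \<theta> W K where K: "valid \<Sigma> X X' \<theta> W K" "prefixes K"
    "M = state_l W K" "M' = state_r \<theta> K" unfolding contracts_def by blast
  obtain Z where Z: "finite Z" "\<And>N. mstep Z M' N \<Longrightarrow> \<exists>Q'. Q \<longmapsto> Q' \<and> rep Q' N"
    using rep_mstep_red[OF M(2)] by blast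
  have "finite X" using net_okD(1) K(1) unfolding valid_def by blast
  from rep_red_mstep[OF M(1) assms(2) this] obtain N where N: "mstep X M N" "rep P' N" by blast
  from contracts_step_l[OF K(1,2) N(1)[unfolded K(3)] subset_refl Z(1)] show ?thesis
    unfolding K(4)[symmetric]
  proof
    assume "contracts N M'"
    from contractedI[OF N(2) M(2) this] show ?thesis by blast
  next
    assume "\<exists>N'. mstep Z M' N' \<and> contracts N N'"
    then obtain N' where N': "mstep Z M' N'" "contracts N N'" by blast
    from Z(2)[OF N'(1)] obtain Q' where Q': "Q \<longmapsto> Q'" "rep Q' N'" by blast
    from contractedI[OF N(2) Q'(2) N'(2)] Q'(1) show ?thesis by blast
  qed
qed

lemma contracted_step_r:
  assumes "contracted P Q" "Q \<longmapsto> Q'"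
  shows "\<exists>P'. P \<longmapsto>* P' \<and> contracted P' Q'"
proof -
  from assms(1) obtain M M' where M: "rep P M" "rep Q M'" "contracts M M'"
    unfolding contracted_def by (elim exE conjE)
  from M(3) obtain \<Sigma> X X' \<theta> W K where K: "valid \<Sigma> X X' \<theta> W K" "prefixes K"
    "M = state_l W K" "M' = state_r \<theta> K" unfolding contracts_def by blast
  have "finite X'" using net_okD(2) K(1) unfolding valid_def by blast
  from rep_red_mstep[OF M(2) assms(2) this] obtain N' where N': "mstep X' M' N'" "rep Q' N'" by blast
  from contracts_step_r[OF K(1,2) N'(1)[unfolded K(4)] subset_refl M(1)[unfolded K(3)]] obtain P' N where
    P': "P \<longmapsto>* P'" "rep P' N" "contracts N N'" by (elim exE conjE) (rule that)
  from contractedI[OF P'(2) N'(2) P'(3)] P'(1) show ?thesis by blast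
qed

lemma contracted_bisimilar:
  assumes "contracted P Q" shows "P \<approx> Q"
proof -
  define R where "R P Q \<longleftrightarrow> contracted P Q \<or> contracted Q P" for P Q
  have closed: "closed_proc P \<and> closed_proc Q" if "contracted P Q" for P Q
    using that rep_closed unfolding contracted_def by (elim exE conjE) (intro conjI)
  have barb_l: "weak_barb Q \<omega>" if "contracted P Q" "barb P \<omega>" for P Q \<omega>
  proof -
    from that(1) obtain M M' where M: "rep P M" "rep Q M'" "contracts M M'"
      unfolding contracted_def by (elim exE conjE)
    from that(2) rep_barb[OF M(1)] obtain i where i: "\<omega> = Success i" "SOut (Succ i) SStar \<in># M" by blast
    from contracts_barb_l[OF M(3) i(2)] rep_barb[OF M(2)] i(1) have "barb Q \<omega>" by blast
    then show ?thesis unfolding weak_barb_def by blast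
  qed
  have barb_r: "weak_barb P \<omega>" if "contracted P Q" "barb Q \<omega>" for P Q \<omega>
  proof -
    from that(1) obtain M M' where M: "rep P M" "rep Q M'" "contracts M M'"
      unfolding contracted_def by (elim exE conjE)
    from that(2) rep_barb[OF M(2)] obtain i where i: "\<omega> = Success i" "SOut (Succ i) SStar \<in># M'" by blast
    from contracts_barb_r[OF M(3) i(2) M(1)] show ?thesis unfolding i(1) .
  qed
  have "symp R" unfolding R_def by (auto intro: sympI)
  moreover have "closed_proc P \<and> closed_proc Q \<and> (\<forall>\<omega>. barb P \<omega> \<longrightarrow> weak_barb Q \<omega>) \<and>
      (\<forall>P'. P \<longmapsto> P' \<longrightarrow> (\<exists>Q'. Q \<longmapsto>* Q' \<and> R P' Q'))" if "R P Q" for P Q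
    using that unfolding R_def
  proof
    assume c: "contracted P Q"
    from closed[OF c] barb_l[OF c] contracted_step_l[OF c]
    show "closed_proc P \<and> closed_proc Q \<and> (\<forall>\<omega>. barb P \<omega> \<longrightarrow> weak_barb Q \<omega>) \<and>
      (\<forall>P'. P \<longmapsto> P' \<longrightarrow> (\<exists>Q'. Q \<longmapsto>* Q' \<and> (contracted P' Q' \<or> contracted Q' P')))" by blast
  next
    assume c: "contracted Q P"
    from closed[OF c] barb_r[OF c] contracted_step_r[OF c]
    show "closed_proc P \<and> closed_proc Q \<and> (\<forall>\<omega>. barb P \<omega> \<longrightarrow> weak_barb Q \<omega>) \<and>
      (\<forall>P'. P \<longmapsto> P' \<longrightarrow> (\<exists>Q'. Q \<longmapsto>* Q' \<and> (contracted P' Q' \<or> contracted Q' P')))" by blast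
  qed
  ultimately have "barbed_bisimulation R" unfolding barbed_bisimulation_def by blast
  moreover have "R P Q" using assms unfolding R_def by blast
  ultimately show ?thesis unfolding barbed_bisimilar_def by blast
qed

text \<open>The initial state has no channels and no wires, so the invariant reduces to the
  contraction and the typing of \<open>P\<close>, and the identity serves as
  \<open>\<theta>\<close>; all wires enter through unrolling. Linear typing is asked of the wired
  half, whose closures carry it, and simple typing of the contracted half.\<close>

lemma contr_bisimilar:
  assumes c: "contr P Q" and P: "tp closed_env P" and Q: "wt closed_env Q"
  shows "P \<approx> Q"
proof -
  define \<Sigma> :: "nat \<Rightarrow> ty" where "\<Sigma> = (\<lambda>_. Unit)"
  define \<theta> :: "nat \<Rightarrow> sv" where "\<theta> = CO"
  define \<kappa> :: closure where "\<kappa> = (closed_vals, P, Q)"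
  \<comment> \<open>\<open>env_of\<close> is total and gives all other names the type
    \<open>Unit\<close>, so it properly extends \<open>closed_env\<close>; monotonicity of
    \<open>tp\<close> bridges the gap.\<close>
  have "env_of \<Sigma> closed_vals c = closed_env c" if "c \<in> dom closed_env" for c
    using that by (cases c) (auto simp: env_of_def closed_env_def)
  then have "closed_env \<subseteq>\<^sub>m env_of \<Sigma> closed_vals" by (simp add: map_le_def)
  then have "tp (env_of \<Sigma> closed_vals) P" using P tp_mono by blast
  moreover have "ids (closed_vals c) \<subseteq> {}" for c by (cases c) simp_all
  ultimately have "closure_ok \<Sigma> {} \<kappa>" unfolding \<kappa>_def closure_ok.simps using c by simp
  moreover have "net_ok \<Sigma> {} {} \<theta> Map.empty"
  proof (rule net_okI)
    show "(u, v) \<in> (edges Map.empty)\<^sup>*" if "is_out u" "ids u \<subseteq> {}" "is_out v" "ids v \<subseteq> {}"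
      "merge \<theta> u = merge \<theta> v" for u v
      using that by (cases u; cases v) auto
  qed simp_all
  moreover have "holders m Map.empty (add_mset \<kappa> {#}) \<le> 1" for m by (simp add: holders_def)
  ultimately have inv: "valid \<Sigma> {} {} \<theta> Map.empty (add_mset \<kappa> {#})" by (intro valid_addI) simp_all
  obtain A M where A: "spill (den P closed_vals) A M" using spill_exists[OF finite.emptyI] by blast
  have merge: "merge \<theta> \<circ> closed_vals = closed_vals"
  proof
    show "(merge \<theta> \<circ> closed_vals) c = closed_vals c" for c by (cases c) simp_all
  qed
  from spill_contr[OF c inv[unfolded \<kappa>_def] A Int_empty_right finite.emptyI] obtain B N where
    B: "spill (den Q closed_vals) B N" "unrolled \<Sigma> {} {} \<theta> Map.empty {#} A B M N"
    unfolding merge by (elim exE conjE) (rule that)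
  have "contracts M N"
    using unrolled_contracts[OF B(2)] by (simp add: state_l_def wires_def prefixes_def)
  moreover have "rep P M" unfolding rep_def using tp_wt[OF P] A meq_refl by (intro conjI exI)
  moreover have "rep Q N" unfolding rep_def using Q B(1) meq_refl by (intro conjI exI)
  ultimately have "contracted P Q" by (intro contractedI)
  then show ?thesis by (rule contracted_bisimilar)
qed

theorem theorem4p2:
  fixes \<Delta> :: env and P :: proc and a b b' :: name and U :: ty
  assumes "type_env \<Delta>"
    and "\<Delta> a = Some (chan_ty a U)"
    and "companions b b'"
    and "is_I b \<longleftrightarrow> is_I a"
    and "b \<noteq> a"
    and "b' \<notin> fn P"
    and "\<Delta> \<turnstile> nu b b' U (Par (link U b' a) P)"
    and "\<Delta> \<turnstile> P\<lbrace>Nm a/b\<rbrace>"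
  shows "barbed_congruent \<Delta> (nu b b' U (Par (link U b' a) P)) (P\<lbrace>Nm a/b\<rbrace>)"
proof -
  \<comment> \<open>Freshness of \<open>b'\<close> is supplied twice because \<open>P\<close> is
    contracted to itself. Contexts need no analysis: \<open>contr\<close> is closed under them, so
    copies of the hole made by replication are contracted together.\<close>
  have c: "contr (nu b b' U (Par (link U b' a) P)) (P\<lbrace>Nm a/b\<rbrace>)"
    by (rule contr_wire[OF contr_refl assms(3,4,5,6,6)])
  have "C\<langle>nu b b' U (Par (link U b' a) P)\<rangle> \<approx> C\<langle>P\<lbrace>Nm a/b\<rbrace>\<rangle>" if C: "closing \<Delta> C" for C
    by (rule contr_bisimilar[OF contr_fill[OF c] closing_tp[OF C assms(7)]
          tp_wt[OF closing_tp[OF C assms(8)]]])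
  with assms(7,8) show ?thesis unfolding barbed_congruent_conn_def by blast
qed

end
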